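(* Let $(S,\mathcal S,\pi)$ be a $\sigma$-finite measure space and $L^0(\mathcal P_1(\mathbb R)):=L^0(S,\mathcal S,\pi;\mathcal P_1(\mathbb R))$. a) For every fixed $\nu\in L^0(\mathcal P_1(\mathbb R))$, the set $\{\mu\in L^0(\mathcal P_1(\mathbb R)) : \mu\leq_{L^0_{\rm icx}}\nu\}$, endowed with the order $\leq_{L^0_{\rm icv}}$, is a Dedekind super complete lattice, and the set $\{\mu\in L^0(\mathcal P_1(\mathbb R)) : \mu\geq_{L^0_{\rm icv}}\nu\}$, endowed with the order $\leq_{L^0_{\rm icx}}$, is a Dedekind super complete lattice. b) Let $M\subset L^0(\mathcal P_1(\mathbb R))$ be nonempty, bounded below with respect to $\leq_{L^0_{\rm icv}}$ and bounded above with respect to $\leq_{L^0_{\rm icx}}$. Let $\preceq$ be one of the two orders $\leq_{L^0_{\rm icv}}$, $\leq_{L^0_{\rm icx}}$. If $M$ is directed upwards (respectively downwards) with respect to $\preceq$, then there exists a sequence $(\mu^n)_{n\in\mathbb N}\subset M$, nondecreasing (respectively nonincreasing) with respect to $\preceq$, such that $\mu^n\to\mu$ $\pi$-a.e. in the Wasserstein-$1$ topology as $n\to\infty$, where $\mu\in L^0(\mathcal P_1(\mathbb R))$ is the supremum (respectively infimum) of $M$ with respect to $\preceq$.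
   Context: $\mathcal P_1(\mathbb R)$ is the set of all Borel probability measures $\mu$ on $\mathbb R$ with $\int_{\mathbb R}|x|\,d\mu(x)<\infty$, endowed with the Wasserstein-$1$ metric, its topology and the corresponding Borel $\sigma$-algebra $\mathcal B(\mathcal P_1(\mathbb R))$. For $\mu\in\mathcal P_1(\mathbb R)$ and $s\in\mathbb R$ set $$\mu_{1,-}(s):=\int_{\mathbb R}\min\{x-s,0\}\,d\mu(x)=-\int_{-\infty}^s\mu((-\infty,u])\,du,\qquad \mu_{1,+}(s):=\int_{\mathbb R}\max\{x-s,0\}\,d\mu(x)=\int_s^\infty\mu((u,\infty))\,du .$$ The increasing concave order (second order stochastic dominance) is $\mu\leq_{\rm icv}\nu$ iff $\mu_{1,-}(s)\leq\nu_{1,-}(s)$ for all $s\in\mathbb R$; the increasing convex order is $\mu\leq_{\rm icx}\nu$ iff $\mu_{1,+}(s)\leq\nu_{1,+}(s)$ for all $s\in\mathbb R$. Both are lattice orders on $\mathcal P_1(\mathbb R)$. $L^0(S,\mathcal S,\pi;\mathcal P_1(\mathbb R))$ is the set of all equivalence classes (with respect to $\pi$-a.e. equality) of $\mathcal S$-$\mathcal B(\mathcal P_1(\mathbb R))$-measurable functions $\mu=(\mu_t)_{t\in S}\colon S\to\mathcal P_1(\mathbb R)$. The orders are: $\mu\leq_{L^0_{\rm icv}}\nu$ iff $\mu_t\leq_{\rm icv}\nu_t$ for $\pi$-a.a. $t$, and $\mu\leq_{L^0_{\rm icx}}\nu$ iff $\mu_t\leq_{\rm icx}\nu_t$ for $\pi$-a.a.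 $t$; both are lattice orders on $L^0(\mathcal P_1(\mathbb R))$. "$\mu^n\to\mu$ $\pi$-a.e. in the Wasserstein-$1$ topology" means that $\mu^n_t\to\mu_t$ in the Wasserstein-$1$ topology for $\pi$-a.a. $t$. A lattice $L$ is Dedekind super complete if every nonempty subset of $L$ that is bounded above (respectively below) has a least upper bound (respectively greatest lower bound) and has a countable subset with the same least upper bound (respectively greatest lower bound). A subset $M$ of a lattice is directed upwards (respectively downwards) if for all $x,y\in M$ there is $z\in M$ with $x\vee y\leq z$ (respectively $x\wedge y\geq z$). *)

theory Defs
  imports "HOL-Probability.Probability" "HOL-Algebra.Lattice"
begin

definition P1 :: "real measure set" where
  "P1 = {\<mu>. sets \<mu> = sets borel \<and> prob_space \<mu> \<and> integrable \<mu> (\<lambda>x. \<bar>x\<bar>)}"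

definition couplings :: "real measure \<Rightarrow> real measure \<Rightarrow> (real \<times> real) measure set" where
  "couplings \<mu> \<nu> =
    {\<gamma>. sets \<gamma> = sets (borel \<Otimes>\<^sub>M borel) \<and> prob_space \<gamma> \<and>
         distr \<gamma> borel fst = \<mu> \<and> distr \<gamma> borel snd = \<nu>}"

text \<open>On \<^const>\<open>P1\<close> the product measure is a coupling and every coupling has finite transport
  cost, so the infimum is over a nonempty set of genuine (nonnegative) integrals.\<close>

definition W1 :: "real measure \<Rightarrow> real measure \<Rightarrow> real" where
  "W1 \<mu> \<nu> = (INF \<gamma>\<in>couplings \<mu> \<nu>. \<integral>p. \<bar>fst p - snd p\<bar> \<partial>\<gamma>)"

text \<open>The topology generated by the metric \<^const>\<open>W1\<close>. The library constant
  \<^const>\<open>Metric_space.mtopology\<close> has an accessible definition only under the metric space axioms,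
  hence the explicit form here; the two agree once these axioms are established for
  \<^const>\<open>W1\<close> (lemma \<open>W1_topology_eq_mtopology\<close>).\<close>

definition W1_topology :: "real measure topology" where
  "W1_topology =
    topology (\<lambda>U. U \<subseteq> P1 \<and> (\<forall>\<mu>\<in>U. \<exists>r>0. \<forall>\<nu>\<in>P1. W1 \<mu> \<nu> < r \<longrightarrow> \<nu> \<in> U))"

lemma openin_W1_topology:
  "openin W1_topology U \<longleftrightarrow>
     U \<subseteq> P1 \<and> (\<forall>\<mu>\<in>U. \<exists>r>0. \<forall>\<nu>\<in>P1. W1 \<mu> \<nu> < r \<longrightarrow> \<nu> \<in> U)"
proof -
  define Q where "Q = (\<lambda>U. U \<subseteq> P1 \<and> (\<forall>\<mu>\<in>U. \<exists>r>0. \<forall>\<nu>\<in>P1. W1 \<mu> \<nu> < r \<longrightarrow> \<nu> \<in> U))"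
  have "Q (A \<inter> B)" if A: "Q A" and B: "Q B" for A B
    unfolding Q_def
  proof (intro conjI ballI)
    show "A \<inter> B \<subseteq> P1" using A by (auto simp: Q_def)
    fix \<mu> assume "\<mu> \<in> A \<inter> B"
    then have "\<exists>r>0. \<forall>\<nu>\<in>P1. W1 \<mu> \<nu> < r \<longrightarrow> \<nu> \<in> A" "\<exists>s>0. \<forall>\<nu>\<in>P1. W1 \<mu> \<nu> < s \<longrightarrow> \<nu> \<in> B"
      using A B by (auto simp: Q_def)
    then obtain r s where "r > 0" "\<forall>\<nu>\<in>P1. W1 \<mu> \<nu> < r \<longrightarrow> \<nu> \<in> A"
      "s > 0" "\<forall>\<nu>\<in>P1. W1 \<mu> \<nu> < s \<longrightarrow> \<nu> \<in> B"
      by blast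
    then show "\<exists>r>0. \<forall>\<nu>\<in>P1. W1 \<mu> \<nu> < r \<longrightarrow> \<nu> \<in> A \<inter> B"
      by (intro exI[of _ "min r s"]) auto
  qed
  moreover have "Q (\<Union>K)" if K: "\<forall>A\<in>K. Q A" for K
    unfolding Q_def
  proof (intro conjI ballI)
    show "\<Union>K \<subseteq> P1" using K by (auto simp: Q_def)
    fix \<mu> assume "\<mu> \<in> \<Union>K"
    then obtain A where A: "A \<in> K" "\<mu> \<in> A" by blast
    with K have "\<exists>r>0. \<forall>\<nu>\<in>P1. W1 \<mu> \<nu> < r \<longrightarrow> \<nu> \<in> A" by (auto simp: Q_def)
    with A show "\<exists>r>0. \<forall>\<nu>\<in>P1. W1 \<mu> \<nu> < r \<longrightarrow> \<nu> \<in> \<Union>K" by blast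
  qed
  ultimately have "istopology Q"
    by (simp add: istopology_def)
  then have "openin (topology Q) = Q"
    by (rule topology_inverse')
  then show ?thesis
    by (simp add: W1_topology_def Q_def)
qed

lemma W1_topology_eq_mtopology:
  assumes "Metric_space P1 W1"
  shows "W1_topology = Metric_space.mtopology P1 W1"
  unfolding topology_eq openin_W1_topology Metric_space.openin_mtopology[OF assms]
    Metric_space.mball_def[OF assms]
  by (intro allI conj_cong refl) blast

definition borel_P1 :: "real measure measure" where
  "borel_P1 = sigma P1 {U. openin W1_topology U}"

definition int_minus :: "real measure \<Rightarrow> real \<Rightarrow> real" where
  "int_minus \<mu> s = (\<integral>x. min (x - s) 0 \<partial>\<mu>)"

definition int_plus :: "real measure \<Rightarrow> real \<Rightarrow> real" where
  "int_plus \<mu> s = (\<integral>x. max (x - s) 0 \<partial>\<mu>)"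

definition leq_icv :: "real measure \<Rightarrow> real measure \<Rightarrow> bool" where
  "leq_icv \<mu> \<nu> \<longleftrightarrow> (\<forall>s. int_minus \<mu> s \<le> int_minus \<nu> s)"

definition leq_icx :: "real measure \<Rightarrow> real measure \<Rightarrow> bool" where
  "leq_icx \<mu> \<nu> \<longleftrightarrow> (\<forall>s. int_plus \<mu> s \<le> int_plus \<nu> s)"

definition ae_rel :: "'s measure \<Rightarrow> (('s \<Rightarrow> real measure) \<times> ('s \<Rightarrow> real measure)) set" where
  "ae_rel \<pi> = {(f, g). f \<in> measurable \<pi> borel_P1 \<and> g \<in> measurable \<pi> borel_P1 \<and>
                        (AE t in \<pi>. f t = g t)}"

definition L0 :: "'s measure \<Rightarrow> ('s \<Rightarrow> real measure) set set" where
  "L0 \<pi> = measurable \<pi> borel_P1 // ae_rel \<pi>"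

text \<open>Relations between classes are defined through some choice of representatives; the lemmas
  below show that the choice is immaterial.\<close>

definition lift_AE ::
  "'s measure \<Rightarrow> (real measure \<Rightarrow> real measure \<Rightarrow> bool) \<Rightarrow>
   ('s \<Rightarrow> real measure) set \<Rightarrow> ('s \<Rightarrow> real measure) set \<Rightarrow> bool" where
  "lift_AE \<pi> R \<mu> \<nu> \<longleftrightarrow> (\<exists>f\<in>\<mu>. \<exists>g\<in>\<nu>. AE t in \<pi>. R (f t) (g t))"

definition L0_icv :: "'s measure \<Rightarrow> ('s \<Rightarrow> real measure) set gorder" where
  "L0_icv \<pi> = \<lparr>carrier = L0 \<pi>, eq = (=), le = lift_AE \<pi> leq_icv\<rparr>"

definition L0_icx :: "'s measure \<Rightarrow> ('s \<Rightarrow> real measure) set gorder" where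
  "L0_icx \<pi> = \<lparr>carrier = L0 \<pi>, eq = (=), le = lift_AE \<pi> leq_icx\<rparr>"

definition AE_W1_tendsto ::
  "'s measure \<Rightarrow> (nat \<Rightarrow> ('s \<Rightarrow> real measure) set) \<Rightarrow> ('s \<Rightarrow> real measure) set \<Rightarrow> bool" where
  "AE_W1_tendsto \<pi> \<mu>s \<mu> \<longleftrightarrow>
    (\<exists>f g. (\<forall>n. f n \<in> \<mu>s n) \<and> g \<in> \<mu> \<and>
       (AE t in \<pi>. limitin W1_topology (\<lambda>n. f n t) (g t) sequentially))"

lemma equiv_ae_rel: "equiv (measurable \<pi> borel_P1) (ae_rel \<pi>)"
proof (rule equivI)
  show "ae_rel \<pi> \<subseteq> measurable \<pi> borel_P1 \<times> measurable \<pi> borel_P1"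
    by (auto simp: ae_rel_def)
  show "refl_on (measurable \<pi> borel_P1) (ae_rel \<pi>)"
    by (auto simp: refl_on_def ae_rel_def)
  show "sym (ae_rel \<pi>)"
    by (auto simp: sym_def ae_rel_def eq_commute)
  show "trans (ae_rel \<pi>)"
    by (rule transI) (auto simp: ae_rel_def elim: eventually_elim2)
qed

lemma L0_AE_eq:
  assumes "\<mu> \<in> L0 \<pi>" "f \<in> \<mu>" "g \<in> \<mu>"
  shows "AE t in \<pi>. f t = g t"
proof -
  have "(f, g) \<in> ae_rel \<pi>"
    using quotient_eq_iff[OF equiv_ae_rel] assms unfolding L0_def by metis
  then show ?thesis
    by (simp add: ae_rel_def)
qed

lemma lift_AE_iff:
  assumes "\<mu> \<in> L0 \<pi>" "\<nu> \<in> L0 \<pi>" "f \<in> \<mu>" "g \<in> \<nu>"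
  shows "lift_AE \<pi> R \<mu> \<nu> \<longleftrightarrow> (AE t in \<pi>. R (f t) (g t))"
proof
  assume "lift_AE \<pi> R \<mu> \<nu>"
  then obtain f' g' where "f' \<in> \<mu>" "g' \<in> \<nu>" and R: "AE t in \<pi>. R (f' t) (g' t)"
    by (auto simp: lift_AE_def)
  have "AE t in \<pi>. f' t = f t" "AE t in \<pi>. g' t = g t"
    using L0_AE_eq[OF assms(1) \<open>f' \<in> \<mu>\<close> assms(3)] L0_AE_eq[OF assms(2) \<open>g' \<in> \<nu>\<close> assms(4)] .
  with R show "AE t in \<pi>. R (f t) (g t)"
    by eventually_elim simp
qed (use assms in \<open>auto simp: lift_AE_def\<close>)

lemma AE_W1_tendsto_iff:
  assumes "\<And>n. \<mu>s n \<in> L0 \<pi>" "\<mu> \<in> L0 \<pi>" "\<And>n. f n \<in> \<mu>s n" "g \<in> \<mu>"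
  shows "AE_W1_tendsto \<pi> \<mu>s \<mu> \<longleftrightarrow>
    (AE t in \<pi>. limitin W1_topology (\<lambda>n. f n t) (g t) sequentially)"
proof
  assume "AE_W1_tendsto \<pi> \<mu>s \<mu>"
  then obtain f' g' where f': "\<And>n. f' n \<in> \<mu>s n" and g': "g' \<in> \<mu>"
    and lim: "AE t in \<pi>. limitin W1_topology (\<lambda>n. f' n t) (g' t) sequentially"
    by (auto simp: AE_W1_tendsto_def)
  have "AE t in \<pi>. \<forall>n. f' n t = f n t"
    using L0_AE_eq[OF assms(1) f' assms(3)] by (simp add: AE_all_countable)
  moreover have "AE t in \<pi>. g' t = g t"
    using L0_AE_eq[OF assms(2) g' assms(4)] .
  ultimately show "AE t in \<pi>. limitin W1_topology (\<lambda>n. f n t) (g t) sequentially"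
    using lim by eventually_elim simp
qed (use assms in \<open>auto simp: AE_W1_tendsto_def\<close>)

definition dedekind_super_complete_lattice :: "('a, 'b) gorder_scheme \<Rightarrow> bool" where
  "dedekind_super_complete_lattice L \<longleftrightarrow>
    Lattice.lattice L \<and>
    (\<forall>A. A \<subseteq> carrier L \<and> A \<noteq> {} \<and> Upper L A \<noteq> {} \<longrightarrow>
      (\<exists>s. is_lub L s A \<and> (\<exists>C\<subseteq>A. countable C \<and> is_lub L s C))) \<and>
    (\<forall>A. A \<subseteq> carrier L \<and> A \<noteq> {} \<and> Lower L A \<noteq> {} \<longrightarrow>
      (\<exists>i. is_glb L i A \<and> (\<exists>C\<subseteq>A. countable C \<and> is_glb L i C)))"

definition directed_upwards :: "('a, 'b) gorder_scheme \<Rightarrow> 'a set \<Rightarrow> bool" where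
  "directed_upwards L M \<longleftrightarrow> (\<forall>x\<in>M. \<forall>y\<in>M. \<exists>z\<in>M. x \<squnion>\<^bsub>L\<^esub> y \<sqsubseteq>\<^bsub>L\<^esub> z)"

definition directed_downwards :: "('a, 'b) gorder_scheme \<Rightarrow> 'a set \<Rightarrow> bool" where
  "directed_downwards L M \<longleftrightarrow> (\<forall>x\<in>M. \<forall>y\<in>M. \<exists>z\<in>M. z \<sqsubseteq>\<^bsub>L\<^esub> x \<sqinter>\<^bsub>L\<^esub> y)"

end

theory Submission
  imports Defs
begin

text \<open>
  A measure in \<open>P1\<close> is encoded by the concave function \<open>int_minus \<mu>\<close>; conversely, every concave
  \<open>\<phi>\<close> with \<open>\<phi> s \<longrightarrow> 0\<close> at \<open>-\<infinity>\<close> and \<open>\<phi> s + s\<close> convergent at \<open>\<infinity>\<close> arises in this way, the right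
  derivative of \<open>- \<phi>\<close> being the distribution function. Hence pointwise infima of such functions, if
  bounded below, are again of this form, and essential infima of the values at rational points, which
  are attained along countable subfamilies, give infima in \<open>L0\<close>. A supremum is the infimum of all
  upper bounds, among which is the Dirac mass at the essential supremum of the means; this
  is what keeps the supremum below a given bound in the increasing convex order. The increasing
  convex order is reduced to the increasing concave one by the reflection \<open>x \<mapsto> - x\<close>.

  For part b), convergence of \<open>int_minus\<close> and \<open>int_plus\<close> at the rational points is equivalent to
  Wasserstein convergence (Skorohod coupling and Scheffe's lemma), so \<open>P1\<close> embeds topologically into a
  countable product of lines, which also settles all measurability questions. Along a monotone
  sequence \<open>int_minus\<close> converges, and the upper bound in the increasing convex order
  forces the means, hence \<open>int_plus\<close>, to converge as well.
\<close>

subsection \<open>Truncated means\<close>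

text \<open>The two orders compare different functions, and the mean is the link between them:
  \<open>int_plus \<mu> s + int_minus \<mu> s\<close> is the mean minus \<open>s\<close>.
  Information on one function reaches the other only once the means are controlled, and this is the
  task of the second, opposite bound. Convergence can fail without it: the measures with mass 1 -
  1/n at 0 and mass 1/n at n decrease in \<open>leq_icv\<close> to the Dirac mass at 0, but their
  means and their Wasserstein distances to it stay equal to 1.

  The other obstacle is null sets. Each comparison holds off a null set of its own and families may
  be uncountable, so a pointwise infimum over the whole family need not be measurable or respect
  equivalence classes. Inequalities are therefore tested on countably many members and at rational
  points, then extended by continuity in \<open>s\<close>.

  Infima and suprema for both orders make four cases. All are phrased as greatest lower bounds for a
  relation \<open>R\<close>, a supremum being one for the converse relation.\<close>

lemma P1_D:
  assumes "\<mu> \<in> P1"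
  shows "prob_space \<mu>" "sets \<mu> = sets borel" "real_distribution \<mu>" "integrable \<mu> (\<lambda>x. x)"
proof -
  show *: "prob_space \<mu>" "sets \<mu> = sets borel" using assms by (auto simp: P1_def)
  then show "real_distribution \<mu>"
    by (simp add: real_distribution_def real_distribution_axioms_def)
  have "(\<lambda>x::real. x) \<in> borel_measurable \<mu>"
    by (subst measurable_cong_sets[OF *(2) refl]) simp
  then show "integrable \<mu> (\<lambda>x. x)"
    using assms integrable_abs_iff by (auto simp: P1_def)
qed

lemma P1_I:
  assumes "prob_space \<mu>" "sets \<mu> = sets borel" "integrable \<mu> (\<lambda>x. x)"
  shows "\<mu> \<in> P1"
  using assms by (simp add: P1_def)

lemma integrable_truncations:
  assumes "\<mu> \<in> P1"
  shows "integrable \<mu> (\<lambda>x. min (x - s) 0)" "integrable \<mu> (\<lambda>x. max (x - s) 0)"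
proof -
  interpret prob_space \<mu> by (rule P1_D[OF assms])
  have "integrable \<mu> (\<lambda>x. x - s)" using P1_D(4)[OF assms] by simp
  then show "integrable \<mu> (\<lambda>x. min (x - s) 0)" "integrable \<mu> (\<lambda>x. max (x - s) 0)" by auto
qed

lemma int_plus_minus:
  assumes "\<mu> \<in> P1"
  shows "int_plus \<mu> s + int_minus \<mu> s = (\<integral>x. x \<partial>\<mu>) - s"
proof -
  interpret prob_space \<mu> by (rule P1_D[OF assms])
  have "int_plus \<mu> s + int_minus \<mu> s = (\<integral>x. max (x - s) 0 + min (x - s) 0 \<partial>\<mu>)"
    unfolding int_plus_def int_minus_def using integrable_truncations[OF assms] by simp
  also have "\<dots> = (\<integral>x. x - s \<partial>\<mu>)"
    by (rule Bochner_Integration.integral_cong) auto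
  finally show ?thesis using P1_D(4)[OF assms] by (simp add: prob_space)
qed

lemma int_minus_nonpos: "int_minus \<mu> s \<le> 0"
proof -
  have "0 \<le> (\<integral>x. - min (x - s) 0 \<partial>\<mu>)" by (rule Bochner_Integration.integral_nonneg) auto
  then show ?thesis by (simp only: int_minus_def Bochner_Integration.integral_minus neg_0_le_iff_le)
qed

lemma int_plus_nonneg: "0 \<le> int_plus \<mu> s"
  unfolding int_plus_def by (rule Bochner_Integration.integral_nonneg) auto

lemma int_minus_le_mean:
  assumes "\<mu> \<in> P1"
  shows "int_minus \<mu> s \<le> (\<integral>x. x \<partial>\<mu>) - s"
  using int_plus_minus[OF assms, of s] int_plus_nonneg[of \<mu> s] by simp

text \<open>The difference of the two integrands is \<open>b - a\<close> for
  \<open>x \<le> a\<close>, vanishes for \<open>x \<ge> b\<close> and is linear in between, so it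
  lies between \<open>b - a\<close> times the indicators of \<open>{..a}\<close> and of
  \<open>{..b}\<close>. These bounds replace differentiation wherever the distribution function is
  recovered from \<open>int_minus\<close>.\<close>

lemma int_minus_cdf:
  assumes "\<mu> \<in> P1" "a \<le> b"
  shows "(b - a) * cdf \<mu> a \<le> int_minus \<mu> a - int_minus \<mu> b"
    "int_minus \<mu> a - int_minus \<mu> b \<le> (b - a) * cdf \<mu> b"
proof -
  interpret real_distribution \<mu> by (rule P1_D[OF assms(1)])
  note int = integrable_truncations[OF assms(1)]
  have eq: "int_minus \<mu> a - int_minus \<mu> b = (\<integral>x. min (x - a) 0 - min (x - b) 0 \<partial>\<mu>)"
    unfolding int_minus_def using int by simp
  have ind: "(b - a) * cdf \<mu> c = (\<integral>x. (b - a) * indicator {..c} x \<partial>\<mu>)" for c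
    by (simp add: cdf_def)
  have indi: "integrable \<mu> (\<lambda>x. (b - a) * indicator {..c} x)" for c
    by (auto intro!: integrable_real_indicator simp: emeasure_eq_measure)
  show "(b - a) * cdf \<mu> a \<le> int_minus \<mu> a - int_minus \<mu> b"
    unfolding eq ind using assms(2)
    by (intro integral_mono indi Bochner_Integration.integrable_diff int) (auto simp: indicator_def min_def)
  show "int_minus \<mu> a - int_minus \<mu> b \<le> (b - a) * cdf \<mu> b"
    unfolding eq ind using assms(2)
    by (intro integral_mono indi Bochner_Integration.integrable_diff int) (auto simp: indicator_def min_def)
qed

lemma int_minus_antimono:
  assumes "\<mu> \<in> P1" "a \<le> b"
  shows "int_minus \<mu> b \<le> int_minus \<mu> a"
proof -
  have "0 \<le> (b - a) * cdf \<mu> a" using assms(2) by (simp add: cdf_def)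
  then show ?thesis using int_minus_cdf(1)[OF assms] by simp
qed

lemma int_minus_add_mono:
  assumes "\<mu> \<in> P1" "a \<le> b"
  shows "int_minus \<mu> a + a \<le> int_minus \<mu> b + b"
proof -
  interpret real_distribution \<mu> by (rule P1_D[OF assms(1)])
  have "(b - a) * cdf \<mu> b \<le> (b - a) * 1"
    using assms(2) cdf_bounded_prob by (intro mult_left_mono) auto
  then show ?thesis using int_minus_cdf(2)[OF assms] by simp
qed

lemma continuous_int_minus:
  assumes "\<mu> \<in> P1"
  shows "continuous_on UNIV (int_minus \<mu>)"
proof -
  have *: "\<bar>int_minus \<mu> a - int_minus \<mu> b\<bar> \<le> 1 * \<bar>a - b\<bar>" for a b
    using int_minus_antimono[OF assms, of a b] int_minus_antimono[OF assms, of b a]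
      int_minus_add_mono[OF assms, of a b] int_minus_add_mono[OF assms, of b a]
    by (cases "a \<le> b") auto
  have "1-lipschitz_on UNIV (int_minus \<mu>)"
    by (rule lipschitz_onI) (use * in \<open>auto simp: dist_real_def\<close>)
  then show ?thesis by (rule lipschitz_on_continuous_on)
qed

text \<open>Comparing increments over [a, b] gives \<open>cdf \<mu> a \<le> cdf \<nu> b\<close> for
  every b > a, and right continuity lets b tend to a. Antisymmetry of both orders on
  \<open>P1\<close> rests on this injectivity.\<close>

lemma int_minus_eqD:
  assumes \<mu>: "\<mu> \<in> P1" and \<nu>: "\<nu> \<in> P1" and eq: "int_minus \<mu> = int_minus \<nu>"
  shows "\<mu> = \<nu>"
proof -
  have le: "cdf \<mu> a \<le> cdf \<nu> a" if \<mu>: "\<mu> \<in> P1" and \<nu>: "\<nu> \<in> P1" and eq: "int_minus \<mu> = int_minus \<nu>"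
    for \<mu> \<nu> a
  proof -
    interpret real_distribution \<nu> by (rule P1_D[OF \<nu>])
    have "cdf \<mu> a \<le> cdf \<nu> b" if "a < b" for b
    proof -
      have "(b - a) * cdf \<mu> a \<le> (b - a) * cdf \<nu> b"
        using int_minus_cdf(1)[OF \<mu>, of a b] int_minus_cdf(2)[OF \<nu>, of a b] fun_cong[OF eq, of a]
          fun_cong[OF eq, of b] that by linarith
      then show ?thesis using that by (simp add: mult_le_cancel_left_pos)
    qed
    then have ev: "\<forall>\<^sub>F b in at_right a. cdf \<mu> a \<le> cdf \<nu> b"
      by (auto simp: eventually_at_filter)
    have "(cdf \<nu> \<longlongrightarrow> cdf \<nu> a) (at_right a)"
      using cdf_is_right_cont[of a] by (simp add: continuous_within)
    from tendsto_lowerbound[OF this ev] show ?thesis by simp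
  qed
  have "cdf \<mu> = cdf \<nu>"
    using le[OF \<mu> \<nu> eq] le[OF \<nu> \<mu> eq[symmetric]] by (intro ext antisym)
  then show ?thesis using cdf_unique P1_D(3) \<mu> \<nu> by blast
qed

lemma int_minus_at_bot:
  assumes "\<mu> \<in> P1"
  shows "(int_minus \<mu> \<longlongrightarrow> 0) at_bot"
proof -
  interpret real_distribution \<mu> by (rule P1_D[OF assms(1)])
  have "((\<lambda>s. \<integral>x. min (x - (- s)) 0 \<partial>\<mu>) \<longlongrightarrow> (\<integral>x. 0 \<partial>\<mu>)) at_top"
  proof (rule integral_dominated_convergence_at_top[where w="\<lambda>x. \<bar>x\<bar>"])
    show "AE x in \<mu>. ((\<lambda>s. min (x - - s) 0) \<longlongrightarrow> 0) at_top"
    proof (rule AE_I2)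
      fix x :: real
      have "\<forall>\<^sub>F s in at_top. min (x - - s) 0 = 0"
        using eventually_ge_at_top[of "-x"] by eventually_elim auto
      then show "((\<lambda>s. min (x - - s) 0) \<longlongrightarrow> 0) at_top" by (rule tendsto_eventually)
    qed
    show "\<forall>\<^sub>F i in at_top. AE x in \<mu>. norm (min (x - - i) 0) \<le> \<bar>x\<bar>"
      using eventually_ge_at_top[of 0]
    proof eventually_elim
      case (elim i)
      then have "norm (min (x - - i) 0) \<le> \<bar>x\<bar>" for x :: real by (simp add: min_def)
      then show ?case by simp
    qed
    show "integrable \<mu> (\<lambda>x. \<bar>x\<bar>)" using P1_D(4)[OF assms] by (rule integrable_abs)
  qed simp_all
  then have "((\<lambda>s. int_minus \<mu> (- s)) \<longlongrightarrow> 0) at_top" by (simp add: int_minus_def[abs_def])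
  then show ?thesis by (simp add: filterlim_at_bot_mirror)
qed

text \<open>Here \<open>min (x - s) 0 + s\<close> is the minimum of x and s, which tends to x and is
  dominated by \<bar>x\<bar> for nonnegative s. The mean, and with it \<open>int_plus\<close>, can
  thus be read off from \<open>int_minus\<close> alone.\<close>

lemma int_minus_add_at_top:
  assumes "\<mu> \<in> P1"
  shows "((\<lambda>s. int_minus \<mu> s + s) \<longlongrightarrow> (\<integral>x. x \<partial>\<mu>)) at_top"
proof -
  interpret real_distribution \<mu> by (rule P1_D[OF assms(1)])
  have "((\<lambda>s. \<integral>x. min (x - s) 0 + s \<partial>\<mu>) \<longlongrightarrow> (\<integral>x. x \<partial>\<mu>)) at_top"
  proof (rule integral_dominated_convergence_at_top[where w="\<lambda>x. \<bar>x\<bar>"])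
    show "AE x in \<mu>. ((\<lambda>s. min (x - s) 0 + s) \<longlongrightarrow> x) at_top"
    proof (rule AE_I2)
      fix x :: real
      have "\<forall>\<^sub>F s in at_top. min (x - s) 0 + s = x"
        using eventually_ge_at_top[of x] by eventually_elim auto
      then show "((\<lambda>s. min (x - s) 0 + s) \<longlongrightarrow> x) at_top" by (rule tendsto_eventually)
    qed
    show "\<forall>\<^sub>F i in at_top. AE x in \<mu>. norm (min (x - i) 0 + i) \<le> \<bar>x\<bar>"
      using eventually_ge_at_top[of 0]
    proof eventually_elim
      case (elim i)
      then have "norm (min (x - i) 0 + i) \<le> \<bar>x\<bar>" for x :: real by (simp add: min_def)
      then show ?case by simp
    qed
    show "integrable \<mu> (\<lambda>x. \<bar>x\<bar>)" using P1_D(4)[OF assms] by (rule integrable_abs)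
  qed (simp_all add: measurable_finite_borel)
  moreover have "(\<integral>x. min (x - s) 0 + s \<partial>\<mu>) = int_minus \<mu> s + s" for s
    unfolding int_minus_def using integrable_truncations[OF assms] prob_space
    by (simp add: Bochner_Integration.integral_add)
  ultimately show ?thesis by simp
qed

lemma int_plus_at_top:
  assumes "\<mu> \<in> P1"
  shows "(int_plus \<mu> \<longlongrightarrow> 0) at_top"
proof -
  have "((\<lambda>s. (\<integral>x. x \<partial>\<mu>) - (int_minus \<mu> s + s)) \<longlongrightarrow> (\<integral>x. x \<partial>\<mu>) - (\<integral>x. x \<partial>\<mu>)) at_top"
    by (intro tendsto_diff tendsto_const int_minus_add_at_top[OF assms])
  moreover have "(\<integral>x. x \<partial>\<mu>) - (int_minus \<mu> s + s) = int_plus \<mu> s" for s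
    using int_plus_minus[OF assms, of s] by simp
  ultimately show ?thesis by simp
qed

lemma concave_int_minus:
  assumes "\<mu> \<in> P1"
  shows "concave_on UNIV (int_minus \<mu>)"
  unfolding concave_on_def
proof (rule convex_onI)
  fix t x y :: real assume t: "0 < t" "t < 1"
  note int = integrable_truncations[OF assms]
  have "(1 - t) * int_minus \<mu> x + t * int_minus \<mu> y
      = (\<integral>z. (1 - t) * min (z - x) 0 + t * min (z - y) 0 \<partial>\<mu>)"
    unfolding int_minus_def using int by simp
  also have "\<dots> \<le> int_minus \<mu> ((1 - t) * x + t * y)"
    unfolding int_minus_def
  proof (intro integral_mono int)
    fix z
    have "(1 - t) * min (z - x) 0 \<le> (1 - t) * (z - x)" "(1 - t) * min (z - x) 0 \<le> (1 - t) * 0"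
      "t * min (z - y) 0 \<le> t * (z - y)" "t * min (z - y) 0 \<le> t * 0"
      using t by (intro mult_left_mono; simp)+
    moreover have "(1 - t) * (z - x) + t * (z - y) = z - ((1 - t) * x + t * y)" by algebra
    ultimately show "(1 - t) * min (z - x) 0 + t * min (z - y) 0 \<le> min (z - ((1 - t) * x + t * y)) 0"
      by linarith
  qed (use int in auto)
  finally show "- int_minus \<mu> ((1 - t) *\<^sub>R x + t *\<^sub>R y) \<le> (1 - t) * - int_minus \<mu> x + t * - int_minus \<mu> y"
    by simp
qed simp

section \<open>Couplings and Lipschitz functionals of the Wasserstein distance\<close>

lemma couplings_nonempty:
  assumes "\<mu> \<in> P1" "\<nu> \<in> P1"
  shows "couplings \<mu> \<nu> \<noteq> {}"
proof -
  interpret m: prob_space \<mu> by (rule P1_D[OF assms(1)])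
  interpret n: prob_space \<nu> by (rule P1_D[OF assms(2)])
  interpret pair_prob_space \<mu> \<nu> ..
  note s[measurable_cong] = P1_D(2)[OF assms(1)] P1_D(2)[OF assms(2)]
  have "distr (\<mu> \<Otimes>\<^sub>M \<nu>) borel fst = distr (\<mu> \<Otimes>\<^sub>M \<nu>) \<mu> fst" "distr (\<mu> \<Otimes>\<^sub>M \<nu>) borel snd = distr (\<mu> \<Otimes>\<^sub>M \<nu>) \<nu> snd"
    using s by (auto intro: distr_cong)
  moreover have "distr (\<mu> \<Otimes>\<^sub>M \<nu>) \<mu> fst = \<mu>"
    using n.distr_pair_fst[of \<mu>] by simp
  moreover have "distr (\<mu> \<Otimes>\<^sub>M \<nu>) \<nu> snd = \<nu>"
  proof (rule measure_eqI)
    fix A assume A: "A \<in> sets (distr (\<mu> \<Otimes>\<^sub>M \<nu>) \<nu> snd)"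
    then have "snd -` A \<inter> space (\<mu> \<Otimes>\<^sub>M \<nu>) = space \<mu> \<times> A"
      by (auto simp: space_pair_measure dest: sets.sets_into_space)
    with A show "emeasure (distr (\<mu> \<Otimes>\<^sub>M \<nu>) \<nu> snd) A = emeasure \<nu> A"
      by (simp add: emeasure_distr n.emeasure_pair_measure_Times m.emeasure_space_1)
  qed simp
  ultimately have "\<mu> \<Otimes>\<^sub>M \<nu> \<in> couplings \<mu> \<nu>"
    using s prob_space_axioms by (auto simp: couplings_def cong: sets_pair_measure_cong)
  then show ?thesis by blast
qed

text \<open>The easy half of Kantorovich-Rubinstein duality: under any coupling both integrals
  become integrals over the joint law, where the Lipschitz bound applies pointwise. It makes the
  truncated means and the mean continuous, hence Borel, on \<open>P1\<close>.\<close>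

lemma W1_lipschitz:
  fixes f :: "real \<Rightarrow> real"
  assumes P: "\<mu> \<in> P1" "\<nu> \<in> P1" and lip: "\<And>x y. \<bar>f x - f y\<bar> \<le> \<bar>x - y\<bar>"
    and int: "integrable \<mu> f" "integrable \<nu> f"
  shows "\<bar>(\<integral>x. f x \<partial>\<mu>) - (\<integral>x. f x \<partial>\<nu>)\<bar> \<le> W1 \<mu> \<nu>"
  unfolding W1_def
proof (rule cINF_greatest[OF couplings_nonempty[OF P]])
  fix \<gamma> assume "\<gamma> \<in> couplings \<mu> \<nu>"
  then have s[measurable_cong]: "sets \<gamma> = sets (borel \<Otimes>\<^sub>M borel)"
    and d: "distr \<gamma> borel fst = \<mu>" "distr \<gamma> borel snd = \<nu>"
    by (auto simp: couplings_def)
  have [measurable]: "f \<in> borel_measurable borel"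
    using borel_measurable_integrable[OF int(1)] by (subst (asm) measurable_cong_sets[OF P1_D(2)[OF P(1)] refl])
  have i: "integrable \<gamma> (\<lambda>p. f (fst p))" "integrable \<gamma> (\<lambda>p. f (snd p))"
    by (rule integrable_distr[of _ \<gamma> borel f]; simp add: d int)+
  have i': "integrable \<gamma> (\<lambda>p. fst p)" "integrable \<gamma> (\<lambda>p. snd p)"
    by (rule integrable_distr[of _ \<gamma> borel "\<lambda>x. x"]; simp add: d P1_D(4)[OF P(1)] P1_D(4)[OF P(2)])+
  have "(\<integral>x. f x \<partial>\<mu>) = (\<integral>p. f (fst p) \<partial>\<gamma>)" "(\<integral>x. f x \<partial>\<nu>) = (\<integral>p. f (snd p) \<partial>\<gamma>)"
    by (subst d[symmetric], subst integral_distr; simp)+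
  then have "\<bar>(\<integral>x. f x \<partial>\<mu>) - (\<integral>x. f x \<partial>\<nu>)\<bar> = \<bar>\<integral>p. f (fst p) - f (snd p) \<partial>\<gamma>\<bar>"
    using i by simp
  also have "\<dots> \<le> (\<integral>p. \<bar>f (fst p) - f (snd p)\<bar> \<partial>\<gamma>)"
    by (rule integral_abs_bound)
  also have "\<dots> \<le> (\<integral>p. \<bar>fst p - snd p\<bar> \<partial>\<gamma>)"
    using i i' lip by (intro integral_mono) auto
  finally show "\<bar>(\<integral>x. f x \<partial>\<mu>) - (\<integral>x. f x \<partial>\<nu>)\<bar> \<le> (\<integral>p. \<bar>fst p - snd p\<bar> \<partial>\<gamma>)" .
qed

lemma W1_truncation_lipschitz:
  assumes P: "\<mu> \<in> P1" "\<nu> \<in> P1"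
  shows "\<bar>int_minus \<mu> s - int_minus \<nu> s\<bar> \<le> W1 \<mu> \<nu>" "\<bar>int_plus \<mu> s - int_plus \<nu> s\<bar> \<le> W1 \<mu> \<nu>"
  unfolding int_minus_def int_plus_def
  using integrable_truncations[OF P(1)] integrable_truncations[OF P(2)]
  by (auto intro!: W1_lipschitz[OF P])

lemma space_borel_P1 [simp]: "space borel_P1 = P1"
  unfolding borel_P1_def by (rule space_measure_of) (auto simp: openin_W1_topology)

lemma sets_borel_P1: "sets borel_P1 = sigma_sets P1 {U. openin W1_topology U}"
  unfolding borel_P1_def by (rule sets_measure_of) (auto simp: openin_W1_topology)

text \<open>The sets where \<Psi> is below \<open>y\<close> are open, since the ball of radius
  \<open>y - \<Psi> \<mu>\<close> about \<mu> stays inside, and the half-lines below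
  \<open>y\<close> generate the Borel sets of the line.\<close>

lemma borel_P1_measurable_lipschitz:
  assumes "\<And>\<mu> \<nu>. \<mu> \<in> P1 \<Longrightarrow> \<nu> \<in> P1 \<Longrightarrow> \<bar>\<Psi> \<mu> - \<Psi> \<nu>\<bar> \<le> W1 \<mu> \<nu>"
  shows "\<Psi> \<in> borel_measurable borel_P1"
proof (rule borel_measurableI_less)
  fix y :: real
  have "openin W1_topology {\<mu> \<in> P1. \<Psi> \<mu> < y}"
    unfolding openin_W1_topology
  proof (intro conjI ballI)
    fix \<mu> assume \<mu>: "\<mu> \<in> {\<mu> \<in> P1. \<Psi> \<mu> < y}"
    have "\<Psi> \<nu> < y" if "\<nu> \<in> P1" "W1 \<mu> \<nu> < y - \<Psi> \<mu>" for \<nu>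
      using assms[of \<mu> \<nu>] that \<mu> by auto
    then show "\<exists>r>0. \<forall>\<nu>\<in>P1. W1 \<mu> \<nu> < r \<longrightarrow> \<nu> \<in> {\<mu> \<in> P1. \<Psi> \<mu> < y}"
      using \<mu> by (intro exI[of _ "y - \<Psi> \<mu>"]) auto
  qed auto
  then show "{\<mu> \<in> space borel_P1. \<Psi> \<mu> < y} \<in> sets borel_P1"
    by (simp add: sets_borel_P1 sigma_sets.Basic)
qed

lemma measurable_int_minus [measurable]: "(\<lambda>\<mu>. int_minus \<mu> s) \<in> borel_measurable borel_P1"
  and measurable_int_plus [measurable]: "(\<lambda>\<mu>. int_plus \<mu> s) \<in> borel_measurable borel_P1"
  by (rule borel_P1_measurable_lipschitz, erule (1) W1_truncation_lipschitz)+

lemma measurable_borel_P1_in_P1: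
  "f \<in> measurable \<pi> borel_P1 \<Longrightarrow> t \<in> space \<pi> \<Longrightarrow> f t \<in> P1"
  by (drule measurable_space) auto

text \<open>For a < b the difference quotient of \<open>- int_minus\<close> over [a, b] lies between
  the distribution function at a and at b. At a continuity point x of \<open>cdf \<mu>\<close>, a
  rational interval just to the left of x gives the lower estimate and one just to the right the
  upper estimate, because the quotients over a fixed rational interval converge.\<close>

lemma weak_conv_of_int_minus:
  assumes \<mu>: "\<mu> \<in> P1" and \<nu>: "\<And>n. \<nu> n \<in> P1"
    and lim: "\<And>s. s \<in> \<rat> \<Longrightarrow> (\<lambda>n. int_minus (\<nu> n) s) \<longlonglongrightarrow> int_minus \<mu> s"
  shows "weak_conv_m \<nu> \<mu>"
  unfolding weak_conv_m_def weak_conv_def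
proof (intro allI impI)
  fix x assume cont: "isCont (cdf \<mu>) x"
  interpret real_distribution \<mu> by (rule P1_D[OF \<mu>])
  have quot: "(\<lambda>n. (int_minus (\<nu> n) a - int_minus (\<nu> n) b) / (b - a)) \<longlonglongrightarrow> (int_minus \<mu> a - int_minus \<mu> b) / (b - a)"
    if "a \<in> \<rat>" "b \<in> \<rat>" "a < b" for a b
    using that by (intro tendsto_intros lim) auto
  have cdf_le: "cdf \<rho> a \<le> (int_minus \<rho> a - int_minus \<rho> b) / (b - a)"
    "(int_minus \<rho> a - int_minus \<rho> b) / (b - a) \<le> cdf \<rho> b" if "\<rho> \<in> P1" "a < b" for \<rho> a b
    using int_minus_cdf[OF that(1), of a b] that(2) by (simp_all add: field_simps)
  have mono: "cdf (\<nu> n) a \<le> cdf (\<nu> n) b" if "a \<le> b" for n a b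
    using finite_borel_measure.cdf_nondecreasing[of "\<nu> n" a b] P1_D(3)[OF \<nu>] that
    by (simp add: real_distribution.finite_borel_measure_M)
  show "(\<lambda>n. cdf (\<nu> n) x) \<longlonglongrightarrow> cdf \<mu> x"
  proof (rule order_tendstoI)
    fix y assume y: "y < cdf \<mu> x"
    have "\<forall>\<^sub>F z in at x. y < cdf \<mu> z"
      using cont y by (simp add: isCont_def order_tendsto_iff)
    then obtain d where d: "d > 0" "\<And>z. z \<noteq> x \<Longrightarrow> dist z x < d \<Longrightarrow> y < cdf \<mu> z"
      by (auto simp: eventually_at)
    obtain b where b: "b \<in> \<rat>" "x - d < b" "b < x" using Rats_dense_in_real[of "x - d" x] d by auto
    obtain a where a: "a \<in> \<rat>" "x - d < a" "a < b" using Rats_dense_in_real[of "x - d" b] b by auto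
    have "y < cdf \<mu> a" using d a b by (auto simp: dist_real_def)
    also have "\<dots> \<le> (int_minus \<mu> a - int_minus \<mu> b) / (b - a)" using cdf_le \<mu> a by blast
    finally have "\<forall>\<^sub>F n in sequentially. y < (int_minus (\<nu> n) a - int_minus (\<nu> n) b) / (b - a)"
      using quot[OF a(1) b(1) a(3)] by (simp add: order_tendsto_iff)
    then show "\<forall>\<^sub>F n in sequentially. y < cdf (\<nu> n) x"
    proof eventually_elim
      case (elim n)
      then show ?case using cdf_le(2)[OF \<nu> a(3), of n] mono[of b x n] b by linarith
    qed
  next
    fix y assume y: "cdf \<mu> x < y"
    have "\<forall>\<^sub>F z in at x. cdf \<mu> z < y"
      using cont y by (simp add: isCont_def order_tendsto_iff)
    then obtain d where d: "d > 0" "\<And>z. z \<noteq> x \<Longrightarrow> dist z x < d \<Longrightarrow> cdf \<mu> z < y"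
      by (auto simp: eventually_at)
    obtain a where a: "a \<in> \<rat>" "x < a" "a < x + d" using Rats_dense_in_real[of x "x + d"] d by auto
    obtain b where b: "b \<in> \<rat>" "a < b" "b < x + d" using Rats_dense_in_real[of a "x + d"] a by auto
    have "(int_minus \<mu> a - int_minus \<mu> b) / (b - a) \<le> cdf \<mu> b" using cdf_le \<mu> b by blast
    also have "\<dots> < y" using d a b by (auto simp: dist_real_def)
    finally have "\<forall>\<^sub>F n in sequentially. (int_minus (\<nu> n) a - int_minus (\<nu> n) b) / (b - a) < y"
      using quot[OF a(1) b(1) b(2)] by (simp add: order_tendsto_iff)
    then show "\<forall>\<^sub>F n in sequentially. cdf (\<nu> n) x < y"
    proof eventually_elim
      case (elim n)
      then show ?case using cdf_le(1)[OF \<nu> b(2), of n] mono[of x a n] a by linarith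
    qed
  qed
qed

subsection \<open>Wasserstein convergence and measurability\<close>

text \<open>The joint law of \<open>X\<close> and \<open>Y\<close> is a coupling. It bounds the
  infimum from above, and it shows that the infimum is taken over a nonempty set, on which
  nonnegativity depends.\<close>

lemma W1_le_integral:
  assumes "prob_space \<Omega>" and [measurable]: "X \<in> borel_measurable \<Omega>" "Y \<in> borel_measurable \<Omega>"
    and "distr \<Omega> borel X = \<mu>" "distr \<Omega> borel Y = \<nu>"
  shows "0 \<le> W1 \<mu> \<nu>" "W1 \<mu> \<nu> \<le> (\<integral>\<omega>. \<bar>X \<omega> - Y \<omega>\<bar> \<partial>\<Omega>)"
proof -
  interpret prob_space \<Omega> by fact
  define \<gamma> where "\<gamma> = distr \<Omega> (borel \<Otimes>\<^sub>M borel) (\<lambda>\<omega>. (X \<omega>, Y \<omega>))"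
  have \<gamma>: "\<gamma> \<in> couplings \<mu> \<nu>"
    using assms by (auto simp: couplings_def \<gamma>_def distr_distr comp_def intro!: prob_space_distr)
  have ge: "0 \<le> (\<integral>p. \<bar>fst p - snd p\<bar> \<partial>\<gamma>)" for \<gamma> :: "(real \<times> real) measure"
    by (rule Bochner_Integration.integral_nonneg) auto
  show "0 \<le> W1 \<mu> \<nu>" unfolding W1_def using \<gamma> ge by (intro cINF_greatest) auto
  have "W1 \<mu> \<nu> \<le> (\<integral>p. \<bar>fst p - snd p\<bar> \<partial>\<gamma>)"
    unfolding W1_def using ge by (intro cINF_lower[OF _ \<gamma>] bdd_belowI2)
  also have "\<dots> = (\<integral>\<omega>. \<bar>X \<omega> - Y \<omega>\<bar> \<partial>\<Omega>)"
    unfolding \<gamma>_def by (subst integral_distr) auto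
  finally show "W1 \<mu> \<nu> \<le> (\<integral>\<omega>. \<bar>X \<omega> - Y \<omega>\<bar> \<partial>\<Omega>)" .
qed

text \<open>The first absolute moment equals \<open>int_plus\<close> minus \<open>int_minus\<close>
  at 0. Its convergence is the norm condition that upgrades the pointwise convergence of the
  Skorohod variables to convergence in the mean, and the expected distance of these variables
  dominates \<open>W1\<close>.\<close>

lemma W1_tendsto_0:
  assumes \<mu>: "\<mu> \<in> P1" and \<nu>: "\<And>n. \<nu> n \<in> P1"
    and lim: "\<And>s. s \<in> \<rat> \<Longrightarrow> (\<lambda>n. int_minus (\<nu> n) s) \<longlonglongrightarrow> int_minus \<mu> s"
      "\<And>s. s \<in> \<rat> \<Longrightarrow> (\<lambda>n. int_plus (\<nu> n) s) \<longlonglongrightarrow> int_plus \<mu> s"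
  shows "(\<lambda>n. W1 \<mu> (\<nu> n)) \<longlonglongrightarrow> 0"
proof -
  obtain \<Omega> :: "real measure" and Y :: "nat \<Rightarrow> real \<Rightarrow> real" and X :: "real \<Rightarrow> real" where
    \<Omega>: "prob_space \<Omega>" and [measurable]: "\<And>n. Y n \<in> measurable \<Omega> borel"
    and dY: "\<And>n. distr \<Omega> borel (Y n) = \<nu> n"
    and X: "X \<in> measurable \<Omega> lborel" and dX: "distr \<Omega> borel X = \<mu>"
    and conv: "\<And>x. x \<in> space \<Omega> \<Longrightarrow> (\<lambda>n. Y n x) \<longlonglongrightarrow> X x"
    using Skorohod[of \<nu> \<mu>] P1_D(3) \<mu> \<nu> weak_conv_of_int_minus[OF \<mu> \<nu> lim(1)] by blast
  have [measurable]: "X \<in> borel_measurable \<Omega>" using X by simp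
  interpret prob_space \<Omega> by fact
  have abs: "(\<integral>x. \<bar>x\<bar> \<partial>\<rho>) = int_plus \<rho> 0 - int_minus \<rho> 0" if "\<rho> \<in> P1" for \<rho>
  proof -
    have "int_plus \<rho> 0 - int_minus \<rho> 0 = (\<integral>x. max (x - 0) 0 - min (x - 0) 0 \<partial>\<rho>)"
      unfolding int_plus_def int_minus_def using integrable_truncations[OF that, of 0] by simp
    also have "\<dots> = (\<integral>x. \<bar>x\<bar> \<partial>\<rho>)" by (rule Bochner_Integration.integral_cong) auto
    finally show ?thesis by simp
  qed
  have iY: "integrable \<Omega> (Y n)" for n
    by (rule integrable_distr[of "Y n" \<Omega> borel "\<lambda>x. x"]) (simp_all add: dY P1_D(4)[OF \<nu>])
  have iX: "integrable \<Omega> X"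
    by (rule integrable_distr[of X \<Omega> borel "\<lambda>x. x"]) (simp_all add: dX P1_D(4)[OF \<mu>])
  have eY: "(\<integral>\<omega>. \<bar>Y n \<omega>\<bar> \<partial>\<Omega>) = int_plus (\<nu> n) 0 - int_minus (\<nu> n) 0" for n
  proof -
    have "(\<integral>x. \<bar>x\<bar> \<partial>\<nu> n) = (\<integral>\<omega>. \<bar>Y n \<omega>\<bar> \<partial>\<Omega>)"
      by (subst dY[symmetric], subst integral_distr) simp_all
    then show ?thesis using abs[OF \<nu>] by metis
  qed
  have eX: "(\<integral>\<omega>. \<bar>X \<omega>\<bar> \<partial>\<Omega>) = int_plus \<mu> 0 - int_minus \<mu> 0"
  proof -
    have "(\<integral>x. \<bar>x\<bar> \<partial>\<mu>) = (\<integral>\<omega>. \<bar>X \<omega>\<bar> \<partial>\<Omega>)"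
      by (subst dX[symmetric], subst integral_distr) simp_all
    then show ?thesis using abs[OF \<mu>] by metis
  qed
  have lim1: "(\<lambda>n. \<integral>\<omega>. norm (Y n \<omega>) \<partial>\<Omega>) \<longlonglongrightarrow> (\<integral>\<omega>. norm (X \<omega>) \<partial>\<Omega>)"
    unfolding real_norm_def eX eY by (intro tendsto_diff lim) auto
  have nn: "(\<integral>\<^sup>+ \<omega>. norm (g \<omega>) \<partial>\<Omega>) = ennreal (\<integral>\<omega>. norm (g \<omega>) \<partial>\<Omega>)" if "integrable \<Omega> g"
    for g :: "real \<Rightarrow> real"
    by (rule nn_integral_eq_integral[OF integrable_norm[OF that]]) simp
  have "(\<lambda>n. \<integral>\<^sup>+ \<omega>. norm (Y n \<omega>) \<partial>\<Omega>) \<longlonglongrightarrow> (\<integral>\<^sup>+ \<omega>. norm (X \<omega>) \<partial>\<Omega>)"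
    unfolding nn[OF iX] nn[OF iY] by (rule tendsto_ennrealI[OF lim1])
  from lim_imp_Limsup[OF sequentially_bot this]
  have limsup: "limsup (\<lambda>n. \<integral>\<^sup>+ \<omega>. norm (Y n \<omega>) \<partial>\<Omega>) \<le> (\<integral>\<^sup>+ \<omega>. norm (X \<omega>) \<partial>\<Omega>)"
    by simp
  have "AE \<omega> in \<Omega>. (\<lambda>n. Y n \<omega>) \<longlonglongrightarrow> X \<omega>"
    using conv by (rule AE_I2)
  from Scheffe_lemma1[OF iY iX this limsup]
  have "(\<lambda>n. ennreal (\<integral>\<omega>. norm (Y n \<omega> - X \<omega>) \<partial>\<Omega>)) \<longlonglongrightarrow> ennreal 0"
    unfolding nn[OF Bochner_Integration.integrable_diff[OF iY iX]] by simp
  then have "(\<lambda>n. \<integral>\<omega>. norm (Y n \<omega> - X \<omega>) \<partial>\<Omega>) \<longlonglongrightarrow> 0"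
    by (subst (asm) tendsto_ennreal_iff) (simp_all add: always_eventually)
  then have "(\<lambda>n. \<integral>\<omega>. \<bar>Y n \<omega> - X \<omega>\<bar> \<partial>\<Omega>) \<longlonglongrightarrow> 0"
    by simp
  then have lim2: "(\<lambda>n. \<integral>\<omega>. \<bar>X \<omega> - Y n \<omega>\<bar> \<partial>\<Omega>) \<longlonglongrightarrow> 0"
    by (subst abs_minus_commute)
  have W: "0 \<le> W1 \<mu> (\<nu> n)" "W1 \<mu> (\<nu> n) \<le> (\<integral>\<omega>. \<bar>X \<omega> - Y n \<omega>\<bar> \<partial>\<Omega>)" for n
    by (rule W1_le_integral[OF \<Omega> _ _ dX dY]; measurable)+
  show ?thesis
    by (rule tendsto_sandwich[OF _ _ tendsto_const lim2]) (simp_all add: W)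
qed

lemma eventually_openin_W1_topology:
  assumes "openin W1_topology U" "\<mu> \<in> U" "\<And>n. \<nu> n \<in> P1" "(\<lambda>n. W1 \<mu> (\<nu> n)) \<longlonglongrightarrow> 0"
  shows "\<forall>\<^sub>F n in sequentially. \<nu> n \<in> U"
proof -
  obtain r where r: "r > 0" "\<forall>\<nu>\<in>P1. W1 \<mu> \<nu> < r \<longrightarrow> \<nu> \<in> U"
    using assms(1,2) by (auto simp: openin_W1_topology)
  have "\<forall>\<^sub>F n in sequentially. W1 \<mu> (\<nu> n) < r"
    using order_tendstoD(2)[OF assms(4) r(1)] .
  then show ?thesis
  proof eventually_elim
    case (elim n)
    then show ?case using r(2) assms(3)[of n] by blast
  qed
qed

text \<open>The truncated means at rational points embed \<open>P1\<close> topologically into a countable product, which is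
  second countable.\<close>
lemma measurable_borel_P1I:
  assumes P: "\<And>t. t \<in> space \<pi> \<Longrightarrow> f t \<in> P1"
    and [measurable]: "\<And>s. (\<lambda>t. int_minus (f t) s) \<in> borel_measurable \<pi>" "\<And>s. (\<lambda>t. int_plus (f t) s) \<in> borel_measurable \<pi>"
  shows "f \<in> measurable \<pi> borel_P1"
proof -
  define \<Phi> :: "real measure \<Rightarrow> rat \<Rightarrow> real \<times> real"
    where "\<Phi> \<mu> q = (int_minus \<mu> (of_rat q), int_plus \<mu> (of_rat q))" for \<mu> q
  have \<Phi>f: "(\<lambda>t. \<Phi> (f t)) \<in> borel_measurable \<pi>"
    by (rule measurable_coordinatewise_then_product) (simp add: \<Phi>_def borel_measurable_Pair assms)
  show ?thesis
    unfolding borel_P1_def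
  proof (rule measurable_measure_of)
    fix U assume "U \<in> {U. openin W1_topology U}"
    then have U: "openin W1_topology U" by simp
    then have UP: "U \<subseteq> P1" by (simp add: openin_W1_topology)
    \<comment> \<open>This \<open>V\<close> is open, and on \<open>P1\<close> its preimage under
      \<Phi> is exactly \<open>U\<close>. The one inclusion with content is that \<Phi> sends no
      point of \<open>U\<close> into the closure: otherwise points outside \<open>U\<close> would
      have images converging to its image, hence converge to it in \<open>W1\<close> and enter the
      open set \<open>U\<close>.\<close>
    define V where "V = - closure (\<Phi> ` (P1 - U))"
    have "\<Phi> \<mu> \<in> V" if "\<mu> \<in> U" for \<mu>
    proof (rule ccontr)
      assume "\<Phi> \<mu> \<notin> V"
      then obtain x where x: "\<And>n::nat. x n \<in> \<Phi> ` (P1 - U)" "x \<longlonglongrightarrow> \<Phi> \<mu>"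
        by (auto simp: V_def closure_sequential)
      then have "\<forall>n. \<exists>\<rho>. \<rho> \<in> P1 - U \<and> x n = \<Phi> \<rho>" by blast
      then obtain \<nu> where \<nu>: "\<And>n. \<nu> n \<in> P1 - U" "\<And>n. x n = \<Phi> (\<nu> n)" by metis
      have lim: "(\<lambda>n. \<Phi> (\<nu> n) q) \<longlonglongrightarrow> \<Phi> \<mu> q" for q
      proof -
        have "continuous_on UNIV (\<lambda>f :: rat \<Rightarrow> real \<times> real. f q)"
          by (rule continuous_on_product_coordinates)
        then have "\<forall>x\<in>UNIV. isCont (\<lambda>f :: rat \<Rightarrow> real \<times> real. f q) x"
          unfolding continuous_on_eq_continuous_at[OF open_UNIV] .
        then have "isCont (\<lambda>f. f q) (\<Phi> \<mu>)" by simp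
        from isCont_tendsto_compose[OF this x(2)] show ?thesis by (simp add: \<nu>(2))
      qed
      have 0: "(\<lambda>n. int_minus (\<nu> n) s) \<longlonglongrightarrow> int_minus \<mu> s" "(\<lambda>n. int_plus (\<nu> n) s) \<longlonglongrightarrow> int_plus \<mu> s"
        if s: "s \<in> \<rat>" for s
      proof -
        obtain q where q: "s = of_rat q" using s unfolding Rats_def by blast
        show "(\<lambda>n. int_minus (\<nu> n) s) \<longlonglongrightarrow> int_minus \<mu> s" "(\<lambda>n. int_plus (\<nu> n) s) \<longlonglongrightarrow> int_plus \<mu> s"
          using tendsto_fst[OF lim[of q]] tendsto_snd[OF lim[of q]] q by (simp_all add: \<Phi>_def)
      qed
      have P: "\<mu> \<in> P1" "\<And>n. \<nu> n \<in> P1" using \<open>\<mu> \<in> U\<close> UP \<nu>(1) by blast+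
      then have "(\<lambda>n. W1 \<mu> (\<nu> n)) \<longlonglongrightarrow> 0" using 0 by (rule W1_tendsto_0)
      from eventually_openin_W1_topology[OF U \<open>\<mu> \<in> U\<close> P(2) this]
      have "\<forall>\<^sub>F n in sequentially. \<nu> n \<in> U" .
      then obtain n where "\<nu> n \<in> U" using eventually_happens'[OF sequentially_bot] by blast
      then show False using \<nu>(1)[of n] by simp
    qed
    moreover have "\<mu> \<in> U" if "\<mu> \<in> P1" "\<Phi> \<mu> \<in> V" for \<mu>
    proof (rule ccontr)
      assume "\<mu> \<notin> U"
      then have "\<Phi> \<mu> \<in> \<Phi> ` (P1 - U)" using that(1) by blast
      then have "\<Phi> \<mu> \<in> closure (\<Phi> ` (P1 - U))" by (rule subsetD[OF closure_subset])
      then show False using that(2) by (simp add: V_def)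
    qed
    ultimately have *: "f t \<in> U \<longleftrightarrow> \<Phi> (f t) \<in> V" if "t \<in> space \<pi>" for t
      using P[OF that] by blast
    then have "f -` U \<inter> space \<pi> = (\<lambda>t. \<Phi> (f t)) -` V \<inter> space \<pi>"
      by auto
    also have "\<dots> \<in> sets \<pi>"
    proof (rule measurable_sets[OF \<Phi>f borel_open])
      show "open V" unfolding V_def by (rule open_Compl[OF closed_closure])
    qed
    finally show "f -` U \<inter> space \<pi> \<in> sets \<pi>" .
  qed (use P in \<open>auto simp: openin_W1_topology\<close>)
qed

lemma limitin_W1_topology:
  assumes "\<mu> \<in> P1" "\<And>n. \<nu> n \<in> P1" "(\<lambda>n. W1 \<mu> (\<nu> n)) \<longlonglongrightarrow> 0"
  shows "limitin W1_topology \<nu> \<mu> sequentially"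
proof -
  have "openin W1_topology P1" 
    unfolding openin_W1_topology by (intro conjI subset_refl ballI exI[of _ 1]) auto
  from openin_subset[OF this] have "\<mu> \<in> topspace W1_topology" using assms(1) by blast
  moreover have "\<forall>\<^sub>F n in sequentially. \<nu> n \<in> U" if U: "openin W1_topology U" "\<mu> \<in> U" for U
    using U assms(2,3) by (rule eventually_openin_W1_topology)
  ultimately show ?thesis by (simp add: limitin_def)
qed

subsection \<open>Realizing concave functions by measures\<close>

text \<open>The difference of the increments over \<open>[a, b]\<close> is at most \<open>(b - a) * (F b - F a)\<close>; subdividing
  \<open>[a, b]\<close> into \<open>n\<close> equal parts improves this bound by the factor \<open>1 / n\<close>.\<close>
lemma increments_unique:
  fixes f g F :: "real \<Rightarrow> real"
  assumes f: "\<And>a b. a \<le> b \<Longrightarrow> (b - a) * F a \<le> f b - f a" "\<And>a b. a \<le> b \<Longrightarrow> f b - f a \<le> (b - a) * F b"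
    and g: "\<And>a b. a \<le> b \<Longrightarrow> (b - a) * F a \<le> g b - g a" "\<And>a b. a \<le> b \<Longrightarrow> g b - g a \<le> (b - a) * F b"
  shows "f b - f a = g b - g a"
proof -
  have main: "f b - f a = g b - g a" if "a \<le> b" for a b
  proof -
    define D where "D x = f x - g x" for x
    have D: "\<bar>D y - D x\<bar> \<le> (y - x) * (F y - F x)" if "x \<le> y" for x y
      using f[OF that] g[OF that] by (simp add: D_def right_diff_distrib abs_le_iff)
    have bound: "\<bar>D b - D a\<bar> \<le> (b - a) * (F b - F a) * (1 / Suc n)" for n
    proof -
      define h where "h = (b - a) / Suc n"
      define x where "x i = a + real i * h" for i
      have h: "0 \<le> h" using that by (simp add: h_def)
      have x0: "x 0 = a" by (simp add: x_def)
      have xn: "x (Suc n) = b"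
        unfolding x_def h_def by (simp add: field_simps del: of_nat_Suc)
      have step: "x (Suc i) - x i = h" for i by (simp add: x_def algebra_simps)
      have "D b - D a = (\<Sum>i<Suc n. D (x (Suc i)) - D (x i))"
        using sum_lessThan_telescope[of "\<lambda>i. D (x i)" "Suc n"] by (simp only: x0 xn)
      then have "\<bar>D b - D a\<bar> \<le> (\<Sum>i<Suc n. \<bar>D (x (Suc i)) - D (x i)\<bar>)"
        by (simp only: sum_abs)
      also have "\<dots> \<le> (\<Sum>i<Suc n. h * (F (x (Suc i)) - F (x i)))"
      proof (rule sum_mono)
        fix i show "\<bar>D (x (Suc i)) - D (x i)\<bar> \<le> h * (F (x (Suc i)) - F (x i))"
          using D[of "x i" "x (Suc i)"] step[of i] h by simp
      qed
      also have "\<dots> = h * (F b - F a)"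
        using sum_lessThan_telescope[of "\<lambda>i. F (x i)" "Suc n"]
        by (simp only: sum_distrib_left[symmetric] x0 xn)
      also have "\<dots> = (b - a) * (F b - F a) * (1 / Suc n)"
        by (simp add: h_def)
      finally show ?thesis .
    qed
    have "(\<lambda>n. (b - a) * (F b - F a) * (1 / Suc n)) \<longlonglongrightarrow> (b - a) * (F b - F a) * 0"
      by (intro tendsto_mult tendsto_const LIMSEQ_Suc[OF lim_1_over_n])
    then have "\<bar>D b - D a\<bar> \<le> (b - a) * (F b - F a) * 0"
      by (rule LIMSEQ_le_const) (use bound in blast)
    then show ?thesis by (simp add: D_def)
  qed
  show ?thesis using main[of a b] main[of b a] by (cases "a \<le> b") auto
qed

lemma filterlim_add_const_at_bot: "filterlim (\<lambda>x::real. x + c) at_bot at_bot"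
  unfolding filterlim_at_bot
proof
  fix Z :: real
  show "\<forall>\<^sub>F x in at_bot. x + c \<le> Z"
    using eventually_le_at_bot[of "Z - c"] by eventually_elim simp
qed

lemma filterlim_add_const_at_top: "filterlim (\<lambda>x::real. x + c) at_top at_top"
  unfolding filterlim_at_top
proof
  fix Z :: real
  show "\<forall>\<^sub>F x in at_top. Z \<le> x + c"
    using eventually_ge_at_top[of "Z - c"] by eventually_elim simp
qed

text \<open>The function \<open>g\<close> is the right derivative, the infimum of the secant slopes
  to the right. Adding two subgradient inequalities gives monotonicity. For right continuity at a,
  choose a secant slope below a given y > g a; it depends continuously on its left end point, so it
  stays below y, and with it \<open>g\<close>, slightly to the right of a.\<close>

lemma convex_right_derivative:
  fixes f :: "real \<Rightarrow> real"
  assumes convex: "convex_on UNIV f"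
  obtains g where "\<And>x y. f x + g x * (y - x) \<le> f y" "\<And>x. continuous (at_right x) g" "mono g"
proof -
  define g where "g x = Inf ((\<lambda>t. (f x - f t) / (x - t)) ` {x<..})" for x
  have sub: "f x + g x * (y - x) \<le> f y" for x y
    using convex_le_Inf_differential[OF convex, of x y] by (simp add: g_def)
  have mono: "g x \<le> g y" if "x \<le> y" for x y
  proof (cases "x = y")
    case False
    have "g x * (y - x) \<le> g y * (y - x)"
      using sub[of x y] sub[of y x] by (simp add: algebra_simps)
    then show ?thesis using False that by (simp add: mult_le_cancel_right)
  qed simp
  have "continuous_on UNIV f" by (rule convex_on_continuous[OF open_UNIV convex])
  then have cont: "isCont f x" for x by (simp add: continuous_on_eq_continuous_at)
  have "(g \<longlongrightarrow> g a) (at_right a)" for a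
  proof (rule order_tendstoI)
    fix y assume "y < g a"
    then show "\<forall>\<^sub>F x in at_right a. y < g x"
      using mono[of a] by (auto simp: eventually_at_filter less_le_trans intro!: always_eventually)
  next
    fix y assume "g a < y"
    then obtain t where t: "a < t" "(f a - f t) / (a - t) < y"
      unfolding g_def by (auto dest!: cInf_lessD[rotated])
    have "((\<lambda>x. (f x - f t) / (x - t)) \<longlongrightarrow> (f a - f t) / (a - t)) (at_right a)"
      by (intro tendsto_intros isCont_tendsto_compose[OF cont]) (use t in auto)
    then have "\<forall>\<^sub>F x in at_right a. (f x - f t) / (x - t) < y"
      using t(2) by (rule order_tendstoD(2))
    moreover have "\<forall>\<^sub>F x in at_right a. x < t"
      using eventually_at_right_real[OF t(1)] by (rule eventually_mono) simp
    ultimately show "\<forall>\<^sub>F x in at_right a. g x < y"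
    proof eventually_elim
      case (elim x)
      have "g x * (t - x) \<le> f t - f x" using sub[of x t] by simp
      then have "g x \<le> (f t - f x) / (t - x)" using elim by (simp add: pos_le_divide_eq)
      also have "\<dots> = (f x - f t) / (x - t)"
        by (metis minus_diff_eq minus_divide_divide)
      finally show ?case using elim by simp
    qed
  qed
  then have "continuous (at_right a) g" for a by (simp add: continuous_within)
  then show ?thesis using that[OF sub _ monoI] mono by blast
qed

lemma int_minus_realization:
  assumes concave: "concave_on UNIV \<phi>"
    and bot: "(\<phi> \<longlongrightarrow> 0) at_bot" and top: "((\<lambda>s. \<phi> s + s) \<longlongrightarrow> m) at_top"
  shows "\<exists>\<mu>\<in>P1. int_minus \<mu> = \<phi>"
proof -
  define f where "f x = - \<phi> x" for x
  have "convex_on UNIV f" using concave by (simp add: concave_on_def f_def[abs_def])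
  then obtain g where sub: "\<And>x y. f x + g x * (y - x) \<le> f y"
    and rc: "\<And>x. continuous (at_right x) g" and mono: "mono g"
    by (rule convex_right_derivative) blast
  have incr: "(b - a) * g a \<le> f b - f a" "f b - f a \<le> (b - a) * g b" for a b
    using sub[of a b] sub[of b a] by (simp_all add: algebra_simps)
  have g_le: "g x \<le> f (x + 1) - f x" and g_ge: "f (x + - 1) \<ge> f x - g x" for x
    using sub[of x "x + 1"] sub[of x "x + - 1"] by simp_all
  have fbot: "(f \<longlongrightarrow> 0) at_bot" using tendsto_minus[OF bot] by (simp add: f_def[abs_def])
  have gbot: "(g \<longlongrightarrow> 0) at_bot"
  proof (rule tendsto_sandwich)
    have "((\<lambda>x. f x - f (x + - 1)) \<longlongrightarrow> 0 - 0) at_bot"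
      by (intro tendsto_diff fbot filterlim_compose[OF fbot filterlim_add_const_at_bot])
    then show "((\<lambda>x. f x - f (x + - 1)) \<longlongrightarrow> 0) at_bot" by simp
    have "((\<lambda>x. f (x + 1) - f x) \<longlongrightarrow> 0 - 0) at_bot"
      by (intro tendsto_diff fbot filterlim_compose[OF fbot filterlim_add_const_at_bot])
    then show "((\<lambda>x. f (x + 1) - f x) \<longlongrightarrow> 0) at_bot" by simp
    show "\<forall>\<^sub>F x in at_bot. f x - f (x + - 1) \<le> g x"
      using g_ge by (intro always_eventually allI) (simp add: algebra_simps)
    show "\<forall>\<^sub>F x in at_bot. g x \<le> f (x + 1) - f x"
      using g_le by (intro always_eventually allI)
  qed
  have gtop: "(g \<longlongrightarrow> 1) at_top"
  proof (rule tendsto_sandwich)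
    have "((\<lambda>x. 1 + (\<phi> (x + - 1) + (x + - 1)) - (\<phi> x + x)) \<longlongrightarrow> 1 + m - m) at_top"
      by (intro tendsto_intros top filterlim_compose[OF top filterlim_add_const_at_top])
    then show "((\<lambda>x. f x - f (x + - 1)) \<longlongrightarrow> 1) at_top" by (simp add: f_def)
    have "((\<lambda>x. 1 + (\<phi> x + x) - (\<phi> (x + 1) + (x + 1))) \<longlongrightarrow> 1 + m - m) at_top"
      by (intro tendsto_intros top filterlim_compose[OF top filterlim_add_const_at_top])
    then show "((\<lambda>x. f (x + 1) - f x) \<longlongrightarrow> 1) at_top" by (simp add: f_def)
    show "\<forall>\<^sub>F x in at_top. f x - f (x + - 1) \<le> g x"
      using g_ge by (intro always_eventually allI) (simp add: algebra_simps)
    show "\<forall>\<^sub>F x in at_top. g x \<le> f (x + 1) - f x"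
      using g_le by (intro always_eventually allI)
  qed
  define M where "M = interval_measure g"
  have gm: "\<And>x y. x \<le> y \<Longrightarrow> g x \<le> g y" using mono by (rule monoD)
  have "real_distribution M"
    unfolding M_def using gm rc gbot gtop by (rule real_distribution_interval_measure)
  then interpret real_distribution M .
  have cdf: "cdf M = g"
    unfolding M_def using gm rc gbot by (rule cdf_interval_measure)
  \<comment> \<open>Integrability of x under \<open>M\<close> is not yet known. Subtracting
    \<open>max (- x) 0\<close> leaves an integrand bounded by \<bar>s\<bar>, so \<open>G\<close> is
    defined unconditionally; it has the same increment bounds as \<open>f\<close>, hence equals
    \<open>f s - f 0\<close>.\<close>
  define G where "G s = (\<integral>x. max (s - x) 0 - max (- x) 0 \<partial>M)" for s
  have iG: "integrable M (\<lambda>x. max (s - x) 0 - max (- x) 0)" for s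
    by (rule integrable_const_bound[of _ "\<bar>s\<bar>"]) (auto simp: max_def)
  have prob_cdf: "prob {..c} = g c" for c using cdf by (auto simp: cdf_def)
  have Gincr: "(b - a) * g a \<le> G b - G a" "G b - G a \<le> (b - a) * g b" if "a \<le> b" for a b
  proof -
    have eq: "G b - G a = (\<integral>x. (max (b - x) 0 - max (- x) 0) - (max (a - x) 0 - max (- x) 0) \<partial>M)"
      unfolding G_def 
      by (rule Bochner_Integration.integral_diff[OF iG iG, symmetric])
    have ind: "(b - a) * g c = (\<integral>x. (b - a) * indicator {..c} x \<partial>M)" for c
      using prob_cdf[of c] by simp
    have indi: "integrable M (\<lambda>x. (b - a) * indicator {..c} x)" for c
      by (auto intro!: integrable_real_indicator simp: emeasure_eq_measure)
    show "(b - a) * g a \<le> G b - G a"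
      unfolding eq ind using that
      by (intro integral_mono indi Bochner_Integration.integrable_diff iG) (auto simp: indicator_def max_def)
    show "G b - G a \<le> (b - a) * g b"
      unfolding eq ind using that
      by (intro integral_mono indi Bochner_Integration.integrable_diff iG) (auto simp: indicator_def max_def)
  qed
  have G0: "G 0 = 0" by (simp add: G_def)
  have Gf: "G s = f s - f 0" for s
    using increments_unique[of g f G s 0, OF incr Gincr] G0 by simp
  have neg: "integrable M (\<lambda>x. max (- x) 0)" "(\<integral>x. max (- x) 0 \<partial>M) = f 0"
  proof -
    \<comment> \<open>These functions increase to the negative part of x, and their integrals
      \<open>f 0 - f (- real n)\<close> tend to \<open>f 0\<close> because \<open>f\<close> vanishes
      at minus infinity. Monotone convergence then yields both integrability and the value.\<close>
    let ?u = "\<lambda>n x. - (max (- real n - x) 0 - max (- x) 0)"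
    have i: "integrable M (?u n)" for n using iG by (rule integrable_minus)
    have "(\<lambda>n. f 0 - f (- real n)) \<longlonglongrightarrow> f 0 - 0"
      by (intro tendsto_intros filterlim_compose[OF fbot] filterlim_uminus_at_bot_at_top
          filterlim_compose[OF filterlim_uminus_at_bot_at_top filterlim_real_sequentially])
    moreover have "f 0 - f (- real n) = (\<integral>x. ?u n x \<partial>M)" for n
      using Gf[of "- real n"] unfolding G_def by (subst integral_minus) simp
    ultimately have lim: "(\<lambda>n. \<integral>x. ?u n x \<partial>M) \<longlonglongrightarrow> f 0" by simp
    have mono: "AE x in M. mono (\<lambda>n. ?u n x)"
      by (auto simp: mono_def max_def)
    have ptw: "AE x in M. (\<lambda>n. ?u n x) \<longlonglongrightarrow> max (- x) 0"
    proof (rule AE_I2)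
      fix x :: real
      have "\<forall>\<^sub>F n in sequentially. - x \<le> real n" 
        using filterlim_real_sequentially by (simp add: filterlim_at_top)
      then have "\<forall>\<^sub>F n in sequentially. ?u n x = max (- x) 0"
        by eventually_elim simp
      then show "(\<lambda>n. ?u n x) \<longlonglongrightarrow> max (- x) 0" by (rule tendsto_eventually)
    qed
    have meas: "(\<lambda>x. max (- x) 0) \<in> borel_measurable M" by measurable
    show "integrable M (\<lambda>x. max (- x) 0)"
      by (rule integrable_monotone_convergence[OF i mono ptw lim meas])
    show "(\<integral>x. max (- x) 0 \<partial>M) = f 0"
      by (rule integral_monotone_convergence[OF i mono ptw lim meas])
  qed
  have pos: "integrable M (\<lambda>x. max x 0)"
  proof -
    \<comment> \<open>This is the minimum of x and n plus the negative part of x, which increases to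
      the positive part. The limit of the integrals is finite because \<open>\<phi> s + s\<close>
      converges at plus infinity.\<close>
    let ?v = "\<lambda>n x. real n - (max (real n - x) 0 - max (- x) 0)"
    have i: "integrable M (?v n)" for n using iG by simp
    have "(\<lambda>n. (\<phi> (real n) + real n) + f 0) \<longlonglongrightarrow> m + f 0"
      by (intro tendsto_intros filterlim_compose[OF top filterlim_real_sequentially])
    moreover have "(\<phi> (real n) + real n) + f 0 = (\<integral>x. ?v n x \<partial>M)" for n
      using Gf[of "real n"] iG[of "real n"] prob_space unfolding G_def f_def by simp
    ultimately have lim: "(\<lambda>n. \<integral>x. ?v n x \<partial>M) \<longlonglongrightarrow> m + f 0" by simp
    have mono: "AE x in M. mono (\<lambda>n. ?v n x)"
      by (auto simp: mono_def max_def)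
    have ptw: "AE x in M. (\<lambda>n. ?v n x) \<longlonglongrightarrow> max x 0"
    proof (rule AE_I2)
      fix x :: real
      have "\<forall>\<^sub>F n in sequentially. x \<le> real n" 
        using filterlim_real_sequentially by (simp add: filterlim_at_top)
      then have "\<forall>\<^sub>F n in sequentially. ?v n x = max x 0"
        by eventually_elim (auto simp: max_def)
      then show "(\<lambda>n. ?v n x) \<longlonglongrightarrow> max x 0" by (rule tendsto_eventually)
    qed
    have meas: "(\<lambda>x. max x 0) \<in> borel_measurable M" by measurable
    show ?thesis
      by (rule integrable_monotone_convergence[OF i mono ptw lim meas])
  qed
  have "M \<in> P1"
  proof (rule P1_I)
    have "integrable M (\<lambda>x. max x 0 - max (- x) 0)" using pos neg by simp
    moreover have "(\<lambda>x::real. max x 0 - max (- x) 0) = (\<lambda>x. x)" by (auto simp: max_def)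
    ultimately show "integrable M (\<lambda>x. x)" by simp
  qed (simp_all add: prob_space_axioms)
  moreover have "int_minus M s = \<phi> s" for s
  proof -
    have "int_minus M s = (\<integral>x. - ((max (s - x) 0 - max (- x) 0) + max (- x) 0) \<partial>M)"
      unfolding int_minus_def by (rule Bochner_Integration.integral_cong) auto
    also have "\<dots> = - (G s + f 0)"
      using Bochner_Integration.integral_add[OF iG[of s] neg(1)] neg(2) unfolding G_def by (subst integral_minus) simp
    finally show ?thesis using Gf[of s] by (simp add: f_def)
  qed
  ultimately show ?thesis by blast
qed

text \<open>The two limits are replaced by inequalities that survive pointwise limits and infima.
  The bound by \<open>int_minus \<kappa>\<close> keeps mass from escaping to minus infinity;
  monotonicity and boundedness of \<open>\<phi> s + s\<close> give its limit at plus
  infinity.\<close>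

lemma int_minus_realization_bounded:
  assumes concave: "concave_on UNIV \<phi>" and \<kappa>: "\<kappa> \<in> P1"
    and lower: "\<And>s. int_minus \<kappa> s \<le> \<phi> s" and nonpos: "\<And>s. \<phi> s \<le> 0"
    and mono: "\<And>a b. a \<le> b \<Longrightarrow> \<phi> a + a \<le> \<phi> b + b" and upper: "\<And>s. \<phi> s + s \<le> M"
  shows "\<phi> \<in> int_minus ` P1"
proof -
  have bot: "(\<phi> \<longlongrightarrow> 0) at_bot"
    by (rule tendsto_sandwich[OF _ _ int_minus_at_bot[OF \<kappa>] tendsto_const]) (simp_all add: lower nonpos)
  have bdd: "bdd_above (range (\<lambda>s. \<phi> s + s))" using upper by (rule bdd_aboveI2)
  have "((\<lambda>s. \<phi> s + s) \<longlongrightarrow> (SUP s. \<phi> s + s)) at_top"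
  proof (rule order_tendstoI)
    fix y assume "y < (SUP s. \<phi> s + s)"
    then obtain s where s: "y < \<phi> s + s" using less_cSUP_iff[OF UNIV_not_empty bdd] by blast
    show "\<forall>\<^sub>F x in at_top. y < \<phi> x + x"
      using eventually_ge_at_top[of s]
    proof eventually_elim
      case (elim x)
      then show ?case using mono[of s x] s by linarith
    qed
  next
    fix y assume y: "(SUP s. \<phi> s + s) < y"
    have "\<phi> x + x < y" for x
      using cSUP_upper[OF UNIV_I bdd, of x] y by linarith
    then show "\<forall>\<^sub>F x in at_top. \<phi> x + x < y" by simp
  qed
  from int_minus_realization[OF concave bot this] show ?thesis by (metis imageI)
qed

lemma concave_on_LIMSEQ:
  fixes \<phi> :: "nat \<Rightarrow> real \<Rightarrow> real"
  assumes concave: "\<And>n. concave_on UNIV (\<phi> n)" and lim: "\<And>s. (\<lambda>n. \<phi> n s) \<longlonglongrightarrow> \<psi> s"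
  shows "concave_on UNIV \<psi>"
  unfolding concave_on_iff
proof (intro conjI ballI allI impI)
  fix x y u v :: real assume uv: "0 \<le> u" "0 \<le> v" "u + v = 1"
  have "(\<lambda>n. u * \<phi> n x + v * \<phi> n y) \<longlonglongrightarrow> u * \<psi> x + v * \<psi> y"
    by (intro tendsto_intros lim)
  moreover have "\<exists>N. \<forall>n\<ge>N. u * \<phi> n x + v * \<phi> n y \<le> \<phi> n (u *\<^sub>R x + v *\<^sub>R y)"
    using concave uv unfolding concave_on_iff by blast
  ultimately show "u * \<psi> x + v * \<psi> y \<le> \<psi> (u *\<^sub>R x + v *\<^sub>R y)"
    using LIMSEQ_le[OF _ lim] by blast
qed simp

lemma concave_on_INF:
  fixes \<phi> :: "'i \<Rightarrow> real \<Rightarrow> real"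
  assumes "I \<noteq> {}" and concave: "\<And>i. i \<in> I \<Longrightarrow> concave_on UNIV (\<phi> i)"
    and bdd: "\<And>s. bdd_below ((\<lambda>i. \<phi> i s) ` I)"
  shows "concave_on UNIV (\<lambda>s. INF i\<in>I. \<phi> i s)"
  unfolding concave_on_iff
proof (intro conjI ballI allI impI)
  fix x y u v :: real assume uv: "0 \<le> u" "0 \<le> v" "u + v = 1"
  show "u * (INF i\<in>I. \<phi> i x) + v * (INF i\<in>I. \<phi> i y) \<le> (INF i\<in>I. \<phi> i (u *\<^sub>R x + v *\<^sub>R y))"
  proof (rule cINF_greatest[OF assms(1)])
    fix i assume i: "i \<in> I"
    have "u * (INF i\<in>I. \<phi> i x) + v * (INF i\<in>I. \<phi> i y) \<le> u * \<phi> i x + v * \<phi> i y"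
      using uv cINF_lower[OF bdd i] by (intro add_mono mult_left_mono) auto
    also have "\<dots> \<le> \<phi> i (u *\<^sub>R x + v *\<^sub>R y)"
      using concave[OF i] uv unfolding concave_on_iff by blast
    finally show "u * (INF i\<in>I. \<phi> i x) + v * (INF i\<in>I. \<phi> i y) \<le> \<phi> i (u *\<^sub>R x + v *\<^sub>R y)" .
  qed
qed simp

text \<open>Every condition of \<open>int_minus_realization_bounded\<close> is a non-strict
  inequality between values at finitely many points, and so passes to the limit. The common bound on
  the means supplies \<open>M\<close>.\<close>

lemma int_minus_LIMSEQ:
  assumes \<mu>: "\<And>n::nat. \<mu> n \<in> P1" and lim: "\<And>s. (\<lambda>n. int_minus (\<mu> n) s) \<longlonglongrightarrow> \<phi> s"
    and \<kappa>: "\<kappa> \<in> P1" "\<And>n. leq_icv \<kappa> (\<mu> n)" and mean: "\<And>n. (\<integral>x. x \<partial>\<mu> n) \<le> M"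
  shows "\<phi> \<in> int_minus ` P1"
proof (rule int_minus_realization_bounded)
  show "concave_on UNIV \<phi>" using concave_int_minus[OF \<mu>] lim by (rule concave_on_LIMSEQ)
  show "\<kappa> \<in> P1" by fact
  fix s a b :: real
  show "int_minus \<kappa> s \<le> \<phi> s"
    using \<kappa>(2) by (intro LIMSEQ_le_const[OF lim]) (auto simp: leq_icv_def)
  show "\<phi> s \<le> 0"
    by (intro LIMSEQ_le_const2[OF lim]) (auto simp: int_minus_nonpos)
  show "\<phi> s + s \<le> M"
  proof (rule LIMSEQ_le_const2)
    show "(\<lambda>n. int_minus (\<mu> n) s + s) \<longlonglongrightarrow> \<phi> s + s" by (intro tendsto_intros lim)
    have "int_minus (\<mu> n) s + s \<le> M" for n
      using int_minus_le_mean[OF \<mu>, of n s] mean[of n] by linarith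
    then show "\<exists>N. \<forall>n\<ge>N. int_minus (\<mu> n) s + s \<le> M" by blast
  qed
  assume "a \<le> b"
  show "\<phi> a + a \<le> \<phi> b + b"
  proof (rule LIMSEQ_le)
    show "(\<lambda>n. int_minus (\<mu> n) a + a) \<longlonglongrightarrow> \<phi> a + a" "(\<lambda>n. int_minus (\<mu> n) b + b) \<longlonglongrightarrow> \<phi> b + b"
      by (intro tendsto_intros lim)+
    show "\<exists>N. \<forall>n\<ge>N. int_minus (\<mu> n) a + a \<le> int_minus (\<mu> n) b + b"
      using int_minus_add_mono[OF \<mu> \<open>a \<le> b\<close>] by blast
  qed
qed

text \<open>An infimum lies below each of its members, so the mean of a single one already bounds
  \<open>\<phi> s + s\<close>. From above no assumption on the whole family is required; from below
  the common bound \<kappa> excludes an escape of mass.\<close>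

lemma int_minus_INF:
  assumes "I \<noteq> {}" and \<mu>: "\<And>i. i \<in> I \<Longrightarrow> \<mu> i \<in> P1"
    and \<kappa>: "\<kappa> \<in> P1" "\<And>i. i \<in> I \<Longrightarrow> leq_icv \<kappa> (\<mu> i)"
  shows "(\<lambda>s. INF i\<in>I. int_minus (\<mu> i) s) \<in> int_minus ` P1"
proof -
  have bdd: "bdd_below ((\<lambda>i. int_minus (\<mu> i) s) ` I)" for s
    using \<kappa>(2) by (intro bdd_belowI2[where m="int_minus \<kappa> s"]) (auto simp: leq_icv_def)
  obtain j where j: "j \<in> I" using assms(1) by blast
  have le: "(INF i\<in>I. int_minus (\<mu> i) s) \<le> int_minus (\<mu> i) s" if "i \<in> I" for i s
    using cINF_lower[OF bdd that] .
  show ?thesis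
  proof (rule int_minus_realization_bounded)
    show "concave_on UNIV (\<lambda>s. INF i\<in>I. int_minus (\<mu> i) s)"
      using assms(1) concave_int_minus[OF \<mu>] bdd by (rule concave_on_INF)
    show "\<kappa> \<in> P1" by fact
    fix s a b :: real
    show "int_minus \<kappa> s \<le> (INF i\<in>I. int_minus (\<mu> i) s)"
      using \<kappa>(2) by (intro cINF_greatest assms(1)) (auto simp: leq_icv_def)
    show "(INF i\<in>I. int_minus (\<mu> i) s) \<le> 0"
      using le[OF j, of s] int_minus_nonpos[of "\<mu> j" s] by linarith
    show "(INF i\<in>I. int_minus (\<mu> i) s) + s \<le> (\<integral>x. x \<partial>\<mu> j)"
      using le[OF j, of s] int_minus_le_mean[OF \<mu>[OF j], of s] by linarith
    assume "a \<le> b"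
    have "(INF i\<in>I. int_minus (\<mu> i) a) + a - b \<le> (INF i\<in>I. int_minus (\<mu> i) b)"
    proof (rule cINF_greatest[OF assms(1)])
      fix i assume i: "i \<in> I"
      show "(INF i\<in>I. int_minus (\<mu> i) a) + a - b \<le> int_minus (\<mu> i) b"
        using le[OF i, of a] int_minus_add_mono[OF \<mu>[OF i] \<open>a \<le> b\<close>] by linarith
    qed
    then show "(INF i\<in>I. int_minus (\<mu> i) a) + a \<le> (INF i\<in>I. int_minus (\<mu> i) b) + b" by linarith
  qed
qed

text \<open>For two measures both limits of the minimum can be computed directly, so no common lower
  bound is presupposed. This provides lower bounds of pairs, from which the lattice property
  starts.\<close>

lemma int_minus_min:
  assumes \<mu>: "\<mu> \<in> P1" and \<nu>: "\<nu> \<in> P1"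
  shows "(\<lambda>s. min (int_minus \<mu> s) (int_minus \<nu> s)) \<in> int_minus ` P1"
proof -
  have "concave_on UNIV (\<lambda>s. INF \<rho>\<in>{\<mu>, \<nu>}. int_minus \<rho> s)"
    by (rule concave_on_INF) (use concave_int_minus \<mu> \<nu> in auto)
  moreover have "(INF \<rho>\<in>{\<mu>, \<nu>}. int_minus \<rho> s) = min (int_minus \<mu> s) (int_minus \<nu> s)" for s
    by (simp add: cInf_eq_Min)
  ultimately have concave: "concave_on UNIV (\<lambda>s. min (int_minus \<mu> s) (int_minus \<nu> s))" by simp
  have "((\<lambda>s. min (int_minus \<mu> s) (int_minus \<nu> s)) \<longlongrightarrow> min 0 0) at_bot"
    by (intro tendsto_min int_minus_at_bot \<mu> \<nu>)
  then have bot: "((\<lambda>s. min (int_minus \<mu> s) (int_minus \<nu> s)) \<longlongrightarrow> 0) at_bot" by simp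
  have "((\<lambda>s. min (int_minus \<mu> s + s) (int_minus \<nu> s + s)) \<longlongrightarrow>
      min (\<integral>x. x \<partial>\<mu>) (\<integral>x. x \<partial>\<nu>)) at_top"
    by (intro tendsto_min int_minus_add_at_top \<mu> \<nu>)
  then have "((\<lambda>s. min (int_minus \<mu> s) (int_minus \<nu> s) + s) \<longlongrightarrow>
      min (\<integral>x. x \<partial>\<mu>) (\<integral>x. x \<partial>\<nu>)) at_top"
    by (simp add: min_add_distrib_left)
  from int_minus_realization[OF concave bot this] show ?thesis by (metis imageI)
qed

lemma return_P1 [simp]: "return borel c \<in> P1"
  and int_minus_return: "int_minus (return borel c) s = min (c - s) 0"
  and mean_return: "(\<integral>x. x \<partial>return borel c) = (c :: real)"
proof -
  interpret prob_space "return borel c" by (simp add: prob_space_return)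
  show "return borel c \<in> P1"
  proof (rule P1_I[OF prob_space_axioms])
    have "AE x in return borel c. norm x \<le> \<bar>c\<bar>" by (subst AE_return) auto
    then show "integrable (return borel c) (\<lambda>x. x)" by (rule integrable_const_bound) simp
  qed simp
qed (simp_all add: int_minus_def integral_return)

lemma measurable_mean [measurable]: "(\<lambda>\<mu>. \<integral>x. x \<partial>\<mu>) \<in> borel_measurable borel_P1"
  by (rule borel_P1_measurable_lipschitz) (rule W1_lipschitz; simp add: P1_D(4))

text \<open>The mean is the limit of \<open>int_minus (f t) (real n) + real n\<close>, so
  \<open>int_plus (f t) s\<close> is a limit of measurable functions built from
  \<open>int_minus\<close>.\<close>

lemma measurable_borel_P1_int_minusI:
  assumes P: "\<And>t. t \<in> space \<pi> \<Longrightarrow> f t \<in> P1"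
    and meas: "\<And>s. (\<lambda>t. int_minus (f t) s) \<in> borel_measurable \<pi>"
  shows "f \<in> measurable \<pi> borel_P1"
proof (rule measurable_borel_P1I[OF P meas])
  fix s
  show "(\<lambda>t. int_plus (f t) s) \<in> borel_measurable \<pi>"
  proof (rule borel_measurable_LIMSEQ_real)
    fix t assume "t \<in> space \<pi>"
    from P[OF this] have "(\<lambda>n. (int_minus (f t) (real n) + real n) - int_minus (f t) s - s)
        \<longlonglongrightarrow> (\<integral>x. x \<partial>f t) - int_minus (f t) s - s"
      by (intro tendsto_intros filterlim_compose[OF int_minus_add_at_top filterlim_real_sequentially])
    moreover have "(\<integral>x. x \<partial>f t) - int_minus (f t) s - s = int_plus (f t) s"
      using int_plus_minus[OF P[OF \<open>t \<in> space \<pi>\<close>], of s] by simp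
    ultimately show "(\<lambda>n. (int_minus (f t) (real n) + real n) - int_minus (f t) s - s) \<longlonglongrightarrow> int_plus (f t) s"
      by simp
  next
    fix n :: nat
    show "(\<lambda>t. (int_minus (f t) (real n) + real n) - int_minus (f t) s - s) \<in> borel_measurable \<pi>"
      by (intro borel_measurable_diff borel_measurable_add meas borel_measurable_const)
  qed
qed

text \<open>A measure is chosen separately for each t, yet no measurable selection argument arises:
  measurability is tested on \<open>int_minus (h t) s\<close>, which is the measurable
  \<open>\<Phi> t s\<close> off the null set \<open>N\<close>. On \<open>N\<close> the Dirac mass at
  0 is a default that keeps all values in \<open>P1\<close>.\<close>

lemma int_minus_realization_AE:
  assumes meas: "\<And>s. (\<lambda>t. \<Phi> t s) \<in> borel_measurable \<pi>"
    and AE: "AE t in \<pi>. \<Phi> t \<in> int_minus ` P1"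
  obtains h where "h \<in> measurable \<pi> borel_P1" "AE t in \<pi>. int_minus (h t) = \<Phi> t"
proof -
  obtain N where N: "{t \<in> space \<pi>. \<Phi> t \<notin> int_minus ` P1} \<subseteq> N" "emeasure \<pi> N = 0" "N \<in> sets \<pi>"
    using AE by (rule AE_E)
  define h where "h t = (if t \<in> N then return borel 0 else inv_into P1 int_minus (\<Phi> t))" for t
  have h: "h t \<in> P1" "t \<notin> N \<Longrightarrow> int_minus (h t) = \<Phi> t" if "t \<in> space \<pi>" for t
    using N(1) that by (auto simp: h_def intro: inv_into_into f_inv_into_f)
  have "h \<in> measurable \<pi> borel_P1"
  proof (rule measurable_borel_P1_int_minusI[OF h(1)])
    fix s
    have "(\<lambda>t. if t \<in> N then min (0 - s) 0 else \<Phi> t s) \<in> borel_measurable \<pi>"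
      using N(3) by (intro measurable_If_set meas) auto
    also have "?this \<longleftrightarrow> (\<lambda>t. int_minus (h t) s) \<in> borel_measurable \<pi>"
    proof (rule measurable_cong)
      fix t assume "t \<in> space \<pi>"
      then show "(if t \<in> N then min (0 - s) 0 else \<Phi> t s) = int_minus (h t) s"
        using h(2)[of t] by (cases "t \<in> N") (simp_all add: h_def int_minus_return)
    qed
    finally show "(\<lambda>t. int_minus (h t) s) \<in> borel_measurable \<pi>" .
  qed
  moreover have "AE t in \<pi>. int_minus (h t) = \<Phi> t"
    using AE_not_in[OF null_setsI[OF N(2,3)]] AE_space by eventually_elim (simp add: h(2))
  ultimately show ?thesis by (rule that)
qed

subsection \<open>Essential suprema\<close>

text \<open>Maximize the integral of \<open>SUP c\<in>C. arctan (X c)\<close> against a finite equivalent weight over all countable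
  \<open>C\<close>. The conclusion avoids the supremum of \<open>X\<close> itself, which may be infinite.\<close>
lemma countable_ess_sup:
  fixes X :: "'i \<Rightarrow> 'a \<Rightarrow> real"
  assumes "sigma_finite_measure M" and X [measurable]: "\<And>i. i \<in> I \<Longrightarrow> X i \<in> borel_measurable M"
  obtains C where "C \<subseteq> I" "countable C"
    "\<And>i. i \<in> I \<Longrightarrow> AE t in M. \<forall>B. (\<forall>c\<in>C. X c t \<le> B) \<longrightarrow> X i t \<le> B"
proof -
  interpret sigma_finite_measure M by fact
  obtain w :: "'a \<Rightarrow> real" where w [measurable]: "w \<in> borel_measurable M"
    and w0: "\<And>t. w t > 0" and wint: "integrable M w"
    using obtain_positive_integrable_function by metis
  \<comment> \<open>Adding pi / 2 makes the arctangent positive, so the passage to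
    \<open>ennreal\<close> preserves the order of the values, and \<open>w t * pi\<close> is an
    integrable bound, so \<open>J\<close> is finite.\<close>
  define Z where "Z i t = ennreal (w t * (arctan (X i t) + pi / 2))" for i t
  have Z [measurable]: "Z i \<in> borel_measurable M" if "i \<in> I" for i
    unfolding Z_def using X[OF that] by measurable
  have Z_le: "Z i t \<le> ennreal (w t * pi)" for i t
    unfolding Z_def using w0[of t] arctan_ubound[of "X i t"]
    by (intro ennreal_leI mult_left_mono) auto
  define J where "J C = (\<integral>\<^sup>+ t. (SUP c\<in>C. Z c t) \<partial>M)" for C
  define K where "K = {C. C \<subseteq> I \<and> countable C}"
  have J_fin: "J C < \<infinity>" for C
  proof -
    have "J C \<le> (\<integral>\<^sup>+ t. ennreal (w t * pi) \<partial>M)"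
      unfolding J_def by (intro nn_integral_mono SUP_least Z_le)
    also have "\<dots> < \<infinity>"
    proof -
      have "integrable M (\<lambda>t. w t * pi)" using wint by simp
      from nn_integral_eq_integral[OF this] show ?thesis
        using w0 by (simp add: less_imp_le)
    qed
    finally show ?thesis .
  qed
  have J_mono: "J C \<le> J D" if "C \<subseteq> D" for C D
    unfolding J_def using that by (intro nn_integral_mono SUP_subset_mono) auto
  have "K \<noteq> {}" unfolding K_def by blast
  then obtain f :: "nat \<Rightarrow> ennreal" where f: "range f \<subseteq> J ` K" "Sup (J ` K) = Sup (range f)"
    using ennreal_SUP_countable_SUP[of K J] by auto
  then have "\<forall>n. \<exists>C. C \<in> K \<and> f n = J C" by blast
  then obtain D where D: "\<And>n. D n \<in> K" "\<And>n. f n = J (D n)" by metis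
  define C where "C = (\<Union>n. D n)"
  have C: "C \<subseteq> I" "countable C" using D(1) unfolding C_def K_def by auto
  have sup: "J E \<le> J C" if "E \<in> K" for E
  proof -
    have "J E \<le> Sup (range f)" using SUP_upper[OF that, of J] f(2) by simp
    also have "\<dots> \<le> J C" using D(2) by (auto intro!: SUP_least J_mono simp: C_def)
    finally show ?thesis .
  qed
  have "AE t in M. \<forall>B. (\<forall>c\<in>C. X c t \<le> B) \<longrightarrow> X i t \<le> B" if i: "i \<in> I" for i
  proof -
    let ?g = "\<lambda>t. SUP c\<in>insert i C. Z c t" and ?f = "\<lambda>t. SUP c\<in>C. Z c t"
    have f_meas: "?f \<in> borel_measurable M"
      using C by (intro borel_measurable_SUP Z) auto
    have g_meas: "?g \<in> borel_measurable M"
      using C i by (intro borel_measurable_SUP Z) auto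
    \<comment> \<open>Adjoining one index keeps the set countable, so by maximality of
      \<open>C\<close> the integral cannot grow. Since \<open>J C\<close> is finite, the two suprema
      under the integrals agree almost everywhere.\<close>
    have "J (insert i C) \<le> J C" using i C by (intro sup) (simp add: K_def)
    then have eq: "J (insert i C) = J C" using J_mono[OF subset_insertI] by (rule antisym)
    have "(\<integral>\<^sup>+ t. ?g t - ?f t \<partial>M) = J (insert i C) - J C"
      unfolding J_def using J_fin[of C]
      by (intro nn_integral_diff f_meas g_meas) (auto simp: J_def intro!: AE_I2 SUP_subset_mono)
    also have "\<dots> = 0" unfolding eq using J_fin[of C] by simp
    finally have "AE t in M. ?g t - ?f t = 0"
      using nn_integral_0_iff_AE[of "\<lambda>t. ?g t - ?f t" M] f_meas g_meas by simp
    then show ?thesis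
    proof eventually_elim
      case (elim t)
      have "Z i t \<le> ?g t" by (rule SUP_upper) simp
      also have "?g t \<le> ?f t" using elim by (rule ennreal_minus_eq_0)
      finally have le: "Z i t \<le> ?f t" .
      show ?case
      proof (intro allI impI)
        fix B assume B: "\<forall>c\<in>C. X c t \<le> B"
        have "?f t \<le> ennreal (w t * (arctan B + pi / 2))"
          unfolding Z_def using B w0[of t]
          by (intro SUP_least ennreal_leI mult_left_mono add_right_mono arctan_monotone') (auto simp: less_imp_le)
        with le have "Z i t \<le> ennreal (w t * (arctan B + pi / 2))" by (rule order_trans)
        moreover have "0 \<le> w t * (arctan B + pi / 2)"
          using w0[of t] arctan_lbound[of B] by (intro mult_nonneg_nonneg) auto
        ultimately have "w t * (arctan (X i t) + pi / 2) \<le> w t * (arctan B + pi / 2)"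
          unfolding Z_def by (simp only: ennreal_le_iff)
        then show "X i t \<le> B" using w0[of t] by (simp add: arctan_le_iff)
      qed
    qed
  qed
  with C show ?thesis by (rule that)
qed

lemma le_of_le_Rats:
  fixes f g :: "real \<Rightarrow> real"
  assumes "continuous_on UNIV f" "continuous_on UNIV g" and le: "\<And>q :: rat. f (of_rat q) \<le> g (of_rat q)"
  shows "f s \<le> g s"
proof -
  have "closed {s. f s \<le> g s}" using assms(1,2) by (rule closed_Collect_le)
  moreover have "\<rat> \<subseteq> {s. f s \<le> g s}" using le by (auto simp: Rats_def)
  ultimately have "closure \<rat> \<subseteq> {s. f s \<le> g s}" by (rule closure_minimal[rotated])
  then show ?thesis by (auto simp: Rats_closure_real)
qed

text \<open>One countable set is taken for each rational s, and their union works for all real s by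
  continuity. The result speaks of upper bounds \<open>g\<close> and not of a supremum, because the
  pointwise supremum of concave functions need not be \<open>int_minus\<close> of a measure. The
  parameter \<Psi> admits both \<open>int_minus\<close> and its negative.\<close>

lemma countable_determining_subset:
  fixes \<Psi> :: "real measure \<Rightarrow> real \<Rightarrow> real"
  assumes \<pi>: "sigma_finite_measure \<pi>" and "I \<noteq> {}"
    and F: "\<And>i. i \<in> I \<Longrightarrow> F i \<in> measurable \<pi> borel_P1"
    and \<Psi>: "\<And>s. (\<lambda>\<mu>. \<Psi> \<mu> s) \<in> borel_measurable borel_P1" "\<And>\<mu>. \<mu> \<in> P1 \<Longrightarrow> continuous_on UNIV (\<Psi> \<mu>)"
  shows "\<exists>C\<subseteq>I. countable C \<and> C \<noteq> {} \<and> (\<forall>i\<in>I. \<forall>g\<in>measurable \<pi> borel_P1.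
    (\<forall>c\<in>C. AE t in \<pi>. \<forall>s. \<Psi> (F c t) s \<le> \<Psi> (g t) s) \<longrightarrow> (AE t in \<pi>. \<forall>s. \<Psi> (F i t) s \<le> \<Psi> (g t) s))"
proof -
  define P where "P q C \<longleftrightarrow> C \<subseteq> I \<and> countable C \<and>
    (\<forall>i\<in>I. AE t in \<pi>. \<forall>B. (\<forall>c\<in>C. \<Psi> (F c t) (of_rat q) \<le> B) \<longrightarrow> \<Psi> (F i t) (of_rat q) \<le> B)"
    for q :: rat and C
  have "\<exists>C. P q C" for q
  proof (rule countable_ess_sup[OF \<pi>, of I "\<lambda>i t. \<Psi> (F i t) (of_rat q)"])
    show "(\<lambda>t. \<Psi> (F i t) (of_rat q)) \<in> borel_measurable \<pi>" if "i \<in> I" for i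
      using F[OF that] \<Psi>(1) by (rule measurable_compose)
  qed (auto simp: P_def)
  then obtain D where "\<And>q. P q (D q)" by metis
  then have D: "D q \<subseteq> I" "countable (D q)"
    "i \<in> I \<Longrightarrow> AE t in \<pi>. \<forall>B. (\<forall>c\<in>D q. \<Psi> (F c t) (of_rat q) \<le> B) \<longrightarrow> \<Psi> (F i t) (of_rat q) \<le> B"
    for q i by (auto simp: P_def)
  obtain j where j: "j \<in> I" using \<open>I \<noteq> {}\<close> by blast
  \<comment> \<open>Inserting \<open>j\<close> ensures that \<open>C\<close> is nonempty; all the
    sets \<open>D q\<close> may be empty when the whole space is a null set.\<close>
  define C where "C = insert j (\<Union>q. D q)"
  have C: "C \<subseteq> I" "countable C" "C \<noteq> {}" using D(1,2) j by (auto simp: C_def)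
  have "AE t in \<pi>. \<forall>s. \<Psi> (F i t) s \<le> \<Psi> (g t) s"
    if i: "i \<in> I" and g: "g \<in> measurable \<pi> borel_P1"
      and dom: "\<And>c. c \<in> C \<Longrightarrow> AE t in \<pi>. \<forall>s. \<Psi> (F c t) s \<le> \<Psi> (g t) s" for i g
  proof -
    have "AE t in \<pi>. \<forall>c\<in>C. \<forall>s. \<Psi> (F c t) s \<le> \<Psi> (g t) s"
      using dom C(2) by (rule AE_ball_countable')
    moreover have "AE t in \<pi>. \<forall>q. \<forall>B. (\<forall>c\<in>D q. \<Psi> (F c t) (of_rat q) \<le> B) \<longrightarrow> \<Psi> (F i t) (of_rat q) \<le> B"
      unfolding AE_all_countable using D(3)[OF i] by blast
    ultimately show ?thesis using AE_space
    proof eventually_elim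
      case (elim t)
      have "\<Psi> (F i t) (of_rat q) \<le> \<Psi> (g t) (of_rat q)" for q
      proof -
        have "\<forall>c\<in>D q. \<Psi> (F c t) (of_rat q) \<le> \<Psi> (g t) (of_rat q)" using elim(1) by (auto simp: C_def)
        then show ?thesis using elim(2) by blast
      qed
      moreover have "F i t \<in> P1" "g t \<in> P1"
        using measurable_borel_P1_in_P1[OF F[OF i] elim(3)] measurable_borel_P1_in_P1[OF g elim(3)] .
      ultimately show ?case using le_of_le_Rats[OF \<Psi>(2) \<Psi>(2)] by blast
    qed
  qed
  then have "\<forall>i\<in>I. \<forall>g\<in>measurable \<pi> borel_P1.
    (\<forall>c\<in>C. AE t in \<pi>. \<forall>s. \<Psi> (F c t) s \<le> \<Psi> (g t) s) \<longrightarrow> (AE t in \<pi>. \<forall>s. \<Psi> (F i t) s \<le> \<Psi> (g t) s)"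
    by (intro ballI impI) simp
  with C show ?thesis by (intro exI[of _ C] conjI)
qed

subsection \<open>The two orders and reflection\<close>

lemma leq_icv_refl: "leq_icv \<mu> \<mu>" and leq_icx_refl: "leq_icx \<mu> \<mu>"
  by (simp_all add: leq_icv_def leq_icx_def)

lemma leq_icv_trans: "leq_icv \<mu> \<nu> \<Longrightarrow> leq_icv \<nu> \<rho> \<Longrightarrow> leq_icv \<mu> \<rho>"
  and leq_icx_trans: "leq_icx \<mu> \<nu> \<Longrightarrow> leq_icx \<nu> \<rho> \<Longrightarrow> leq_icx \<mu> \<rho>"
  unfolding leq_icv_def leq_icx_def by (meson order_trans)+

lemma leq_icv_antisym:
  assumes "\<mu> \<in> P1" "\<nu> \<in> P1" "leq_icv \<mu> \<nu>" "leq_icv \<nu> \<mu>"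
  shows "\<mu> = \<nu>"
  using assms(3,4) by (intro int_minus_eqD assms(1,2) ext antisym) (simp_all add: leq_icv_def)

lemma leq_icv_mean:
  assumes "\<mu> \<in> P1" "\<nu> \<in> P1" "leq_icv \<mu> \<nu>"
  shows "(\<integral>x. x \<partial>\<mu>) \<le> (\<integral>x. x \<partial>\<nu>)"
  using assms(3)
  by (intro tendsto_le[OF _ int_minus_add_at_top[OF assms(2)] int_minus_add_at_top[OF assms(1)]])
    (simp_all add: leq_icv_def)

lemma leq_icv_return:
  assumes "\<mu> \<in> P1" "(\<integral>x. x \<partial>\<mu>) \<le> c"
  shows "leq_icv \<mu> (return borel c)"
  unfolding leq_icv_def int_minus_return
proof
  fix s show "int_minus \<mu> s \<le> min (c - s) 0"
    using int_minus_le_mean[OF assms(1), of s] assms(2) int_minus_nonpos[of \<mu> s] by simp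
qed

definition reflect :: "real measure \<Rightarrow> real measure" where
  "reflect \<mu> = distr \<mu> borel uminus"

lemma reflect_P1 [simp]:
  assumes "\<mu> \<in> P1" shows "reflect \<mu> \<in> P1"
proof (rule P1_I)
  interpret real_distribution \<mu> by (rule P1_D[OF assms])
  show "prob_space (reflect \<mu>)" unfolding reflect_def by (rule prob_space_distr) simp
  show "sets (reflect \<mu>) = sets borel" by (simp add: reflect_def)
  have "integrable \<mu> (\<lambda>x. - x)" using P1_D(4)[OF assms] by simp
  moreover have "uminus \<in> measurable \<mu> borel" by simp
  ultimately show "integrable (reflect \<mu>) (\<lambda>x. x)"
    unfolding reflect_def by (simp only: integrable_distr_eq[OF _ measurable_ident_sets[OF refl]])
qed

lemma integral_reflect:
  fixes f :: "real \<Rightarrow> real"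
  assumes "\<mu> \<in> P1" and f: "f \<in> borel_measurable borel"
  shows "(\<integral>x. f x \<partial>reflect \<mu>) = (\<integral>x. f (- x) \<partial>\<mu>)"
proof -
  interpret real_distribution \<mu> by (rule P1_D[OF assms(1)])
  show ?thesis unfolding reflect_def by (subst integral_distr[OF _ f]) simp_all
qed

lemma int_plus_reflect:
  assumes "\<mu> \<in> P1" shows "int_plus (reflect \<mu>) s = - int_minus \<mu> (- s)"
proof -
  have "int_plus (reflect \<mu>) s = (\<integral>x. max (- x - s) 0 \<partial>\<mu>)"
    unfolding int_plus_def by (rule integral_reflect[OF assms]) measurable
  also have "\<dots> = (\<integral>x. - min (x - (- s)) 0 \<partial>\<mu>)"
    by (rule Bochner_Integration.integral_cong) auto
  also have "\<dots> = - int_minus \<mu> (- s)"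
    unfolding int_minus_def by (rule Bochner_Integration.integral_minus)
  finally show ?thesis .
qed

lemma int_minus_reflect:
  assumes "\<mu> \<in> P1" shows "int_minus (reflect \<mu>) s = - int_plus \<mu> (- s)"
proof -
  have "int_minus (reflect \<mu>) s = (\<integral>x. min (- x - s) 0 \<partial>\<mu>)"
    unfolding int_minus_def by (rule integral_reflect[OF assms]) measurable
  also have "\<dots> = (\<integral>x. - max (x - (- s)) 0 \<partial>\<mu>)"
    by (rule Bochner_Integration.integral_cong) auto
  also have "\<dots> = - int_plus \<mu> (- s)"
    unfolding int_plus_def by (rule Bochner_Integration.integral_minus)
  finally show ?thesis .
qed

lemma mean_reflect:
  assumes "\<mu> \<in> P1" shows "(\<integral>x. x \<partial>reflect \<mu>) = - (\<integral>x. x \<partial>\<mu>)"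
  using integral_reflect[OF assms, of "\<lambda>x. x"] by simp

lemma leq_icx_reflect:
  assumes "\<mu> \<in> P1" "\<nu> \<in> P1"
  shows "leq_icx (reflect \<mu>) (reflect \<nu>) \<longleftrightarrow> leq_icv \<nu> \<mu>"
  unfolding leq_icx_def leq_icv_def int_plus_reflect[OF assms(1)] int_plus_reflect[OF assms(2)]
  by (metis minus_minus neg_le_iff_le)

lemma leq_icv_reflect:
  assumes "\<mu> \<in> P1" "\<nu> \<in> P1"
  shows "leq_icv (reflect \<mu>) (reflect \<nu>) \<longleftrightarrow> leq_icx \<nu> \<mu>"
  unfolding leq_icx_def leq_icv_def int_minus_reflect[OF assms(1)] int_minus_reflect[OF assms(2)]
  by (metis minus_minus neg_le_iff_le)

lemma reflect_reflect [simp]: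
  assumes "\<mu> \<in> P1" shows "reflect (reflect \<mu>) = \<mu>"
  using assms by (intro int_minus_eqD ext) (simp_all add: int_minus_reflect int_plus_reflect)

lemma leq_icx_antisym:
  assumes "\<mu> \<in> P1" "\<nu> \<in> P1" "leq_icx \<mu> \<nu>" "leq_icx \<nu> \<mu>"
  shows "\<mu> = \<nu>"
proof -
  have "reflect \<mu> = reflect \<nu>"
    using assms by (intro leq_icv_antisym) (simp_all add: leq_icv_reflect)
  then have "reflect (reflect \<mu>) = reflect (reflect \<nu>)" by simp
  then show ?thesis using assms(1,2) by simp
qed

lemma leq_icx_mean:
  assumes "\<mu> \<in> P1" "\<nu> \<in> P1" "leq_icx \<mu> \<nu>"
  shows "(\<integral>x. x \<partial>\<mu>) \<le> (\<integral>x. x \<partial>\<nu>)"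
  using leq_icv_mean[of "reflect \<nu>" "reflect \<mu>"] assms by (simp add: leq_icv_reflect mean_reflect)

lemma measurable_reflect:
  assumes f: "f \<in> measurable \<pi> borel_P1"
  shows "(\<lambda>t. reflect (f t)) \<in> measurable \<pi> borel_P1"
proof (rule measurable_borel_P1_int_minusI)
  show P: "reflect (f t) \<in> P1" if "t \<in> space \<pi>" for t
    using measurable_borel_P1_in_P1[OF f that] by simp
  fix s
  have "(\<lambda>t. - int_plus (f t) (- s)) \<in> borel_measurable \<pi>"
    by (rule borel_measurable_uminus) (rule measurable_compose[OF f measurable_int_plus])
  also have "?this \<longleftrightarrow> (\<lambda>t. int_minus (reflect (f t)) s) \<in> borel_measurable \<pi>"
    by (rule measurable_cong) (simp add: int_minus_reflect measurable_borel_P1_in_P1[OF f])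
  finally show "(\<lambda>t. int_minus (reflect (f t)) s) \<in> borel_measurable \<pi>" .
qed

lemma AE_P1:
  assumes "f \<in> measurable \<pi> borel_P1" shows "AE t in \<pi>. f t \<in> P1"
  using measurable_borel_P1_in_P1[OF assms] by (rule AE_I2)

subsection \<open>Essential bounds of families of random measures\<close>

text \<open>Essential suprema are the instances of the following definition with the converse of the order.
  The bound determined by the countable set \<open>C\<close> is at the same time the one of \<open>I\<close>.\<close>

definition ess_glb :: "'s measure \<Rightarrow> (real measure \<Rightarrow> real measure \<Rightarrow> bool) \<Rightarrow>
    ('i \<Rightarrow> 's \<Rightarrow> real measure) \<Rightarrow> 'i set \<Rightarrow> 'i set \<Rightarrow> ('s \<Rightarrow> real measure) \<Rightarrow> bool" where
  "ess_glb \<pi> R F I C h \<longleftrightarrow> h \<in> measurable \<pi> borel_P1 \<and> C \<subseteq> I \<and> countable C \<and> C \<noteq> {} \<and>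
    (\<forall>i\<in>I. AE t in \<pi>. R (h t) (F i t)) \<and>
    (\<forall>g\<in>measurable \<pi> borel_P1. (\<forall>c\<in>C. AE t in \<pi>. R (g t) (F c t)) \<longrightarrow> (AE t in \<pi>. R (g t) (h t)))"

lemma ess_glbI:
  assumes "h \<in> measurable \<pi> borel_P1" "C \<subseteq> I" "countable C" "C \<noteq> {}"
    "\<And>i. i \<in> I \<Longrightarrow> AE t in \<pi>. R (h t) (F i t)"
    "\<And>g. g \<in> measurable \<pi> borel_P1 \<Longrightarrow> (\<And>c. c \<in> C \<Longrightarrow> AE t in \<pi>. R (g t) (F c t)) \<Longrightarrow>
      AE t in \<pi>. R (g t) (h t)"
  shows "ess_glb \<pi> R F I C h"
  using assms unfolding ess_glb_def by blast

lemma ess_glbD: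
  assumes "ess_glb \<pi> R F I C h"
  shows "h \<in> measurable \<pi> borel_P1" "C \<subseteq> I" "countable C" "C \<noteq> {}"
    "i \<in> I \<Longrightarrow> AE t in \<pi>. R (h t) (F i t)"
    "g \<in> measurable \<pi> borel_P1 \<Longrightarrow> (\<And>c. c \<in> C \<Longrightarrow> AE t in \<pi>. R (g t) (F c t)) \<Longrightarrow>
      AE t in \<pi>. R (g t) (h t)"
  using assms unfolding ess_glb_def by blast+

text \<open>Reflection is an involution on \<open>P1\<close> that preserves measurability, so it
  carries lower bounds for \<open>R\<close> to lower bounds for \<open>R'\<close> and back. The
  determining set \<open>C\<close> stays the same.\<close>

lemma ess_glb_reflect:
  assumes h: "ess_glb \<pi> R (\<lambda>i t. reflect (F i t)) I C h"
    and F: "\<And>i. i \<in> I \<Longrightarrow> F i \<in> measurable \<pi> borel_P1"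
    and R: "\<And>\<mu> \<nu>. \<mu> \<in> P1 \<Longrightarrow> \<nu> \<in> P1 \<Longrightarrow> R (reflect \<mu>) (reflect \<nu>) \<longleftrightarrow> R' \<mu> \<nu>"
  shows "ess_glb \<pi> R' F I C (\<lambda>t. reflect (h t))"
proof (rule ess_glbI)
  note hD = ess_glbD[OF h]
  show "(\<lambda>t. reflect (h t)) \<in> measurable \<pi> borel_P1" by (rule measurable_reflect[OF hD(1)])
  show "C \<subseteq> I" "countable C" "C \<noteq> {}" by (fact hD)+
  show "AE t in \<pi>. R' (reflect (h t)) (F i t)" if i: "i \<in> I" for i
    using hD(5)[OF i] AE_P1[OF hD(1)] AE_P1[OF F[OF i]]
  proof eventually_elim
    case (elim t)
    then show ?case using R[of "reflect (h t)" "F i t"] by simp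
  qed
  show "AE t in \<pi>. R' (g t) (reflect (h t))"
    if g: "g \<in> measurable \<pi> borel_P1" and le: "\<And>c. c \<in> C \<Longrightarrow> AE t in \<pi>. R' (g t) (F c t)" for g
  proof -
    have "AE t in \<pi>. R (reflect (g t)) (reflect (F c t))" if c: "c \<in> C" for c
    proof -
      have "c \<in> I" using c hD(2) by blast
      show ?thesis
        using le[OF c] AE_P1[OF g] AE_P1[OF F[OF \<open>c \<in> I\<close>]] by eventually_elim (simp add: R)
    qed
    from hD(6)[OF measurable_reflect[OF g] this] have "AE t in \<pi>. R (reflect (g t)) (h t)" by simp
    then show ?thesis
      using AE_P1[OF g] AE_P1[OF hD(1)]
    proof eventually_elim
      case (elim t)
      then show ?case using R[of "g t" "reflect (h t)"] by simp
    qed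
  qed
qed

text \<open>Serves only to give a pair the common lower bound that \<open>icv_inf\<close> asks for,
  which is why maximality of \<open>h\<close> is not stated.\<close>

lemma measurable_meet:
  assumes f: "f \<in> measurable \<pi> borel_P1" and g: "g \<in> measurable \<pi> borel_P1"
  obtains h where "h \<in> measurable \<pi> borel_P1"
    "AE t in \<pi>. leq_icv (h t) (f t)" "AE t in \<pi>. leq_icv (h t) (g t)"
proof -
  have "AE t in \<pi>. (\<lambda>s. min (int_minus (f t) s) (int_minus (g t) s)) \<in> int_minus ` P1"
    using AE_P1[OF f] AE_P1[OF g] by eventually_elim (rule int_minus_min)
  moreover have "(\<lambda>t. min (int_minus (f t) s) (int_minus (g t) s)) \<in> borel_measurable \<pi>" for s
    by (intro borel_measurable_min measurable_compose[OF f measurable_int_minus]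
        measurable_compose[OF g measurable_int_minus])
  ultimately obtain h where h: "h \<in> measurable \<pi> borel_P1"
    "AE t in \<pi>. int_minus (h t) = (\<lambda>s. min (int_minus (f t) s) (int_minus (g t) s))"
    using int_minus_realization_AE[of "\<lambda>t s. min (int_minus (f t) s) (int_minus (g t) s)" \<pi>] by blast
  have "AE t in \<pi>. leq_icv (h t) (f t)" "AE t in \<pi>. leq_icv (h t) (g t)"
    using h(2) by (eventually_elim; simp add: leq_icv_def)+
  with h(1) show ?thesis by (rule that)
qed

text \<open>The bound \<open>h\<close> realizes the pointwise infimum of \<open>int_minus\<close>
  over a countable determining set. It stays below \<nu> in \<open>leq_icx\<close> because its mean
  is at most the mean of each member \<open>F c\<close>, which is at most
  \<open>int_plus \<nu> s + int_minus (F c) s + s\<close>; the infimum over c turns this into the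
  estimate for \<open>int_plus\<close> of \<open>h\<close>.\<close>

lemma icv_inf:
  assumes \<pi>: "sigma_finite_measure \<pi>" and I: "I \<noteq> {}"
    and F: "\<And>i. i \<in> I \<Longrightarrow> F i \<in> measurable \<pi> borel_P1"
    and lower: "(\<exists>\<kappa>\<in>measurable \<pi> borel_P1. \<forall>i\<in>I. AE t in \<pi>. leq_icv (\<kappa> t) (F i t)) \<or> (\<exists>i j. I = {i, j})"
  obtains h C where "ess_glb \<pi> leq_icv F I C h"
    "\<And>\<nu>. \<nu> \<in> measurable \<pi> borel_P1 \<Longrightarrow> (\<And>i. i \<in> I \<Longrightarrow> AE t in \<pi>. leq_icx (F i t) (\<nu> t)) \<Longrightarrow>
      AE t in \<pi>. leq_icx (h t) (\<nu> t)"
proof -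
  obtain \<kappa> where \<kappa>: "\<kappa> \<in> measurable \<pi> borel_P1" "\<And>i. i \<in> I \<Longrightarrow> AE t in \<pi>. leq_icv (\<kappa> t) (F i t)"
  proof (cases "\<exists>i j. I = {i, j}")
    case True
    then obtain i j where I: "I = {i, j}" by blast
    obtain \<kappa> where "\<kappa> \<in> measurable \<pi> borel_P1"
      "AE t in \<pi>. leq_icv (\<kappa> t) (F i t)" "AE t in \<pi>. leq_icv (\<kappa> t) (F j t)"
      by (rule measurable_meet[OF F F, of i j]) (auto simp: I)
    then show ?thesis using that[of \<kappa>] I by blast
  next
    case False
    then show ?thesis using lower that by blast
  qed
  obtain C where C: "C \<subseteq> I" "countable C" "C \<noteq> {}"
    and det: "\<forall>i\<in>I. \<forall>g\<in>measurable \<pi> borel_P1.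
      (\<forall>c\<in>C. AE t in \<pi>. \<forall>s. - int_minus (F c t) s \<le> - int_minus (g t) s) \<longrightarrow>
      (AE t in \<pi>. \<forall>s. - int_minus (F i t) s \<le> - int_minus (g t) s)"
  proof -
    have "\<exists>C\<subseteq>I. countable C \<and> C \<noteq> {} \<and> (\<forall>i\<in>I. \<forall>g\<in>measurable \<pi> borel_P1.
      (\<forall>c\<in>C. AE t in \<pi>. \<forall>s. - int_minus (F c t) s \<le> - int_minus (g t) s) \<longrightarrow>
      (AE t in \<pi>. \<forall>s. - int_minus (F i t) s \<le> - int_minus (g t) s))"
    \<comment> \<open>The determining set is formulated for upper bounds; the minus sign turns it
      into one for lower bounds.\<close>
    proof (rule countable_determining_subset[OF \<pi> I, where \<Psi>="\<lambda>\<mu> s. - int_minus \<mu> s"])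
      show "F i \<in> measurable \<pi> borel_P1" if "i \<in> I" for i by (rule F[OF that])
      show "(\<lambda>\<mu>. - int_minus \<mu> s) \<in> borel_measurable borel_P1" for s by measurable
      show "continuous_on UNIV (\<lambda>s. - int_minus \<mu> s)" if "\<mu> \<in> P1" for \<mu>
        using continuous_int_minus[OF that] by (rule continuous_on_minus)
    qed
    then show ?thesis by (elim exE conjE) (rule that)
  qed
  have FC: "AE t in \<pi>. \<forall>c\<in>C. F c t \<in> P1"
    by (rule AE_ball_countable'[OF _ C(2)], rule AE_P1[OF F], rule subsetD[OF C(1)])
  have lowC: "AE t in \<pi>. \<forall>c\<in>C. leq_icv (\<kappa> t) (F c t)"
    by (rule AE_ball_countable'[OF _ C(2)], rule \<kappa>(2), rule subsetD[OF C(1)])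
  define \<Phi> where "\<Phi> t s = (INF c\<in>C. int_minus (F c t) s)" for t s
  have "AE t in \<pi>. \<Phi> t \<in> int_minus ` P1"
    using FC lowC AE_P1[OF \<kappa>(1)]
  proof eventually_elim
    case (elim t)
    then show ?case
      using int_minus_INF[OF C(3), of "\<lambda>c. F c t" "\<kappa> t"] by (simp add: \<Phi>_def[abs_def])
  qed
  moreover have "(\<lambda>t. \<Phi> t s) \<in> borel_measurable \<pi>" for s
    unfolding \<Phi>_def
  proof (rule borel_measurable_cINF_real[OF C(2)])
    fix c assume "c \<in> C"
    then have "c \<in> I" using C(1) by blast
    from F[OF this] show "(\<lambda>t. int_minus (F c t) s) \<in> borel_measurable \<pi>"
      by (rule measurable_compose[OF _ measurable_int_minus])
  qed
  ultimately obtain h where h: "h \<in> measurable \<pi> borel_P1" and h\<Phi>: "AE t in \<pi>. int_minus (h t) = \<Phi> t"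
    using int_minus_realization_AE[of \<Phi> \<pi>] by blast
  have bdd: "bdd_below ((\<lambda>c. int_minus (F c t) s) ` C)" if "\<forall>c\<in>C. leq_icv (\<kappa> t) (F c t)" for t s
    using that by (intro bdd_belowI2[where m="int_minus (\<kappa> t) s"]) (simp add: leq_icv_def)
  have hC: "AE t in \<pi>. \<forall>c\<in>C. leq_icv (h t) (F c t)"
    using h\<Phi> lowC
  proof eventually_elim
    case (elim t)
    show ?case
    proof
      fix c assume c: "c \<in> C"
      show "leq_icv (h t) (F c t)"
        unfolding leq_icv_def elim(1) \<Phi>_def using cINF_lower[OF bdd[OF elim(2)] c] by blast
    qed
  qed
  have glb: "ess_glb \<pi> leq_icv F I C h"
  proof (rule ess_glbI[OF h C])
    show "AE t in \<pi>. leq_icv (h t) (F i t)" if i: "i \<in> I" for i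
    proof -
      have "AE t in \<pi>. \<forall>s. - int_minus (F c t) s \<le> - int_minus (h t) s" if c: "c \<in> C" for c
        using hC by eventually_elim (use c in \<open>simp add: leq_icv_def\<close>)
      then show ?thesis using bspec[OF bspec[OF det i] h] by (simp add: leq_icv_def)
    qed
    show "AE t in \<pi>. leq_icv (g t) (h t)"
      if le: "\<And>c. c \<in> C \<Longrightarrow> AE t in \<pi>. leq_icv (g t) (F c t)" for g
    proof -
      have "AE t in \<pi>. \<forall>c\<in>C. leq_icv (g t) (F c t)"
        using le C(2) by (rule AE_ball_countable')
      then show ?thesis
        using h\<Phi>
      proof eventually_elim
        case (elim t)
        show ?case
          unfolding leq_icv_def elim(2) \<Phi>_def
        proof
          fix s show "int_minus (g t) s \<le> (INF c\<in>C. int_minus (F c t) s)"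
            using elim(1) by (intro cINF_greatest C(3)) (simp add: leq_icv_def)
        qed
      qed
    qed
  qed
  have "AE t in \<pi>. leq_icx (h t) (\<nu> t)"
    if le: "\<And>i. i \<in> I \<Longrightarrow> AE t in \<pi>. leq_icx (F i t) (\<nu> t)" for \<nu>
  proof -
    have "AE t in \<pi>. \<forall>c\<in>C. leq_icx (F c t) (\<nu> t)"
      by (rule AE_ball_countable'[OF _ C(2)], rule le, rule subsetD[OF C(1)])
    then show ?thesis
      using h\<Phi> hC FC AE_P1[OF h]
    proof eventually_elim
      case (elim t)
      show ?case
        unfolding leq_icx_def
      proof
        fix s
        let ?m = "\<integral>x. x \<partial>h t"
        \<comment> \<open>The quantity \<open>int_minus (h t) b + b\<close> stands for the mean of
          \<open>h t\<close>, its limit as b tends to infinity; for fixed b it is bounded directly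
          through \<open>int_minus (F c t) b\<close>.\<close>
        have "int_minus (h t) b + b - int_plus (\<nu> t) s - s \<le> int_minus (h t) s" for b
          unfolding elim(2)[THEN fun_cong, of s] \<Phi>_def
        proof (rule cINF_greatest[OF C(3)])
          fix c assume c: "c \<in> C"
          have "int_minus (h t) b \<le> int_minus (F c t) b" using elim(3) c by (simp add: leq_icv_def)
          also have "\<dots> \<le> (\<integral>x. x \<partial>F c t) - b" using elim(4) c by (intro int_minus_le_mean) simp
          also have "(\<integral>x. x \<partial>F c t) = int_plus (F c t) s + int_minus (F c t) s + s"
            using int_plus_minus[of "F c t" s] elim(4) c by simp
          also have "int_plus (F c t) s \<le> int_plus (\<nu> t) s" using elim(1) c by (simp add: leq_icx_def)
          finally show "int_minus (h t) b + b - int_plus (\<nu> t) s - s \<le> int_minus (F c t) s" by simp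
        qed
        then have ev: "\<forall>\<^sub>F b in at_top. int_minus (h t) b + b \<le> int_minus (h t) s + int_plus (\<nu> t) s + s"
          by (intro always_eventually allI) (simp add: algebra_simps)
        have "?m \<le> int_minus (h t) s + int_plus (\<nu> t) s + s"
          by (rule tendsto_upperbound[OF int_minus_add_at_top[OF elim(5)] ev]) simp
        then show "int_plus (h t) s \<le> int_plus (\<nu> t) s"
          using int_plus_minus[OF elim(5), of s] by simp
      qed
    qed
  qed
  with glb show ?thesis by (rule that)
qed

text \<open>A bound on the means suffices because the Dirac mass at an upper bound of the means dominates
  the whole family in the increasing concave order.\<close>
lemma icv_sup:
  assumes \<pi>: "sigma_finite_measure \<pi>" and I: "I \<noteq> {}"
    and F: "\<And>i. i \<in> I \<Longrightarrow> F i \<in> measurable \<pi> borel_P1"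
    and upper: "\<And>i. i \<in> I \<Longrightarrow> AE t in \<pi>. (\<integral>x. x \<partial>F i t) \<le> b t"
  obtains h C where "ess_glb \<pi> (\<lambda>\<mu> \<nu>. leq_icv \<nu> \<mu>) F I C h"
    "\<And>\<nu>. \<nu> \<in> measurable \<pi> borel_P1 \<Longrightarrow> (\<And>i. i \<in> I \<Longrightarrow> AE t in \<pi>. leq_icx (F i t) (\<nu> t)) \<Longrightarrow>
      AE t in \<pi>. leq_icx (h t) (\<nu> t)"
proof -
  obtain C where C: "C \<subseteq> I" "countable C" "C \<noteq> {}"
    and det: "\<forall>i\<in>I. \<forall>g\<in>measurable \<pi> borel_P1.
      (\<forall>c\<in>C. AE t in \<pi>. \<forall>s. int_minus (F c t) s \<le> int_minus (g t) s) \<longrightarrow>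
      (AE t in \<pi>. \<forall>s. int_minus (F i t) s \<le> int_minus (g t) s)"
  proof -
    have "\<exists>C\<subseteq>I. countable C \<and> C \<noteq> {} \<and> (\<forall>i\<in>I. \<forall>g\<in>measurable \<pi> borel_P1.
      (\<forall>c\<in>C. AE t in \<pi>. \<forall>s. int_minus (F c t) s \<le> int_minus (g t) s) \<longrightarrow>
      (AE t in \<pi>. \<forall>s. int_minus (F i t) s \<le> int_minus (g t) s))"
      by (rule countable_determining_subset[OF \<pi> I F measurable_int_minus continuous_int_minus])
    then show ?thesis by (elim exE conjE) (rule that)
  qed
  have FC: "AE t in \<pi>. \<forall>c\<in>C. F c t \<in> P1"
    by (rule AE_ball_countable'[OF _ C(2)], rule AE_P1[OF F], rule subsetD[OF C(1)])
  have upC: "AE t in \<pi>. \<forall>c\<in>C. (\<integral>x. x \<partial>F c t) \<le> b t"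
    by (rule AE_ball_countable'[OF _ C(2)], rule upper, rule subsetD[OF C(1)])
  \<comment> \<open>The given bound \<open>b\<close> need not be measurable. The supremum of the
    means over the countable set \<open>C\<close>, written as a negated infimum, is measurable and
    dominates the same means.\<close>
  define M where "M t = - (INF c\<in>C. - (\<integral>x. x \<partial>F c t))" for t
  have M_meas: "M \<in> borel_measurable \<pi>"
    unfolding M_def
  proof (intro borel_measurable_uminus borel_measurable_cINF_real[OF C(2)])
    fix c assume "c \<in> C"
    then have "c \<in> I" using C(1) by blast
    from F[OF this] show "(\<lambda>t. \<integral>x. x \<partial>F c t) \<in> borel_measurable \<pi>"
      by (rule measurable_compose[OF _ measurable_mean])
  qed
  have mean_le: "(\<integral>x. x \<partial>F c t) \<le> M t" if "\<forall>c\<in>C. (\<integral>x. x \<partial>F c t) \<le> b t" "c \<in> C" for c t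
  proof -
    have "bdd_below ((\<lambda>c. - (\<integral>x. x \<partial>F c t)) ` C)"
      using that(1) by (intro bdd_belowI2[where m="- b t"]) simp
    from cINF_lower[OF this that(2)] show ?thesis by (simp add: M_def)
  qed
  have \<delta>_meas: "(\<lambda>t. return borel (M t)) \<in> measurable \<pi> borel_P1"
  proof (rule measurable_borel_P1_int_minusI)
    show "(\<lambda>t. int_minus (return borel (M t)) s) \<in> borel_measurable \<pi>" for s
      unfolding int_minus_return using M_meas by measurable
  qed simp
  have \<delta>C: "AE t in \<pi>. \<forall>c\<in>C. leq_icv (F c t) (return borel (M t))"
    using FC upC
  proof eventually_elim
    case (elim t)
    show ?case using elim(1) mean_le[OF elim(2)] by (blast intro: leq_icv_return)
  qed
  have \<delta>: "AE t in \<pi>. leq_icv (F i t) (return borel (M t))" if i: "i \<in> I" for i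
  proof -
    have "AE t in \<pi>. \<forall>s. int_minus (F c t) s \<le> int_minus (return borel (M t)) s" if c: "c \<in> C" for c
      using \<delta>C by eventually_elim (use c in \<open>simp add: leq_icv_def\<close>)
    then show ?thesis using bspec[OF bspec[OF det i] \<delta>_meas] by (simp add: leq_icv_def)
  qed
  \<comment> \<open>The supremum is found as the infimum of \<open>U\<close>, a set bounded below by
    any member \<open>F j\<close> of the family and nonempty because of the Dirac mass.\<close>
  define U where "U = {u \<in> measurable \<pi> borel_P1. \<forall>i\<in>I. AE t in \<pi>. leq_icv (F i t) (u t)}"
  have \<delta>U: "(\<lambda>t. return borel (M t)) \<in> U" using \<delta> \<delta>_meas by (simp add: U_def)
  obtain j where j: "j \<in> I" using I by blast
  obtain h D where hD: "ess_glb \<pi> leq_icv (\<lambda>u. u) U D h"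
  proof (rule icv_inf[OF \<pi>, of U "\<lambda>u. u"])
    show "U \<noteq> {}" using \<delta>U by blast
    show "u \<in> measurable \<pi> borel_P1" if "u \<in> U" for u using that by (simp add: U_def)
    show "(\<exists>\<kappa>\<in>measurable \<pi> borel_P1. \<forall>u\<in>U. AE t in \<pi>. leq_icv (\<kappa> t) (u t)) \<or> (\<exists>i j. U = {i, j})"
      using F[OF j] j by (intro disjI1 bexI[of _ "F j"]) (simp_all add: U_def)
  qed blast
  note h = ess_glbD[OF hD]
  have Fh: "AE t in \<pi>. leq_icv (F i t) (h t)" if i: "i \<in> I" for i
    using h(2) i by (intro h(6) F) (auto simp: U_def)
  have glb: "ess_glb \<pi> (\<lambda>\<mu> \<nu>. leq_icv \<nu> \<mu>) F I C h"
  proof (rule ess_glbI[OF h(1) C Fh])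
    show "AE t in \<pi>. leq_icv (h t) (g t)"
      if g: "g \<in> measurable \<pi> borel_P1" and le: "\<And>c. c \<in> C \<Longrightarrow> AE t in \<pi>. leq_icv (F c t) (g t)" for g
    proof (rule h(5))
      have "AE t in \<pi>. leq_icv (F i t) (g t)" if "i \<in> I" for i
        using bspec[OF bspec[OF det that] g] le by (simp add: leq_icv_def)
      then show "g \<in> U" using g by (simp add: U_def)
    qed
  qed
  have "AE t in \<pi>. leq_icx (h t) (\<nu> t)"
    if le: "\<And>i. i \<in> I \<Longrightarrow> AE t in \<pi>. leq_icx (F i t) (\<nu> t)" for \<nu>
  proof -
    have 1: "AE t in \<pi>. \<forall>c\<in>C. leq_icx (F c t) (\<nu> t)"
      by (rule AE_ball_countable'[OF _ C(2)], rule le, rule subsetD[OF C(1)])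
    have 2: "AE t in \<pi>. \<forall>c\<in>C. leq_icv (F c t) (h t)"
      by (rule AE_ball_countable'[OF _ C(2)], rule Fh, rule subsetD[OF C(1)])
    \<comment> \<open>As the least upper bound, \<open>h\<close> lies below the Dirac mass, so its
      mean is at most the supremum \<open>M t\<close> of the means of the family. An arbitrary upper
      bound in \<open>leq_icv\<close> could have a larger mean, and then \<open>int_plus\<close>
      would not be controlled.\<close>
    have 3: "AE t in \<pi>. leq_icv (h t) (return borel (M t))"
      by (rule h(5)[OF \<delta>U])
    show ?thesis
      using 1 2 3 FC AE_P1[OF h(1)]
    proof eventually_elim
      case (elim t)
      have mh: "(\<integral>x. x \<partial>h t) \<le> M t"
        using leq_icv_mean[OF elim(5) return_P1 elim(3)] by (simp add: mean_return)
      show ?case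
        unfolding leq_icx_def
      proof
        fix s
        have "- (int_plus (\<nu> t) s + int_minus (h t) s + s) \<le> (INF c\<in>C. - (\<integral>x. x \<partial>F c t))"
        proof (rule cINF_greatest[OF C(3)])
          fix c assume c: "c \<in> C"
          have "(\<integral>x. x \<partial>F c t) = int_plus (F c t) s + int_minus (F c t) s + s"
            using int_plus_minus[of "F c t" s] elim(4) c by simp
          moreover have "int_plus (F c t) s \<le> int_plus (\<nu> t) s" using elim(1) c by (simp add: leq_icx_def)
          moreover have "int_minus (F c t) s \<le> int_minus (h t) s" using elim(2) c by (simp add: leq_icv_def)
          ultimately show "- (int_plus (\<nu> t) s + int_minus (h t) s + s) \<le> - (\<integral>x. x \<partial>F c t)" by simp
        qed
        then have "M t \<le> int_plus (\<nu> t) s + int_minus (h t) s + s" by (simp add: M_def)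
        then show "int_plus (h t) s \<le> int_plus (\<nu> t) s"
          using int_plus_minus[OF elim(5), of s] mh by simp
      qed
    qed
  qed
  with glb show ?thesis by (rule that)
qed

section \<open>Convergence along monotone sequences\<close>

lemma int_plus_LIMSEQ:
  assumes \<mu>: "\<And>n::nat. \<mu> n \<in> P1" and h: "h \<in> P1" and \<nu>: "\<nu> \<in> P1"
    and lim: "\<And>s. (\<lambda>n. int_minus (\<mu> n) s) \<longlonglongrightarrow> int_minus h s" and le: "\<And>n. leq_icx (\<mu> n) \<nu>"
  shows "(\<lambda>n. int_plus (\<mu> n) s) \<longlonglongrightarrow> int_plus h s"
proof -
  have mean: "(\<lambda>n. \<integral>x. x \<partial>\<mu> n) \<longlonglongrightarrow> (\<integral>x. x \<partial>h)"
  proof (rule tendstoI)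
    fix e :: real assume "0 < e"
    then have e: "0 < e / 2" by simp
    \<comment> \<open>At one point s far to the right, \<open>int_plus\<close> is below e / 2 for
      the limit and, through \<nu>, for all members at once. The means then differ by less than e as
      soon as \<open>int_minus\<close> at this single s has come within e / 2 of its limit.\<close>
    have "\<forall>\<^sub>F s in at_top. int_plus \<nu> s < e / 2 \<and> int_plus h s < e / 2"
      using order_tendstoD(2)[OF int_plus_at_top[OF \<nu>] e] order_tendstoD(2)[OF int_plus_at_top[OF h] e]
      by (rule eventually_conj)
    from eventually_happens'[OF trivial_limit_at_top_linorder this]
    obtain s where s: "int_plus \<nu> s < e / 2" "int_plus h s < e / 2" by blast
    show "\<forall>\<^sub>F n in sequentially. dist (\<integral>x. x \<partial>\<mu> n) (\<integral>x. x \<partial>h) < e"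
      using tendstoD[OF lim[of s] e]
    proof eventually_elim
      case (elim n)
      have "int_plus (\<mu> n) s \<le> int_plus \<nu> s" using le by (simp add: leq_icx_def)
      then show ?case
        using elim s int_plus_nonneg[of "\<mu> n" s] int_plus_nonneg[of h s]
          int_plus_minus[OF \<mu>, of n s] int_plus_minus[OF h, of s]
        unfolding dist_real_def by linarith
    qed
  qed
  have eq: "int_plus \<rho> s = (\<integral>x. x \<partial>\<rho>) - s - int_minus \<rho> s" if "\<rho> \<in> P1" for \<rho>
    using int_plus_minus[OF that, of s] by simp
  show ?thesis
    unfolding eq[OF \<mu>] eq[OF h] by (intro tendsto_intros mean lim)
qed

text \<open>The pointwise limit of \<open>int_minus\<close> is realized by some \<open>k\<close>,
  which is itself a bound of the sequence for \<open>R\<close>; hence \<open>R (k t) (h t)\<close>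
  because \<open>h\<close> is the greatest such bound. Conversely the inequalities between
  \<open>h\<close> and the members pass to the limit, so \<open>k\<close> and \<open>h\<close> agree
  almost everywhere. This treats decreasing and increasing sequences alike, although an increasing
  limit is not a pointwise infimum.\<close>

lemma icv_monotone_convergence:
  assumes R: "R = leq_icv \<or> R = (\<lambda>\<mu> \<nu>. leq_icv \<nu> \<mu>)"
    and F: "\<And>n::nat. F n \<in> measurable \<pi> borel_P1" and h: "h \<in> measurable \<pi> borel_P1"
    and \<kappa>: "\<kappa> \<in> measurable \<pi> borel_P1" and \<nu>: "\<nu> \<in> measurable \<pi> borel_P1"
    and mono: "\<And>n. AE t in \<pi>. R (F (Suc n) t) (F n t)"
    and lower: "\<And>n. AE t in \<pi>. leq_icv (\<kappa> t) (F n t)" and upper: "\<And>n. AE t in \<pi>. leq_icx (F n t) (\<nu> t)"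
    and hF: "\<And>n. AE t in \<pi>. R (h t) (F n t)"
    and glb: "\<And>g. g \<in> measurable \<pi> borel_P1 \<Longrightarrow> (\<And>n. AE t in \<pi>. R (g t) (F n t)) \<Longrightarrow> AE t in \<pi>. R (g t) (h t)"
  shows "AE t in \<pi>. \<forall>s. (\<lambda>n. int_minus (F n t) s) \<longlonglongrightarrow> int_minus (h t) s \<and>
    (\<lambda>n. int_plus (F n t) s) \<longlonglongrightarrow> int_plus (h t) s"
proof -
  define \<Phi> where "\<Phi> t s = lim (\<lambda>n. int_minus (F n t) s)" for t s
  have all: "AE t in \<pi>. \<forall>n. F n t \<in> P1" "AE t in \<pi>. \<forall>n. R (F (Suc n) t) (F n t)"
    "AE t in \<pi>. \<forall>n. leq_icv (\<kappa> t) (F n t)" "AE t in \<pi>. \<forall>n. leq_icx (F n t) (\<nu> t)"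
    "AE t in \<pi>. \<forall>n. R (h t) (F n t)"
    unfolding AE_all_countable using AE_P1[OF F] mono lower upper hF by simp_all
  have conv: "AE t in \<pi>. \<forall>s. (\<lambda>n. int_minus (F n t) s) \<longlonglongrightarrow> \<Phi> t s"
    using all(2,3)
  proof eventually_elim
    case (elim t)
    show ?case
    proof
      fix s
      have "monoseq (\<lambda>n. int_minus (F n t) s)"
        using R elim(1) unfolding monoseq_Suc by (auto simp: leq_icv_def)
      moreover have "Bseq (\<lambda>n. int_minus (F n t) s)"
      proof (rule BseqI')
        fix n
        have "int_minus (\<kappa> t) s \<le> int_minus (F n t) s" using elim(2) by (simp add: leq_icv_def)
        then show "norm (int_minus (F n t) s) \<le> - int_minus (\<kappa> t) s"
          using int_minus_nonpos[of "F n t" s] by simp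
      qed
      ultimately have "convergent (\<lambda>n. int_minus (F n t) s)" by (rule Bseq_monoseq_convergent[rotated])
      then show "(\<lambda>n. int_minus (F n t) s) \<longlonglongrightarrow> \<Phi> t s"
        unfolding \<Phi>_def by (simp add: convergent_LIMSEQ_iff)
    qed
  qed
  have "AE t in \<pi>. \<Phi> t \<in> int_minus ` P1"
    using conv all(1,3,4) AE_P1[OF \<kappa>] AE_P1[OF \<nu>]
  proof eventually_elim
    case (elim t)
    have "(\<integral>x. x \<partial>F n t) \<le> (\<integral>x. x \<partial>\<nu> t)" for n
      using elim by (intro leq_icx_mean) simp_all
    then show ?case
      using elim by (intro int_minus_LIMSEQ[of "\<lambda>n. F n t" "\<Phi> t" "\<kappa> t"]) simp_all
  qed
  moreover have "(\<lambda>t. \<Phi> t s) \<in> borel_measurable \<pi>" for s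
    unfolding \<Phi>_def by (intro borel_measurable_lim_metric measurable_compose[OF F measurable_int_minus])
  ultimately obtain k where k: "k \<in> measurable \<pi> borel_P1" and k\<Phi>: "AE t in \<pi>. int_minus (k t) = \<Phi> t"
    using int_minus_realization_AE[of \<Phi> \<pi>] by blast
  have "AE t in \<pi>. R (k t) (F n t)" for n
    using conv k\<Phi> all(2)
  proof eventually_elim
    case (elim t)
    have lim: "(\<lambda>n. int_minus (F n t) s) \<longlonglongrightarrow> int_minus (k t) s" for s
      using elim by simp
    from R show ?case
    proof
      assume R: "R = leq_icv"
      have "decseq (\<lambda>n. int_minus (F n t) s)" for s
        using elim(3) unfolding R by (intro decseq_SucI) (simp add: leq_icv_def)
      from decseq_ge[OF this lim] show ?thesis unfolding R leq_icv_def by simp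
    next
      assume R: "R = (\<lambda>\<mu> \<nu>. leq_icv \<nu> \<mu>)"
      have "incseq (\<lambda>n. int_minus (F n t) s)" for s
        using elim(3) unfolding R by (intro incseq_SucI) (simp add: leq_icv_def)
      from incseq_le[OF this lim] show ?thesis unfolding R leq_icv_def by simp
    qed
  qed
  from glb[OF k this] have kh: "AE t in \<pi>. R (k t) (h t)" .
  show ?thesis
    using kh conv k\<Phi> all(1,4,5) AE_P1[OF k] AE_P1[OF h] AE_P1[OF \<nu>]
  proof eventually_elim
    case (elim t)
    have lim: "(\<lambda>n. int_minus (F n t) s) \<longlonglongrightarrow> int_minus (k t) s" for s
      using elim(2,3) by simp
    have "k t = h t"
      using R
    proof
      assume R: "R = leq_icv"
      have "int_minus (h t) s \<le> int_minus (k t) s" for s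
        using elim(6) unfolding R by (intro LIMSEQ_le_const[OF lim]) (simp add: leq_icv_def)
      then show ?thesis
        using elim(1,7,8) unfolding R by (intro leq_icv_antisym) (simp_all add: leq_icv_def)
    next
      assume R: "R = (\<lambda>\<mu> \<nu>. leq_icv \<nu> \<mu>)"
      have "int_minus (k t) s \<le> int_minus (h t) s" for s
        using elim(6) unfolding R by (intro LIMSEQ_le_const2[OF lim]) (simp add: leq_icv_def)
      then show ?thesis
        using elim(1,7,8) unfolding R by (intro leq_icv_antisym) (simp_all add: leq_icv_def)
    qed
    then have lim': "(\<lambda>n. int_minus (F n t) s) \<longlonglongrightarrow> int_minus (h t) s" for s
      using lim by simp
    have "(\<lambda>n. int_plus (F n t) s) \<longlonglongrightarrow> int_plus (h t) s" for s
      using elim(4,5,8,9) lim' by (intro int_plus_LIMSEQ[of "\<lambda>n. F n t" "h t" "\<nu> t"]) simp_all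
    with lim' show ?case by blast
  qed
qed

text \<open>Reflection exchanges the two bounds: the image of \<nu> bounds the reflected sequence
  below in \<open>leq_icv\<close>, and that of \<kappa> bounds it above in \<open>leq_icx\<close>.
  It also swaps the two convergences, up to sign and the substitution of -s for s.\<close>

lemma icx_monotone_convergence:
  assumes R: "R = leq_icx \<or> R = (\<lambda>\<mu> \<nu>. leq_icx \<nu> \<mu>)"
    and F: "\<And>n::nat. F n \<in> measurable \<pi> borel_P1" and h: "h \<in> measurable \<pi> borel_P1"
    and \<kappa>: "\<kappa> \<in> measurable \<pi> borel_P1" and \<nu>: "\<nu> \<in> measurable \<pi> borel_P1"
    and mono: "\<And>n. AE t in \<pi>. R (F (Suc n) t) (F n t)"
    and lower: "\<And>n. AE t in \<pi>. leq_icv (\<kappa> t) (F n t)" and upper: "\<And>n. AE t in \<pi>. leq_icx (F n t) (\<nu> t)"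
    and hF: "\<And>n. AE t in \<pi>. R (h t) (F n t)"
    and glb: "\<And>g. g \<in> measurable \<pi> borel_P1 \<Longrightarrow> (\<And>n. AE t in \<pi>. R (g t) (F n t)) \<Longrightarrow> AE t in \<pi>. R (g t) (h t)"
  shows "AE t in \<pi>. \<forall>s. (\<lambda>n. int_minus (F n t) s) \<longlonglongrightarrow> int_minus (h t) s \<and>
    (\<lambda>n. int_plus (F n t) s) \<longlonglongrightarrow> int_plus (h t) s"
proof -
  obtain R' where R': "R' = leq_icv \<or> R' = (\<lambda>\<mu> \<nu>. leq_icv \<nu> \<mu>)"
    and RR: "\<And>\<mu> \<nu>. \<mu> \<in> P1 \<Longrightarrow> \<nu> \<in> P1 \<Longrightarrow> R' (reflect \<mu>) (reflect \<nu>) \<longleftrightarrow> R \<mu> \<nu>"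
    using R
  proof
    assume "R = leq_icx"
    then show thesis by (intro that[of "\<lambda>\<mu> \<nu>. leq_icv \<nu> \<mu>"]) (simp_all add: leq_icv_reflect)
  next
    assume "R = (\<lambda>\<mu> \<nu>. leq_icx \<nu> \<mu>)"
    then show thesis by (intro that[of leq_icv]) (simp_all add: leq_icv_reflect)
  qed
  note P = AE_P1[OF F] AE_P1[OF h] AE_P1[OF \<kappa>] AE_P1[OF \<nu>]
  have "AE t in \<pi>. \<forall>s. (\<lambda>n. int_minus (reflect (F n t)) s) \<longlonglongrightarrow> int_minus (reflect (h t)) s \<and>
    (\<lambda>n. int_plus (reflect (F n t)) s) \<longlonglongrightarrow> int_plus (reflect (h t)) s"
  proof (rule icv_monotone_convergence[OF R' measurable_reflect[OF F] measurable_reflect[OF h]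
        measurable_reflect[OF \<nu>] measurable_reflect[OF \<kappa>]])
    fix n
    show "AE t in \<pi>. R' (reflect (F (Suc n) t)) (reflect (F n t))"
      using mono[of n] P(1)[of n] P(1)[of "Suc n"] by eventually_elim (simp add: RR)
    show "AE t in \<pi>. leq_icv (reflect (\<nu> t)) (reflect (F n t))"
      using upper[of n] P(1)[of n] P(4) by eventually_elim (simp add: leq_icv_reflect)
    show "AE t in \<pi>. leq_icx (reflect (F n t)) (reflect (\<kappa> t))"
      using lower[of n] P(1)[of n] P(3) by eventually_elim (simp add: leq_icx_reflect)
    show "AE t in \<pi>. R' (reflect (h t)) (reflect (F n t))"
      using hF[of n] P(1)[of n] P(2) by eventually_elim (simp add: RR)
  next
    fix g assume g: "g \<in> measurable \<pi> borel_P1" and le: "\<And>n. AE t in \<pi>. R' (g t) (reflect (F n t))"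
    have "AE t in \<pi>. R (reflect (g t)) (F n t)" for n
      using le[of n] P(1)[of n] AE_P1[OF g]
    proof eventually_elim
      case (elim t)
      then show ?case using RR[of "reflect (g t)" "F n t"] by simp
    qed
    from glb[OF measurable_reflect[OF g] this]
    show "AE t in \<pi>. R' (g t) (reflect (h t))"
      using P(2) AE_P1[OF g]
    proof eventually_elim
      case (elim t)
      then show ?case using RR[of "reflect (g t)" "h t"] by simp
    qed
  qed
  moreover have "AE t in \<pi>. \<forall>n. F n t \<in> P1" unfolding AE_all_countable using P(1) by blast
  ultimately show ?thesis
    using P(2)
  proof eventually_elim
    case (elim t)
    show ?case
    proof
      fix s
      have "(\<lambda>n. - int_plus (F n t) s) \<longlonglongrightarrow> - int_plus (h t) s"
        using elim(1)[THEN spec, of "- s"] elim(2,3) by (simp add: int_minus_reflect)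
      moreover have "(\<lambda>n. - int_minus (F n t) s) \<longlonglongrightarrow> - int_minus (h t) s"
        using elim(1)[THEN spec, of "- s"] elim(2,3) by (simp add: int_plus_reflect)
      ultimately show "(\<lambda>n. int_minus (F n t) s) \<longlonglongrightarrow> int_minus (h t) s \<and>
          (\<lambda>n. int_plus (F n t) s) \<longlonglongrightarrow> int_plus (h t) s"
        by (simp add: tendsto_minus_cancel_left[symmetric])
    qed
  qed
qed

text \<open>The three alternatives cover boundedness within a carrier, the pairs needed for the lattice
  property, and the hypothesis of part b), which for two of the four relations \<open>R\<close> is not a bound with
  respect to \<open>R\<close>.\<close>

definition order_bounded :: "'s measure \<Rightarrow> (real measure \<Rightarrow> real measure \<Rightarrow> bool) \<Rightarrow>
    ('i \<Rightarrow> 's \<Rightarrow> real measure) \<Rightarrow> 'i set \<Rightarrow> bool" where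
  "order_bounded \<pi> R F I \<longleftrightarrow>
    (\<exists>\<kappa>\<in>measurable \<pi> borel_P1. \<forall>i\<in>I. AE t in \<pi>. R (\<kappa> t) (F i t)) \<or> (\<exists>i j. I = {i, j}) \<or>
    (\<exists>\<kappa>\<in>measurable \<pi> borel_P1. \<exists>\<nu>\<in>measurable \<pi> borel_P1.
      \<forall>i\<in>I. (AE t in \<pi>. leq_icv (\<kappa> t) (F i t)) \<and> (AE t in \<pi>. leq_icx (F i t) (\<nu> t)))"

lemma ess_glb_icv:
  assumes \<pi>: "sigma_finite_measure \<pi>" and R: "R = leq_icv \<or> R = (\<lambda>\<mu> \<nu>. leq_icv \<nu> \<mu>)" and I: "I \<noteq> {}"
    and F: "\<And>i. i \<in> I \<Longrightarrow> F i \<in> measurable \<pi> borel_P1" and bounded: "order_bounded \<pi> R F I"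
  shows "\<exists>h C. ess_glb \<pi> R F I C h \<and> (\<forall>\<nu>\<in>measurable \<pi> borel_P1.
    (\<forall>i\<in>I. AE t in \<pi>. leq_icx (F i t) (\<nu> t)) \<longrightarrow> (AE t in \<pi>. leq_icx (h t) (\<nu> t)))"
  using R
proof
  assume R: "R = leq_icv"
  show ?thesis
  proof (rule icv_inf[OF \<pi> I])
    show "(\<exists>\<kappa>\<in>measurable \<pi> borel_P1. \<forall>i\<in>I. AE t in \<pi>. leq_icv (\<kappa> t) (F i t)) \<or> (\<exists>i j. I = {i, j})"
      using bounded unfolding order_bounded_def R by blast
    show "F i \<in> measurable \<pi> borel_P1" if "i \<in> I" for i by (rule F[OF that])
    fix h C
    assume "ess_glb \<pi> leq_icv F I C h" and pres:
      "\<And>\<nu>. \<nu> \<in> measurable \<pi> borel_P1 \<Longrightarrow> (\<And>i. i \<in> I \<Longrightarrow> AE t in \<pi>. leq_icx (F i t) (\<nu> t)) \<Longrightarrow>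
        AE t in \<pi>. leq_icx (h t) (\<nu> t)"
    then show ?thesis
      unfolding R by (intro exI[of _ h] exI[of _ C] conjI ballI impI pres) simp_all
  qed
next
  assume R: "R = (\<lambda>\<mu> \<nu>. leq_icv \<nu> \<mu>)"
  \<comment> \<open>Each kind of boundedness enters a supremum solely through a bound on the means.
    This is how an upper bound in \<open>leq_icx\<close> can replace one in
    \<open>leq_icv\<close>.\<close>
  obtain b where b: "\<And>i. i \<in> I \<Longrightarrow> AE t in \<pi>. (\<integral>x. x \<partial>F i t) \<le> b t"
  proof -
    consider \<kappa> where "\<kappa> \<in> measurable \<pi> borel_P1" "\<And>i. i \<in> I \<Longrightarrow> AE t in \<pi>. leq_icv (F i t) (\<kappa> t)"
      | i j where "I = {i, j}"
      | \<nu> where "\<nu> \<in> measurable \<pi> borel_P1" "\<And>i. i \<in> I \<Longrightarrow> AE t in \<pi>. leq_icx (F i t) (\<nu> t)"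
      using bounded unfolding order_bounded_def R by blast
    then show thesis
    proof cases
      case 1
      show thesis
      proof (rule that)
        fix i assume i: "i \<in> I"
        show "AE t in \<pi>. (\<integral>x. x \<partial>F i t) \<le> (\<integral>x. x \<partial>\<kappa> t)"
          using 1(2)[OF i] AE_P1[OF F[OF i]] AE_P1[OF 1(1)] by eventually_elim (rule leq_icv_mean)
      qed
    next
      case 2
      then show thesis by (intro that[of "\<lambda>t. max (\<integral>x. x \<partial>F i t) (\<integral>x. x \<partial>F j t)"]) auto
    next
      case 3
      show thesis
      proof (rule that)
        fix i assume i: "i \<in> I"
        show "AE t in \<pi>. (\<integral>x. x \<partial>F i t) \<le> (\<integral>x. x \<partial>\<nu> t)"
          using 3(2)[OF i] AE_P1[OF F[OF i]] AE_P1[OF 3(1)] by eventually_elim (rule leq_icx_mean)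
      qed
    qed
  qed
  show ?thesis
  proof (rule icv_sup[OF \<pi> I])
    show "AE t in \<pi>. (\<integral>x. x \<partial>F i t) \<le> b t" if "i \<in> I" for i by (rule b[OF that])
    show "F i \<in> measurable \<pi> borel_P1" if "i \<in> I" for i by (rule F[OF that])
    fix h C
    assume "ess_glb \<pi> (\<lambda>\<mu> \<nu>. leq_icv \<nu> \<mu>) F I C h" and pres:
      "\<And>\<nu>. \<nu> \<in> measurable \<pi> borel_P1 \<Longrightarrow> (\<And>i. i \<in> I \<Longrightarrow> AE t in \<pi>. leq_icx (F i t) (\<nu> t)) \<Longrightarrow>
        AE t in \<pi>. leq_icx (h t) (\<nu> t)"
    then show ?thesis
      unfolding R by (intro exI[of _ h] exI[of _ C] conjI ballI impI pres) simp_all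
  qed
qed

text \<open>Reflection reverses the direction as it exchanges the orders, so an infimum for
  \<open>leq_icx\<close> comes from a supremum for \<open>leq_icv\<close> and vice versa. The
  preserved upper bound in \<open>leq_icx\<close> becomes a preserved lower bound in
  \<open>leq_icv\<close>.\<close>

lemma ess_glb_icx:
  assumes \<pi>: "sigma_finite_measure \<pi>" and R: "R = leq_icx \<or> R = (\<lambda>\<mu> \<nu>. leq_icx \<nu> \<mu>)" and I: "I \<noteq> {}"
    and F: "\<And>i. i \<in> I \<Longrightarrow> F i \<in> measurable \<pi> borel_P1" and bounded: "order_bounded \<pi> R F I"
  shows "\<exists>h C. ess_glb \<pi> R F I C h \<and> (\<forall>\<nu>\<in>measurable \<pi> borel_P1.
    (\<forall>i\<in>I. AE t in \<pi>. leq_icv (\<nu> t) (F i t)) \<longrightarrow> (AE t in \<pi>. leq_icv (\<nu> t) (h t)))"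
proof -
  obtain R' where R': "R' = leq_icv \<or> R' = (\<lambda>\<mu> \<nu>. leq_icv \<nu> \<mu>)"
    and RR: "\<And>\<mu> \<nu>. \<mu> \<in> P1 \<Longrightarrow> \<nu> \<in> P1 \<Longrightarrow> R' (reflect \<mu>) (reflect \<nu>) \<longleftrightarrow> R \<mu> \<nu>"
    using R
  proof
    assume "R = leq_icx"
    then show thesis by (intro that[of "\<lambda>\<mu> \<nu>. leq_icv \<nu> \<mu>"]) (simp_all add: leq_icv_reflect)
  next
    assume "R = (\<lambda>\<mu> \<nu>. leq_icx \<nu> \<mu>)"
    then show thesis by (intro that[of leq_icv]) (simp_all add: leq_icv_reflect)
  qed
  note P = AE_P1[OF F]
  let ?F = "\<lambda>i t. reflect (F i t)"
  have "order_bounded \<pi> R' ?F I"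
  proof -
    consider \<kappa> where "\<kappa> \<in> measurable \<pi> borel_P1" "\<And>i. i \<in> I \<Longrightarrow> AE t in \<pi>. R (\<kappa> t) (F i t)"
      | "\<exists>i j. I = {i, j}"
      | \<kappa> \<nu> where "\<kappa> \<in> measurable \<pi> borel_P1" "\<nu> \<in> measurable \<pi> borel_P1"
        "\<And>i. i \<in> I \<Longrightarrow> AE t in \<pi>. leq_icv (\<kappa> t) (F i t)" "\<And>i. i \<in> I \<Longrightarrow> AE t in \<pi>. leq_icx (F i t) (\<nu> t)"
      using bounded unfolding order_bounded_def by blast
    then show ?thesis
    proof cases
      case 1
      have "AE t in \<pi>. R' (reflect (\<kappa> t)) (?F i t)" if i: "i \<in> I" for i
        using 1(2)[OF i] AE_P1[OF 1(1)] P[OF i] by eventually_elim (simp add: RR)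
      then show ?thesis
        unfolding order_bounded_def
        by (intro disjI1 bexI[of _ "\<lambda>t. reflect (\<kappa> t)"] measurable_reflect 1(1)) blast
    next
      case 2
      then show ?thesis unfolding order_bounded_def by blast
    next
      case 3
      have "AE t in \<pi>. leq_icx (?F i t) (reflect (\<kappa> t))" if i: "i \<in> I" for i
        using 3(3)[OF i] AE_P1[OF 3(1)] P[OF i] by eventually_elim (simp add: leq_icx_reflect)
      moreover have "AE t in \<pi>. leq_icv (reflect (\<nu> t)) (?F i t)" if i: "i \<in> I" for i
        using 3(4)[OF i] AE_P1[OF 3(2)] P[OF i] by eventually_elim (simp add: leq_icv_reflect)
      ultimately have "\<forall>i\<in>I. (AE t in \<pi>. leq_icv (reflect (\<nu> t)) (?F i t)) \<and>
          (AE t in \<pi>. leq_icx (?F i t) (reflect (\<kappa> t)))"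
        by simp
      then show ?thesis
        unfolding order_bounded_def
        by (intro disjI2) (rule bexI[OF bexI[OF _ measurable_reflect[OF 3(1)]] measurable_reflect[OF 3(2)]])
    qed
  qed
  then have "\<exists>h C. ess_glb \<pi> R' ?F I C h \<and> (\<forall>\<nu>\<in>measurable \<pi> borel_P1.
    (\<forall>i\<in>I. AE t in \<pi>. leq_icx (?F i t) (\<nu> t)) \<longrightarrow> (AE t in \<pi>. leq_icx (h t) (\<nu> t)))"
    by (intro ess_glb_icv[OF \<pi> R' I] measurable_reflect F)
  then obtain h C where h: "ess_glb \<pi> R' ?F I C h"
    and pres: "\<forall>\<nu>\<in>measurable \<pi> borel_P1.
    (\<forall>i\<in>I. AE t in \<pi>. leq_icx (?F i t) (\<nu> t)) \<longrightarrow> (AE t in \<pi>. leq_icx (h t) (\<nu> t))"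
    by blast
  have "AE t in \<pi>. leq_icv (\<nu> t) (reflect (h t))"
    if \<nu>: "\<nu> \<in> measurable \<pi> borel_P1" and le: "\<forall>i\<in>I. AE t in \<pi>. leq_icv (\<nu> t) (F i t)" for \<nu>
  proof -
    have "AE t in \<pi>. leq_icx (?F i t) (reflect (\<nu> t))" if i: "i \<in> I" for i
      using bspec[OF le i] AE_P1[OF \<nu>] P[OF i] by eventually_elim (simp add: leq_icx_reflect)
    then have "AE t in \<pi>. leq_icx (h t) (reflect (\<nu> t))"
      using bspec[OF pres measurable_reflect[OF \<nu>]] by simp
    then show ?thesis
      using AE_P1[OF \<nu>] AE_P1[OF ess_glbD(1)[OF h]]
    proof eventually_elim
      case (elim t)
      then show ?case using leq_icx_reflect[of "reflect (h t)" "\<nu> t"] by simp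
    qed
  qed
  moreover have "ess_glb \<pi> R F I C (\<lambda>t. reflect (h t))"
    by (rule ess_glb_reflect[OF h F RR])
  ultimately show ?thesis by (intro exI[of _ "\<lambda>t. reflect (h t)"] exI[of _ C]) simp
qed

subsection \<open>Passage to equivalence classes\<close>

definition ae_repr :: "('s \<Rightarrow> real measure) set \<Rightarrow> 's \<Rightarrow> real measure" where
  "ae_repr x = (SOME f. f \<in> x)"

definition ae_class :: "'s measure \<Rightarrow> ('s \<Rightarrow> real measure) \<Rightarrow> ('s \<Rightarrow> real measure) set" where
  "ae_class \<pi> h = ae_rel \<pi> `` {h}"

lemma L0_ae_repr:
  assumes "x \<in> L0 \<pi>"
  shows "ae_repr x \<in> x" "ae_repr x \<in> measurable \<pi> borel_P1"
proof -
  have x: "x \<in> measurable \<pi> borel_P1 // ae_rel \<pi>" using assms by (simp only: L0_def)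
  show *: "ae_repr x \<in> x"
    using in_quotient_imp_non_empty[OF equiv_ae_rel x] by (simp add: ae_repr_def some_in_eq)
  show "ae_repr x \<in> measurable \<pi> borel_P1"
    by (rule subsetD[OF in_quotient_imp_subset[OF equiv_ae_rel x] *])
qed

lemma ae_class_L0:
  assumes "h \<in> measurable \<pi> borel_P1"
  shows "ae_class \<pi> h \<in> L0 \<pi>" "h \<in> ae_class \<pi> h"
  using assms equiv_class_self[OF equiv_ae_rel assms] unfolding ae_class_def L0_def
  by (simp_all add: quotientI)

lemma L0_eqI:
  assumes "x \<in> L0 \<pi>" "y \<in> L0 \<pi>" "f \<in> x" "g \<in> y" "AE t in \<pi>. f t = g t"
  shows "x = y"
proof -
  have x: "x \<in> measurable \<pi> borel_P1 // ae_rel \<pi>" and y: "y \<in> measurable \<pi> borel_P1 // ae_rel \<pi>"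
    using assms(1,2) by (simp_all only: L0_def)
  have "(f, g) \<in> ae_rel \<pi>"
    using subsetD[OF in_quotient_imp_subset[OF equiv_ae_rel x] assms(3)]
      subsetD[OF in_quotient_imp_subset[OF equiv_ae_rel y] assms(4)] assms(5) by (simp add: ae_rel_def)
  then show ?thesis by (rule quotient_eqI[OF equiv_ae_rel x y assms(3,4)])
qed

text \<open>This notion is invariant under passing to the converse relation, so facts proved from it
  serve infima and suprema at once. Antisymmetry is restricted to \<open>P1\<close>, where the
  truncated means determine the measure.\<close>

definition P1_order :: "(real measure \<Rightarrow> real measure \<Rightarrow> bool) \<Rightarrow> bool" where
  "P1_order R \<longleftrightarrow> (\<forall>\<mu>. R \<mu> \<mu>) \<and> (\<forall>\<mu> \<nu> \<rho>. R \<mu> \<nu> \<longrightarrow> R \<nu> \<rho> \<longrightarrow> R \<mu> \<rho>) \<and>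
    (\<forall>\<mu>\<in>P1. \<forall>\<nu>\<in>P1. R \<mu> \<nu> \<longrightarrow> R \<nu> \<mu> \<longrightarrow> \<mu> = \<nu>)"

lemma P1_order_converse: "P1_order R \<Longrightarrow> P1_order (\<lambda>\<mu> \<nu>. R \<nu> \<mu>)"
  unfolding P1_order_def by blast

lemma P1_order_leq_icv: "P1_order leq_icv" and P1_order_leq_icx: "P1_order leq_icx"
  unfolding P1_order_def
  by (intro conjI allI ballI impI; (rule leq_icv_refl leq_icx_refl | erule (1) leq_icv_trans leq_icx_trans
      | rule leq_icv_antisym leq_icx_antisym; assumption))+

lemma lift_AE_converse: "lift_AE \<pi> (\<lambda>\<mu> \<nu>. R \<nu> \<mu>) x y \<longleftrightarrow> lift_AE \<pi> R y x"
  unfolding lift_AE_def by blast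

lemma lift_AE_refl:
  assumes "P1_order R" "x \<in> L0 \<pi>" shows "lift_AE \<pi> R x x"
  unfolding lift_AE_iff[OF assms(2,2) L0_ae_repr(1)[OF assms(2)] L0_ae_repr(1)[OF assms(2)]]
  using assms(1) by (simp add: P1_order_def)

lemma lift_AE_trans:
  assumes R: "P1_order R" and x: "x \<in> L0 \<pi>" and y: "y \<in> L0 \<pi>" and z: "z \<in> L0 \<pi>"
    and le: "lift_AE \<pi> R x y" "lift_AE \<pi> R y z"
  shows "lift_AE \<pi> R x z"
proof -
  note r = L0_ae_repr(1)
  have "AE t in \<pi>. R (ae_repr x t) (ae_repr y t)" "AE t in \<pi>. R (ae_repr y t) (ae_repr z t)"
    using le lift_AE_iff[OF x y r[OF x] r[OF y]] lift_AE_iff[OF y z r[OF y] r[OF z]] by blast+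
  then have "AE t in \<pi>. R (ae_repr x t) (ae_repr z t)"
  proof eventually_elim
    case (elim t)
    then show ?case using R unfolding P1_order_def by blast
  qed
  then show ?thesis unfolding lift_AE_iff[OF x z r[OF x] r[OF z]] .
qed

lemma lift_AE_antisym:
  assumes R: "P1_order R" and x: "x \<in> L0 \<pi>" and y: "y \<in> L0 \<pi>"
    and le: "lift_AE \<pi> R x y" "lift_AE \<pi> R y x"
  shows "x = y"
proof (rule L0_eqI[OF x y L0_ae_repr(1)[OF x] L0_ae_repr(1)[OF y]])
  note r = L0_ae_repr(1)
  have "AE t in \<pi>. R (ae_repr x t) (ae_repr y t)" "AE t in \<pi>. R (ae_repr y t) (ae_repr x t)"
    using le lift_AE_iff[OF x y r[OF x] r[OF y]] lift_AE_iff[OF y x r[OF y] r[OF x]] by blast+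
  then show "AE t in \<pi>. ae_repr x t = ae_repr y t"
    using AE_P1[OF L0_ae_repr(2)[OF x]] AE_P1[OF L0_ae_repr(2)[OF y]]
  proof eventually_elim
    case (elim t)
    then show ?case using R unfolding P1_order_def by blast
  qed
qed

text \<open>A common form for \<open>L0_icv\<close>, \<open>L0_icx\<close>, their restrictions to
  smaller carriers and their duals; the dual is obtained by replacing \<open>R\<close> with its
  converse.\<close>

definition L0_order :: "'s measure \<Rightarrow> ('s \<Rightarrow> real measure) set set \<Rightarrow>
    (real measure \<Rightarrow> real measure \<Rightarrow> bool) \<Rightarrow> ('s \<Rightarrow> real measure) set gorder" where
  "L0_order \<pi> K R = \<lparr>carrier = K, eq = (=), le = lift_AE \<pi> R\<rparr>"

lemma L0_order_simps [simp]:
  "carrier (L0_order \<pi> K R) = K" "eq (L0_order \<pi> K R) = (=)" "le (L0_order \<pi> K R) = lift_AE \<pi> R"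
  by (simp_all add: L0_order_def)

lemma Lower_L0_order: "A \<subseteq> K \<Longrightarrow> Lower (L0_order \<pi> K R) A = {l \<in> K. \<forall>x\<in>A. lift_AE \<pi> R l x}"
  and Upper_L0_order: "A \<subseteq> K \<Longrightarrow> Upper (L0_order \<pi> K R) A = {u \<in> K. \<forall>x\<in>A. lift_AE \<pi> R x u}"
  unfolding Lower_def Upper_def L0_order_simps by blast+

lemma is_glb_L0_order:
  assumes "A \<subseteq> K"
  shows "is_glb (L0_order \<pi> K R) i A \<longleftrightarrow>
    i \<in> K \<and> (\<forall>x\<in>A. lift_AE \<pi> R i x) \<and> (\<forall>l\<in>K. (\<forall>x\<in>A. lift_AE \<pi> R l x) \<longrightarrow> lift_AE \<pi> R l i)"
  unfolding greatest_def Lower_L0_order[OF assms] L0_order_simps by blast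

lemma is_lub_L0_order:
  assumes "A \<subseteq> K"
  shows "is_lub (L0_order \<pi> K R) i A \<longleftrightarrow> is_glb (L0_order \<pi> K (\<lambda>\<mu> \<nu>. R \<nu> \<mu>)) i A"
  unfolding is_glb_L0_order[OF assms] lift_AE_converse[of \<pi> R] least_def Upper_L0_order[OF assms] L0_order_simps
  by blast

lemma partial_order_L0_order:
  assumes R: "P1_order R" and K: "K \<subseteq> L0 \<pi>"
  shows "partial_order (L0_order \<pi> K R)"
proof
  fix x y z
  show "x \<in> carrier (L0_order \<pi> K R) \<Longrightarrow> x \<sqsubseteq>\<^bsub>L0_order \<pi> K R\<^esub> x"
    using lift_AE_refl[OF R, of x \<pi>] K by (simp add: subset_iff)
  show "x .=\<^bsub>L0_order \<pi> K R\<^esub> y" if "x \<sqsubseteq>\<^bsub>L0_order \<pi> K R\<^esub> y" "y \<sqsubseteq>\<^bsub>L0_order \<pi> K R\<^esub> x"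
    "x \<in> carrier (L0_order \<pi> K R)" "y \<in> carrier (L0_order \<pi> K R)"
    using lift_AE_antisym[OF R, of x \<pi> y] K that by (simp add: subset_iff)
  show "x \<sqsubseteq>\<^bsub>L0_order \<pi> K R\<^esub> z" if "x \<sqsubseteq>\<^bsub>L0_order \<pi> K R\<^esub> y" "y \<sqsubseteq>\<^bsub>L0_order \<pi> K R\<^esub> z"
    "x \<in> carrier (L0_order \<pi> K R)" "y \<in> carrier (L0_order \<pi> K R)" "z \<in> carrier (L0_order \<pi> K R)"
    using lift_AE_trans[OF R, of x \<pi> y z] K that by (simp add: subset_iff)
qed simp_all

text \<open>The intermediate set \<open>B\<close> is there so that the choices \<open>A\<close> and
  \<open>C\<close> show the same class to be the bound of the set and of its countable subset, as
  super completeness demands.\<close>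

lemma ess_glb_is_glb:
  assumes K: "K \<subseteq> L0 \<pi>" and A: "A \<subseteq> K" and h: "ess_glb \<pi> R ae_repr A C h" and hK: "ae_class \<pi> h \<in> K"
    and B: "C \<subseteq> B" "B \<subseteq> A"
  shows "is_glb (L0_order \<pi> K R) (ae_class \<pi> h) B"
proof -
  note hD = ess_glbD[OF h]
  note hL = ae_class_L0[OF hD(1)]
  have AL: "x \<in> L0 \<pi>" if "x \<in> A" for x using that A K by blast
  have "lift_AE \<pi> R (ae_class \<pi> h) x" if x: "x \<in> A" for x
    unfolding lift_AE_iff[OF hL(1) AL[OF x] hL(2) L0_ae_repr(1)[OF AL[OF x]]] by (rule hD(5)[OF x])
  moreover have "lift_AE \<pi> R l (ae_class \<pi> h)" if l: "l \<in> K" and le: "\<And>x. x \<in> C \<Longrightarrow> lift_AE \<pi> R l x" for l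
  proof -
    have lL: "l \<in> L0 \<pi>" using l K by blast
    have "AE t in \<pi>. R (ae_repr l t) (ae_repr c t)" if c: "c \<in> C" for c
    proof -
      have "c \<in> L0 \<pi>" using c hD(2) AL by blast
      from lift_AE_iff[OF lL this L0_ae_repr(1)[OF lL] L0_ae_repr(1)[OF this]] show ?thesis
        using le[OF c] by blast
    qed
    from hD(6)[OF L0_ae_repr(2)[OF lL] this] show ?thesis
      unfolding lift_AE_iff[OF lL hL(1) L0_ae_repr(1)[OF lL] hL(2)] .
  qed
  moreover have "B \<subseteq> K" using A B by blast
  ultimately show ?thesis using hK B unfolding is_glb_L0_order[OF \<open>B \<subseteq> K\<close>] by blast
qed

text \<open>Half of Dedekind super completeness. The alternative for pairs yields the lattice
  property, since two elements of the carrier are not known beforehand to have a common lower bound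
  in it.\<close>

definition glb_complete :: "'s measure \<Rightarrow> ('s \<Rightarrow> real measure) set set \<Rightarrow>
    (real measure \<Rightarrow> real measure \<Rightarrow> bool) \<Rightarrow> bool" where
  "glb_complete \<pi> K R \<longleftrightarrow> (\<forall>A. A \<subseteq> K \<longrightarrow> A \<noteq> {} \<longrightarrow>
    Lower (L0_order \<pi> K R) A \<noteq> {} \<or> (\<exists>x y. A = {x, y}) \<longrightarrow>
    (\<exists>i C. C \<subseteq> A \<and> countable C \<and> is_glb (L0_order \<pi> K R) i A \<and> is_glb (L0_order \<pi> K R) i C))"

lemma dedekind_super_complete_L0_order:
  assumes R: "P1_order R" and K: "K \<subseteq> L0 \<pi>"
    and inf: "glb_complete \<pi> K R" and sup: "glb_complete \<pi> K (\<lambda>\<mu> \<nu>. R \<nu> \<mu>)"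
  shows "dedekind_super_complete_lattice (L0_order \<pi> K R)"
proof -
  interpret partial_order "L0_order \<pi> K R" by (rule partial_order_L0_order[OF R K])
  have glb: "\<exists>i C. C \<subseteq> A \<and> countable C \<and> is_glb (L0_order \<pi> K R) i A \<and> is_glb (L0_order \<pi> K R) i C"
    if "A \<subseteq> K" "A \<noteq> {}" "Lower (L0_order \<pi> K R) A \<noteq> {} \<or> (\<exists>x y. A = {x, y})" for A
    by (rule inf[unfolded glb_complete_def, rule_format, OF that])
  have lub: "\<exists>s C. C \<subseteq> A \<and> countable C \<and> is_lub (L0_order \<pi> K R) s A \<and> is_lub (L0_order \<pi> K R) s C"
    if A: "A \<subseteq> K" "A \<noteq> {}" "Upper (L0_order \<pi> K R) A \<noteq> {} \<or> (\<exists>x y. A = {x, y})" for A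
  proof -
    have "Lower (L0_order \<pi> K (\<lambda>\<mu> \<nu>. R \<nu> \<mu>)) A = Upper (L0_order \<pi> K R) A"
      unfolding Lower_L0_order[OF A(1)] Upper_L0_order[OF A(1)] lift_AE_converse[of \<pi> R] ..
    with A(3) have "Lower (L0_order \<pi> K (\<lambda>\<mu> \<nu>. R \<nu> \<mu>)) A \<noteq> {} \<or> (\<exists>x y. A = {x, y})" by simp
    from sup[unfolded glb_complete_def, rule_format, OF A(1,2) this]
    obtain i C where "C \<subseteq> A" "countable C" "is_glb (L0_order \<pi> K (\<lambda>\<mu> \<nu>. R \<nu> \<mu>)) i A"
      "is_glb (L0_order \<pi> K (\<lambda>\<mu> \<nu>. R \<nu> \<mu>)) i C"
      by (elim exE conjE)
    moreover have "C \<subseteq> K" using \<open>C \<subseteq> A\<close> A(1) by blast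
    ultimately show ?thesis using A(1) 
      by (intro exI[of _ i] exI[of _ C]) (simp add: is_lub_L0_order[OF A(1)] is_lub_L0_order[OF \<open>C \<subseteq> K\<close>])
  qed
  have "Lattice.lattice (L0_order \<pi> K R)"
  proof
    fix x y assume xy: "x \<in> carrier (L0_order \<pi> K R)" "y \<in> carrier (L0_order \<pi> K R)"
    then have "{x, y} \<subseteq> K" "{x, y} \<noteq> {}" by simp_all
    then show "\<exists>s. is_lub (L0_order \<pi> K R) s {x, y}" "\<exists>s. is_glb (L0_order \<pi> K R) s {x, y}"
      using lub[of "{x, y}"] glb[of "{x, y}"] by blast+
  qed
  moreover have "\<exists>s. is_lub (L0_order \<pi> K R) s A \<and> (\<exists>C\<subseteq>A. countable C \<and> is_lub (L0_order \<pi> K R) s C)"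
    if "A \<subseteq> K" "A \<noteq> {}" "Upper (L0_order \<pi> K R) A \<noteq> {}" for A
    using lub[of A] that by blast
  moreover have "\<exists>i. is_glb (L0_order \<pi> K R) i A \<and> (\<exists>C\<subseteq>A. countable C \<and> is_glb (L0_order \<pi> K R) i C)"
    if "A \<subseteq> K" "A \<noteq> {}" "Lower (L0_order \<pi> K R) A \<noteq> {}" for A
    using glb[of A] that by blast
  ultimately show ?thesis unfolding dedekind_super_complete_lattice_def L0_order_simps by simp
qed

lemma order_bounded_ae_repr:
  assumes K: "K \<subseteq> L0 \<pi>" and A: "A \<subseteq> K" and "Lower (L0_order \<pi> K R) A \<noteq> {} \<or> (\<exists>x y. A = {x, y})"
  shows "order_bounded \<pi> R ae_repr A"
  using assms(3)
proof
  assume "Lower (L0_order \<pi> K R) A \<noteq> {}"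
  then obtain l where l: "l \<in> K" "\<And>x. x \<in> A \<Longrightarrow> lift_AE \<pi> R l x"
    unfolding Lower_L0_order[OF A] by blast
  then have lL: "l \<in> L0 \<pi>" using K by blast
  have "AE t in \<pi>. R (ae_repr l t) (ae_repr x t)" if x: "x \<in> A" for x
  proof -
    have xL: "x \<in> L0 \<pi>" using x A K by blast
    from l(2)[OF x] show ?thesis
      unfolding lift_AE_iff[OF lL xL L0_ae_repr(1)[OF lL] L0_ae_repr(1)[OF xL]] .
  qed
  then have "\<forall>x\<in>A. AE t in \<pi>. R (ae_repr l t) (ae_repr x t)" by blast
  then show ?thesis
    unfolding order_bounded_def by (rule disjI1[OF bexI[OF _ L0_ae_repr(2)[OF lL]]])
next
  assume "\<exists>x y. A = {x, y}"
  then show ?thesis unfolding order_bounded_def by blast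
qed

lemma glb_completeI:
  assumes K: "K \<subseteq> L0 \<pi>"
    and glb: "\<And>A. A \<subseteq> K \<Longrightarrow> A \<noteq> {} \<Longrightarrow> order_bounded \<pi> R ae_repr A \<Longrightarrow>
      \<exists>h C. ess_glb \<pi> R ae_repr A C h \<and> ae_class \<pi> h \<in> K"
  shows "glb_complete \<pi> K R"
  unfolding glb_complete_def
proof (intro allI impI)
  fix A assume A: "A \<subseteq> K" "A \<noteq> {}" "Lower (L0_order \<pi> K R) A \<noteq> {} \<or> (\<exists>x y. A = {x, y})"
  obtain h C where h: "ess_glb \<pi> R ae_repr A C h" "ae_class \<pi> h \<in> K"
    using glb[OF A(1,2) order_bounded_ae_repr[OF K A(1,3)]] by blast
  note hD = ess_glbD[OF h(1)]
  show "\<exists>i C. C \<subseteq> A \<and> countable C \<and> is_glb (L0_order \<pi> K R) i A \<and> is_glb (L0_order \<pi> K R) i C"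
    using hD(2,3) ess_glb_is_glb[OF K A(1) h hD(2) subset_refl]
      ess_glb_is_glb[OF K A(1) h subset_refl hD(2)] by blast
qed

text \<open>The restricted carrier is closed under these bounds because they keep every upper bound
  in \<open>leq_icx\<close> of the family. The unrestricted version gives the joins and meets that
  occur in the definition of directedness.\<close>

lemma glb_complete_icv:
  assumes \<pi>: "sigma_finite_measure \<pi>" and R: "R = leq_icv \<or> R = (\<lambda>\<mu> \<nu>. leq_icv \<nu> \<mu>)"
  shows "glb_complete \<pi> (L0 \<pi>) R"
    and "\<nu> \<in> L0 \<pi> \<Longrightarrow> glb_complete \<pi> {\<mu> \<in> L0 \<pi>. lift_AE \<pi> leq_icx \<mu> \<nu>} R"
proof -
  have ex: "\<exists>h C. ess_glb \<pi> R ae_repr A C h \<and> (\<forall>\<nu>\<in>measurable \<pi> borel_P1.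
    (\<forall>i\<in>A. AE t in \<pi>. leq_icx (ae_repr i t) (\<nu> t)) \<longrightarrow> (AE t in \<pi>. leq_icx (h t) (\<nu> t)))"
    if "A \<subseteq> L0 \<pi>" "A \<noteq> {}" "order_bounded \<pi> R ae_repr A" for A
    using that by (intro ess_glb_icv[OF \<pi> R] L0_ae_repr(2)) auto
  show "glb_complete \<pi> (L0 \<pi>) R"
  proof (rule glb_completeI[OF subset_refl])
    fix A assume "A \<subseteq> L0 \<pi>" "A \<noteq> {}" "order_bounded \<pi> R ae_repr A"
    from ex[OF this] show "\<exists>h C. ess_glb \<pi> R ae_repr A C h \<and> ae_class \<pi> h \<in> L0 \<pi>"
      using ess_glbD(1) ae_class_L0(1) by blast
  qed
  assume \<nu>: "\<nu> \<in> L0 \<pi>"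
  show "glb_complete \<pi> {\<mu> \<in> L0 \<pi>. lift_AE \<pi> leq_icx \<mu> \<nu>} R"
  proof (rule glb_completeI)
    fix A assume A: "A \<subseteq> {\<mu> \<in> L0 \<pi>. lift_AE \<pi> leq_icx \<mu> \<nu>}" "A \<noteq> {}" "order_bounded \<pi> R ae_repr A"
    have AL: "A \<subseteq> L0 \<pi>" using A(1) by blast
    obtain h C where h: "ess_glb \<pi> R ae_repr A C h" and pres: "\<forall>\<nu>\<in>measurable \<pi> borel_P1.
      (\<forall>i\<in>A. AE t in \<pi>. leq_icx (ae_repr i t) (\<nu> t)) \<longrightarrow> (AE t in \<pi>. leq_icx (h t) (\<nu> t))"
      using ex[OF AL A(2,3)] by blast
    have "AE t in \<pi>. leq_icx (ae_repr x t) (ae_repr \<nu> t)" if x: "x \<in> A" for x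
    proof -
      have xL: "x \<in> L0 \<pi>" and le: "lift_AE \<pi> leq_icx x \<nu>" using x A(1) by blast+
      from le show ?thesis unfolding lift_AE_iff[OF xL \<nu> L0_ae_repr(1)[OF xL] L0_ae_repr(1)[OF \<nu>]] .
    qed
    then have le: "AE t in \<pi>. leq_icx (h t) (ae_repr \<nu> t)"
      using bspec[OF pres L0_ae_repr(2)[OF \<nu>]] by simp
    note hL = ae_class_L0[OF ess_glbD(1)[OF h]]
    have "lift_AE \<pi> leq_icx (ae_class \<pi> h) \<nu>"
      unfolding lift_AE_iff[OF hL(1) \<nu> hL(2) L0_ae_repr(1)[OF \<nu>]] by (rule le)
    then show "\<exists>h C. ess_glb \<pi> R ae_repr A C h \<and> ae_class \<pi> h \<in> {\<mu> \<in> L0 \<pi>. lift_AE \<pi> leq_icx \<mu> \<nu>}"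
      using h hL(1) by blast
  qed blast
qed

lemma glb_complete_icx:
  assumes \<pi>: "sigma_finite_measure \<pi>" and R: "R = leq_icx \<or> R = (\<lambda>\<mu> \<nu>. leq_icx \<nu> \<mu>)"
  shows "glb_complete \<pi> (L0 \<pi>) R"
    and "\<nu> \<in> L0 \<pi> \<Longrightarrow> glb_complete \<pi> {\<mu> \<in> L0 \<pi>. lift_AE \<pi> leq_icv \<nu> \<mu>} R"
proof -
  have ex: "\<exists>h C. ess_glb \<pi> R ae_repr A C h \<and> (\<forall>\<nu>\<in>measurable \<pi> borel_P1.
    (\<forall>i\<in>A. AE t in \<pi>. leq_icv (\<nu> t) (ae_repr i t)) \<longrightarrow> (AE t in \<pi>. leq_icv (\<nu> t) (h t)))"
    if "A \<subseteq> L0 \<pi>" "A \<noteq> {}" "order_bounded \<pi> R ae_repr A" for A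
    using that by (intro ess_glb_icx[OF \<pi> R] L0_ae_repr(2)) auto
  show "glb_complete \<pi> (L0 \<pi>) R"
  proof (rule glb_completeI[OF subset_refl])
    fix A assume "A \<subseteq> L0 \<pi>" "A \<noteq> {}" "order_bounded \<pi> R ae_repr A"
    from ex[OF this] show "\<exists>h C. ess_glb \<pi> R ae_repr A C h \<and> ae_class \<pi> h \<in> L0 \<pi>"
      using ess_glbD(1) ae_class_L0(1) by blast
  qed
  assume \<nu>: "\<nu> \<in> L0 \<pi>"
  show "glb_complete \<pi> {\<mu> \<in> L0 \<pi>. lift_AE \<pi> leq_icv \<nu> \<mu>} R"
  proof (rule glb_completeI)
    fix A assume A: "A \<subseteq> {\<mu> \<in> L0 \<pi>. lift_AE \<pi> leq_icv \<nu> \<mu>}" "A \<noteq> {}" "order_bounded \<pi> R ae_repr A"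
    have AL: "A \<subseteq> L0 \<pi>" using A(1) by blast
    obtain h C where h: "ess_glb \<pi> R ae_repr A C h" and pres: "\<forall>\<nu>\<in>measurable \<pi> borel_P1.
      (\<forall>i\<in>A. AE t in \<pi>. leq_icv (\<nu> t) (ae_repr i t)) \<longrightarrow> (AE t in \<pi>. leq_icv (\<nu> t) (h t))"
      using ex[OF AL A(2,3)] by blast
    have "AE t in \<pi>. leq_icv (ae_repr \<nu> t) (ae_repr x t)" if x: "x \<in> A" for x
    proof -
      have xL: "x \<in> L0 \<pi>" and le: "lift_AE \<pi> leq_icv \<nu> x" using x A(1) by blast+
      from le show ?thesis unfolding lift_AE_iff[OF \<nu> xL L0_ae_repr(1)[OF \<nu>] L0_ae_repr(1)[OF xL]] .
    qed
    then have le: "AE t in \<pi>. leq_icv (ae_repr \<nu> t) (h t)"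
      using bspec[OF pres L0_ae_repr(2)[OF \<nu>]] by simp
    note hL = ae_class_L0[OF ess_glbD(1)[OF h]]
    have "lift_AE \<pi> leq_icv \<nu> (ae_class \<pi> h)"
      unfolding lift_AE_iff[OF \<nu> hL(1) L0_ae_repr(1)[OF \<nu>] hL(2)] by (rule le)
    then show "\<exists>h C. ess_glb \<pi> R ae_repr A C h \<and> ae_class \<pi> h \<in> {\<mu> \<in> L0 \<pi>. lift_AE \<pi> leq_icv \<nu> \<mu>}"
      using h hL(1) by blast
  qed blast
qed

section \<open>Directed sets and their limits\<close>

lemma directed_sequence:
  assumes trans: "\<And>x y z. x \<in> M \<Longrightarrow> y \<in> M \<Longrightarrow> z \<in> M \<Longrightarrow> P x y \<Longrightarrow> P y z \<Longrightarrow> P x z"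
    and refl: "\<And>x. x \<in> M \<Longrightarrow> P x x"
    and directed: "\<forall>x\<in>M. \<forall>y\<in>M. \<exists>z\<in>M. P z x \<and> P z y"
    and C: "C \<subseteq> M" "countable C" "C \<noteq> {}"
  shows "\<exists>\<mu> :: nat \<Rightarrow> 'a. (\<forall>n. \<mu> n \<in> M) \<and> (\<forall>m n. m \<le> n \<longrightarrow> P (\<mu> n) (\<mu> m)) \<and>
    (\<forall>c\<in>C. \<exists>n. P (\<mu> n) c)"
proof -
  define e where "e = from_nat_into C"
  have e: "e n \<in> M" for n using from_nat_into[OF C(3)] C(1) unfolding e_def by blast
  \<comment> \<open>With \<open>e\<close> enumerating \<open>C\<close>, each new term is chosen
    below its predecessor and below the next element of the enumeration, so every element of
    \<open>C\<close> eventually has a term below it.\<close>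
  have "\<exists>\<mu>. \<forall>n. (\<mu> n \<in> M \<and> P (\<mu> n) (e n)) \<and> P (\<mu> (Suc n)) (\<mu> n)"
  proof (rule dependent_nat_choice)
    show "\<exists>x. x \<in> M \<and> P x (e 0)" using e refl by blast
    fix x n assume "x \<in> M \<and> P x (e n)"
    then show "\<exists>y. (y \<in> M \<and> P y (e (Suc n))) \<and> P y x" using directed e by blast
  qed
  then obtain \<mu> where \<mu>: "\<And>n. \<mu> n \<in> M" "\<And>n. P (\<mu> n) (e n)" "\<And>n. P (\<mu> (Suc n)) (\<mu> n)" by blast
  have "P (\<mu> n) (\<mu> m)" if "m \<le> n" for m n
    using that
  proof (induction rule: dec_induct)
    case base
    then show ?case by (rule refl[OF \<mu>(1)])
  next
    case (step k)
    show ?case by (rule trans[OF \<mu>(1) \<mu>(1) \<mu>(1) \<mu>(3) step.IH])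
  qed
  moreover have "\<exists>n. P (\<mu> n) c" if "c \<in> C" for c
    using \<mu>(2) from_nat_into_surj[OF C(2) that] unfolding e_def by metis
  ultimately show ?thesis using \<mu>(1) by (intro exI[of _ \<mu>]) simp
qed

text \<open>The sequence goes below each element of a countable determining set, so its greatest
  lower bound is that of the whole of \<open>M\<close>, and monotone convergence applies to it.
  Upward directed sets are covered by the converse relations among the four choices of
  \<open>R\<close>.\<close>

lemma directed_limit:
  assumes \<pi>: "sigma_finite_measure \<pi>"
    and R: "(R = leq_icv \<or> R = (\<lambda>\<mu> \<nu>. leq_icv \<nu> \<mu>)) \<or> (R = leq_icx \<or> R = (\<lambda>\<mu> \<nu>. leq_icx \<nu> \<mu>))"
    and M: "M \<subseteq> L0 \<pi>" "M \<noteq> {}" and l: "l \<in> L0 \<pi>" "\<forall>x\<in>M. lift_AE \<pi> leq_icv l x"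
    and u: "u \<in> L0 \<pi>" "\<forall>x\<in>M. lift_AE \<pi> leq_icx x u"
    and directed: "\<forall>x\<in>M. \<forall>y\<in>M. \<exists>z\<in>M. lift_AE \<pi> R z x \<and> lift_AE \<pi> R z y"
  shows "\<exists>\<mu>s \<mu>. (\<forall>n. \<mu>s n \<in> M) \<and> (\<forall>m n. m \<le> n \<longrightarrow> lift_AE \<pi> R (\<mu>s n) (\<mu>s m)) \<and>
    \<mu> \<in> L0 \<pi> \<and> is_glb (L0_order \<pi> (L0 \<pi>) R) \<mu> M \<and> AE_W1_tendsto \<pi> \<mu>s \<mu>"
proof -
  have ord: "P1_order R"
    using R P1_order_leq_icv P1_order_leq_icx P1_order_converse[OF P1_order_leq_icv]
      P1_order_converse[OF P1_order_leq_icx] by auto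
  note r = L0_ae_repr(1) and meas = L0_ae_repr(2)
  have M_L0: "x \<in> L0 \<pi>" if "x \<in> M" for x using that M(1) by blast
  have lower: "AE t in \<pi>. leq_icv (ae_repr l t) (ae_repr x t)" if x: "x \<in> M" for x
    using bspec[OF l(2) x] unfolding lift_AE_iff[OF l(1) M_L0[OF x] r[OF l(1)] r[OF M_L0[OF x]]] .
  have upper: "AE t in \<pi>. leq_icx (ae_repr x t) (ae_repr u t)" if x: "x \<in> M" for x
    using bspec[OF u(2) x] unfolding lift_AE_iff[OF M_L0[OF x] u(1) r[OF M_L0[OF x]] r[OF u(1)]] .
  have "\<forall>x\<in>M. (AE t in \<pi>. leq_icv (ae_repr l t) (ae_repr x t)) \<and> (AE t in \<pi>. leq_icx (ae_repr x t) (ae_repr u t))"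
    using lower upper by blast
  then have "order_bounded \<pi> R ae_repr M"
    unfolding order_bounded_def
    by (intro disjI2) (rule bexI[OF bexI[OF _ meas[OF u(1)]] meas[OF l(1)]])
  note bounded = this
  have rM: "ae_repr x \<in> measurable \<pi> borel_P1" if "x \<in> M" for x by (rule meas[OF M_L0[OF that]])
  have "\<exists>h C. ess_glb \<pi> R ae_repr M C h"
    using R
  proof
    assume R': "R = leq_icv \<or> R = (\<lambda>\<mu> \<nu>. leq_icv \<nu> \<mu>)"
    show ?thesis
      by (rule exE[OF ess_glb_icv[OF \<pi> R' M(2) _ bounded]], erule rM, blast)
  next
    assume R': "R = leq_icx \<or> R = (\<lambda>\<mu> \<nu>. leq_icx \<nu> \<mu>)"
    show ?thesis
      by (rule exE[OF ess_glb_icx[OF \<pi> R' M(2) _ bounded]], erule rM, blast)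
  qed
  then obtain h C where h: "ess_glb \<pi> R ae_repr M C h" by blast
  note hD = ess_glbD[OF h]
  note hL = ae_class_L0[OF hD(1)]
  have "\<exists>\<mu>s :: nat \<Rightarrow> _. (\<forall>n. \<mu>s n \<in> M) \<and> (\<forall>m n. m \<le> n \<longrightarrow> lift_AE \<pi> R (\<mu>s n) (\<mu>s m)) \<and>
    (\<forall>c\<in>C. \<exists>n. lift_AE \<pi> R (\<mu>s n) c)"
  proof (rule directed_sequence[OF _ _ directed hD(2,3,4)])
    show "lift_AE \<pi> R x z" if "x \<in> M" "y \<in> M" "z \<in> M" "lift_AE \<pi> R x y" "lift_AE \<pi> R y z" for x y z
      by (rule lift_AE_trans[OF ord M_L0[OF that(1)] M_L0[OF that(2)] M_L0[OF that(3)] that(4,5)])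
    show "lift_AE \<pi> R x x" if "x \<in> M" for x by (rule lift_AE_refl[OF ord M_L0[OF that]])
  qed
  then obtain \<mu>s where \<mu>s: "\<And>n::nat. \<mu>s n \<in> M" "\<And>m n. m \<le> n \<Longrightarrow> lift_AE \<pi> R (\<mu>s n) (\<mu>s m)"
    "\<And>c. c \<in> C \<Longrightarrow> \<exists>n. lift_AE \<pi> R (\<mu>s n) c"
    by blast
  let ?F = "\<lambda>n. ae_repr (\<mu>s n)"
  have FL: "\<mu>s n \<in> L0 \<pi>" for n by (rule M_L0[OF \<mu>s(1)])
  have F: "?F n \<in> measurable \<pi> borel_P1" for n by (rule meas[OF FL])
  have mono: "AE t in \<pi>. R (?F (Suc n) t) (?F n t)" for n
    using \<mu>s(2)[of n "Suc n"] unfolding lift_AE_iff[OF FL FL r[OF FL] r[OF FL]] by simp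
  have hF: "AE t in \<pi>. R (h t) (?F n t)" for n by (rule hD(5)[OF \<mu>s(1)])
  \<comment> \<open>A lower bound of the sequence lies below every element of \<open>C\<close>, by
    transitivity through a suitable term, and hence below \<open>h\<close>.\<close>
  have glb: "AE t in \<pi>. R (g t) (h t)"
    if g: "g \<in> measurable \<pi> borel_P1" and le: "\<And>n. AE t in \<pi>. R (g t) (?F n t)" for g
  proof (rule hD(6)[OF g])
    fix c assume c: "c \<in> C"
    then have cL: "c \<in> L0 \<pi>" using hD(2) M_L0 by blast
    obtain n where "lift_AE \<pi> R (\<mu>s n) c" using \<mu>s(3)[OF c] by blast
    then have "AE t in \<pi>. R (?F n t) (ae_repr c t)"
      unfolding lift_AE_iff[OF FL cL r[OF FL] r[OF cL]] .
    with le[of n] show "AE t in \<pi>. R (g t) (ae_repr c t)"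
    proof eventually_elim
      case (elim t)
      then show ?case using ord unfolding P1_order_def by blast
    qed
  qed
  have conv: "AE t in \<pi>. \<forall>s. (\<lambda>n. int_minus (?F n t) s) \<longlonglongrightarrow> int_minus (h t) s \<and>
    (\<lambda>n. int_plus (?F n t) s) \<longlonglongrightarrow> int_plus (h t) s"
    using R
  proof
    assume "R = leq_icv \<or> R = (\<lambda>\<mu> \<nu>. leq_icv \<nu> \<mu>)"
    then show ?thesis
    proof (rule icv_monotone_convergence[where F="?F" and h=h and \<kappa>="ae_repr l" and \<nu>="ae_repr u"])
      show "AE t in \<pi>. R (g t) (h t)"
        if "g \<in> measurable \<pi> borel_P1" "\<And>n. AE t in \<pi>. R (g t) (?F n t)" for g
        by (rule glb[OF that])
    qed (rule F hD(1) meas[OF l(1)] meas[OF u(1)] mono lower[OF \<mu>s(1)] upper[OF \<mu>s(1)] hF)+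
  next
    assume "R = leq_icx \<or> R = (\<lambda>\<mu> \<nu>. leq_icx \<nu> \<mu>)"
    then show ?thesis
    proof (rule icx_monotone_convergence[where F="?F" and h=h and \<kappa>="ae_repr l" and \<nu>="ae_repr u"])
      show "AE t in \<pi>. R (g t) (h t)"
        if "g \<in> measurable \<pi> borel_P1" "\<And>n. AE t in \<pi>. R (g t) (?F n t)" for g
        by (rule glb[OF that])
    qed (rule F hD(1) meas[OF l(1)] meas[OF u(1)] mono lower[OF \<mu>s(1)] upper[OF \<mu>s(1)] hF)+
  qed
  have "AE t in \<pi>. \<forall>n. ?F n t \<in> P1" unfolding AE_all_countable using AE_P1[OF F] by blast
  with conv have "AE t in \<pi>. limitin W1_topology (\<lambda>n. ?F n t) (h t) sequentially"
    using AE_P1[OF hD(1)]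
  proof eventually_elim
    case (elim t)
    have "(\<lambda>n. W1 (h t) (?F n t)) \<longlonglongrightarrow> 0"
      using elim by (intro W1_tendsto_0) simp_all
    then show ?case using elim(2,3) by (intro limitin_W1_topology) simp_all
  qed
  then have "AE_W1_tendsto \<pi> \<mu>s (ae_class \<pi> h)"
    unfolding AE_W1_tendsto_iff[OF FL hL(1) r[OF FL] hL(2)] .
  moreover have "is_glb (L0_order \<pi> (L0 \<pi>) R) (ae_class \<pi> h) M"
    by (rule ess_glb_is_glb[OF subset_refl M(1) h hL(1) hD(2) subset_refl])
  ultimately show ?thesis using \<mu>s(1,2) hL(1) by blast
qed

theorem theorem3p8:
  fixes \<pi> :: "'s measure"
  assumes "sigma_finite_measure \<pi>"
  shows
    "(\<forall>\<nu>\<in>L0 \<pi>.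
        dedekind_super_complete_lattice
          ((L0_icv \<pi>)\<lparr>carrier := {\<mu> \<in> L0 \<pi>. \<mu> \<sqsubseteq>\<^bsub>L0_icx \<pi>\<^esub> \<nu>}\<rparr>) \<and>
        dedekind_super_complete_lattice
          ((L0_icx \<pi>)\<lparr>carrier := {\<mu> \<in> L0 \<pi>. \<nu> \<sqsubseteq>\<^bsub>L0_icv \<pi>\<^esub> \<mu>}\<rparr>)) \<and>
     (\<forall>M L. M \<subseteq> L0 \<pi> \<and> M \<noteq> {} \<and>
        Lower (L0_icv \<pi>) M \<noteq> {} \<and> Upper (L0_icx \<pi>) M \<noteq> {} \<and>
        L \<in> {L0_icv \<pi>, L0_icx \<pi>} \<longrightarrow>
        (directed_upwards L M \<longrightarrow>
          (\<exists>\<mu>s \<mu>. (\<forall>n. \<mu>s n \<in> M) \<and>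
             (\<forall>m n. m \<le> n \<longrightarrow> \<mu>s m \<sqsubseteq>\<^bsub>L\<^esub> \<mu>s n) \<and>
             \<mu> \<in> L0 \<pi> \<and> is_lub L \<mu> M \<and> AE_W1_tendsto \<pi> \<mu>s \<mu>)) \<and>
        (directed_downwards L M \<longrightarrow>
          (\<exists>\<mu>s \<mu>. (\<forall>n. \<mu>s n \<in> M) \<and>
             (\<forall>m n. m \<le> n \<longrightarrow> \<mu>s n \<sqsubseteq>\<^bsub>L\<^esub> \<mu>s m) \<and>
             \<mu> \<in> L0 \<pi> \<and> is_glb L \<mu> M \<and> AE_W1_tendsto \<pi> \<mu>s \<mu>)))"
proof -
  note \<pi> = assms
  have icv: "L0_icv \<pi> = L0_order \<pi> (L0 \<pi>) leq_icv" and icx: "L0_icx \<pi> = L0_order \<pi> (L0 \<pi>) leq_icx"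
    by (simp_all add: L0_icv_def L0_icx_def L0_order_def)
  have sub: "(L0_order \<pi> (L0 \<pi>) R)\<lparr>carrier := K\<rparr> = L0_order \<pi> K R" for K R
    by (simp add: L0_order_def)
  have subK: "{\<mu> \<in> L0 \<pi>. P \<mu>} \<subseteq> L0 \<pi>" for P by blast
  have a: "dedekind_super_complete_lattice ((L0_icv \<pi>)\<lparr>carrier := {\<mu> \<in> L0 \<pi>. \<mu> \<sqsubseteq>\<^bsub>L0_icx \<pi>\<^esub> \<nu>}\<rparr>)"
    "dedekind_super_complete_lattice ((L0_icx \<pi>)\<lparr>carrier := {\<mu> \<in> L0 \<pi>. \<nu> \<sqsubseteq>\<^bsub>L0_icv \<pi>\<^esub> \<mu>}\<rparr>)"
    if \<nu>: "\<nu> \<in> L0 \<pi>" for \<nu>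
    unfolding icv icx sub L0_order_simps
    by (rule dedekind_super_complete_L0_order[OF P1_order_leq_icv subK
          glb_complete_icv(2)[OF \<pi> disjI1[OF refl] \<nu>] glb_complete_icv(2)[OF \<pi> disjI2[OF refl] \<nu>]]
        dedekind_super_complete_L0_order[OF P1_order_leq_icx subK
          glb_complete_icx(2)[OF \<pi> disjI1[OF refl] \<nu>] glb_complete_icx(2)[OF \<pi> disjI2[OF refl] \<nu>]])+
  have b: "(directed_upwards L M \<longrightarrow>
          (\<exists>\<mu>s \<mu>. (\<forall>n. \<mu>s n \<in> M) \<and>
             (\<forall>m n. m \<le> n \<longrightarrow> \<mu>s m \<sqsubseteq>\<^bsub>L\<^esub> \<mu>s n) \<and>
             \<mu> \<in> L0 \<pi> \<and> is_lub L \<mu> M \<and> AE_W1_tendsto \<pi> \<mu>s \<mu>)) \<and>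
        (directed_downwards L M \<longrightarrow>
          (\<exists>\<mu>s \<mu>. (\<forall>n. \<mu>s n \<in> M) \<and>
             (\<forall>m n. m \<le> n \<longrightarrow> \<mu>s n \<sqsubseteq>\<^bsub>L\<^esub> \<mu>s m) \<and>
             \<mu> \<in> L0 \<pi> \<and> is_glb L \<mu> M \<and> AE_W1_tendsto \<pi> \<mu>s \<mu>))"
    if M: "M \<subseteq> L0 \<pi>" "M \<noteq> {}" and l: "Lower (L0_icv \<pi>) M \<noteq> {}" and u: "Upper (L0_icx \<pi>) M \<noteq> {}"
      and L: "L \<in> {L0_icv \<pi>, L0_icx \<pi>}" for M L
  proof -
    obtain l where l: "l \<in> L0 \<pi>" "\<forall>x\<in>M. lift_AE \<pi> leq_icv l x"
      using l unfolding icv Lower_L0_order[OF M(1)] by blast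
    obtain u where u: "u \<in> L0 \<pi>" "\<forall>x\<in>M. lift_AE \<pi> leq_icx x u"
      using u unfolding icx Upper_L0_order[OF M(1)] by blast
    obtain R where R: "R = leq_icv \<or> R = leq_icx" and LR: "L = L0_order \<pi> (L0 \<pi>) R"
      using L icv icx by blast
    have ord: "P1_order R" using R P1_order_leq_icv P1_order_leq_icx by blast
    \<comment> \<open>Directedness is expressed by joins and meets in all of
      \<open>L0 \<pi>\<close>. The full carrier must therefore be known to be a lattice before z can
      be compared with x and y separately.\<close>
    have gc: "glb_complete \<pi> (L0 \<pi>) R" "glb_complete \<pi> (L0 \<pi>) (\<lambda>\<mu> \<nu>. R \<nu> \<mu>)"
      using R glb_complete_icv(1)[OF \<pi>] glb_complete_icx(1)[OF \<pi>] by auto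
    have "Lattice.lattice L"
      using dedekind_super_complete_L0_order[OF ord subset_refl gc]
      unfolding LR dedekind_super_complete_lattice_def by blast
    then interpret lattice L .
    have car: "carrier L = L0 \<pi>" and le: "le L = lift_AE \<pi> R" by (simp_all add: LR)
    have R2: "(R = leq_icv \<or> R = (\<lambda>\<mu> \<nu>. leq_icv \<nu> \<mu>)) \<or> (R = leq_icx \<or> R = (\<lambda>\<mu> \<nu>. leq_icx \<nu> \<mu>))"
      "((\<lambda>\<mu> \<nu>. R \<nu> \<mu>) = leq_icv \<or> (\<lambda>\<mu> \<nu>. R \<nu> \<mu>) = (\<lambda>\<mu> \<nu>. leq_icv \<nu> \<mu>)) \<or>
       ((\<lambda>\<mu> \<nu>. R \<nu> \<mu>) = leq_icx \<or> (\<lambda>\<mu> \<nu>. R \<nu> \<mu>) = (\<lambda>\<mu> \<nu>. leq_icx \<nu> \<mu>))"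
      using R by auto
    have MC: "x \<in> carrier L" if "x \<in> M" for x using that M(1) car by blast
    show ?thesis
    proof (intro conjI impI)
      assume dir: "directed_upwards L M"
      have "\<exists>z\<in>M. lift_AE \<pi> (\<lambda>\<mu> \<nu>. R \<nu> \<mu>) z x \<and> lift_AE \<pi> (\<lambda>\<mu> \<nu>. R \<nu> \<mu>) z y"
        if x: "x \<in> M" and y: "y \<in> M" for x y
      proof -
        obtain z where z: "z \<in> M" "x \<squnion>\<^bsub>L\<^esub> y \<sqsubseteq>\<^bsub>L\<^esub> z"
          using dir x y unfolding directed_upwards_def by blast
        note c = MC[OF x] MC[OF y] MC[OF z(1)]
        have "x \<sqsubseteq>\<^bsub>L\<^esub> z" "y \<sqsubseteq>\<^bsub>L\<^esub> z"
          using le_trans[OF join_left[OF c(1,2)] z(2)] le_trans[OF join_right[OF c(1,2)] z(2)]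
            c join_closed by blast+
        then show ?thesis using z(1) unfolding lift_AE_converse[of \<pi> R] le by blast
      qed
      then have "\<forall>x\<in>M. \<forall>y\<in>M. \<exists>z\<in>M. lift_AE \<pi> (\<lambda>\<mu> \<nu>. R \<nu> \<mu>) z x \<and> lift_AE \<pi> (\<lambda>\<mu> \<nu>. R \<nu> \<mu>) z y"
        by blast
      from directed_limit[OF \<pi> R2(2) M l u this]
      show "\<exists>\<mu>s \<mu>. (\<forall>n. \<mu>s n \<in> M) \<and> (\<forall>m n. m \<le> n \<longrightarrow> \<mu>s m \<sqsubseteq>\<^bsub>L\<^esub> \<mu>s n) \<and>
             \<mu> \<in> L0 \<pi> \<and> is_lub L \<mu> M \<and> AE_W1_tendsto \<pi> \<mu>s \<mu>"
        unfolding LR is_lub_L0_order[OF M(1)] L0_order_simps lift_AE_converse[of \<pi> R] .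
    next
      assume dir: "directed_downwards L M"
      have "\<exists>z\<in>M. lift_AE \<pi> R z x \<and> lift_AE \<pi> R z y" if x: "x \<in> M" and y: "y \<in> M" for x y
      proof -
        obtain z where z: "z \<in> M" "z \<sqsubseteq>\<^bsub>L\<^esub> x \<sqinter>\<^bsub>L\<^esub> y"
          using dir x y unfolding directed_downwards_def by blast
        note c = MC[OF x] MC[OF y] MC[OF z(1)]
        have "z \<sqsubseteq>\<^bsub>L\<^esub> x" "z \<sqsubseteq>\<^bsub>L\<^esub> y"
          using le_trans[OF z(2) meet_left[OF c(1,2)]] le_trans[OF z(2) meet_right[OF c(1,2)]]
            c meet_closed by blast+
        then show ?thesis using z(1) unfolding le by blast
      qed
      then have "\<forall>x\<in>M. \<forall>y\<in>M. \<exists>z\<in>M. lift_AE \<pi> R z x \<and> lift_AE \<pi> R z y" by blast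
      from directed_limit[OF \<pi> R2(1) M l u this]
      show "\<exists>\<mu>s \<mu>. (\<forall>n. \<mu>s n \<in> M) \<and> (\<forall>m n. m \<le> n \<longrightarrow> \<mu>s n \<sqsubseteq>\<^bsub>L\<^esub> \<mu>s m) \<and>
             \<mu> \<in> L0 \<pi> \<and> is_glb L \<mu> M \<and> AE_W1_tendsto \<pi> \<mu>s \<mu>"
        unfolding LR L0_order_simps .
    qed
  qed
  show ?thesis
    by (rule conjI, intro ballI conjI a, assumption+, intro allI impI, elim conjE, rule b; assumption)
qed

end
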